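(* For every $\varphi\in\mathscr K(\mathbb R^d)$ and every $k\in\mathbb Z$, $$e^{ik\pi\mathscr L}\varphi(x)=\varphi((-1)^kx)=\mathcal R^k\varphi(x),$$ and hence $e^{i\pi\mathscr L}=\mathcal R$ and $e^{i2\pi\mathscr L}=I$. Moreover, $$e^{-|x|^2/4}\left(e^{i(\frac\pi2+k\pi)\mathscr L}\varphi\right)(x)=(4\pi)^{-d/2}\,\mathscr F\!\left(e^{-|\cdot|^2/4}\varphi\right)\left(\frac{(-1)^kx}{4\pi}\right).$$ By density, all these identities extend as identities in $L^2(\mathbb R^d,d\gamma)$.
   Context: $d\gamma(x)=(2\pi)^{-d/2}e^{-|x|^2/2}dx$ on $\mathbb R^d$ and $\mathscr L=\Delta-\langle x,\nabla\rangle$ with its natural self-adjoint realization in $L^2(\mathbb R^d,d\gamma)$ (the Hermite polynomials $H_\alpha$ form a complete orthogonal system with $\mathscr L H_\alpha=-|\alpha|H_\alpha$); $\{e^{it\mathscr L}\}_{t\in\mathbb R}$ is the associated unitary group on $L^2(\mathbb R^d,d\gamma)$. $\mathscr K(\mathbb R^d)=\{\varphi\in C^\infty(\mathbb R^d): e^{-|x|^2/4}\varphi\in\mathscr S(\mathbb R^d)\}$, with $\mathscr S$ the Schwartz space. $(\mathcal R\varphi)(x)=\varphi(-x)$. The Fourier transform is $\mathscr F(f)(\xi)=\int_{\mathbb R^d}e^{-2\pi i\langle\xi,x\rangle}f(x)\,dx$ (extended to $L^2$ by Plancherel). *)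

theory Defs
  imports "HOL-Analysis.Analysis" "HOL-Computational_Algebra.Polynomial"
begin

section \<open>Square-integrable functions\<close>

text \<open>Elements of an \<open>L\<^sup>2\<close> space are handled through (Borel) representatives; identities in
  \<open>L\<^sup>2\<close> are therefore stated almost everywhere.\<close>

definition L2 :: "'a measure \<Rightarrow> ('a \<Rightarrow> complex) set" where
  "L2 M = {f \<in> borel_measurable M. integrable M (\<lambda>x. (cmod (f x))\<^sup>2)}"

definition L2_inner :: "'a measure \<Rightarrow> ('a \<Rightarrow> complex) \<Rightarrow> ('a \<Rightarrow> complex) \<Rightarrow> complex" where
  "L2_inner M f g = (LINT x|M. f x * cnj (g x))"

text \<open>The distance is taken with values in \<open>[0, \<infinity>]\<close>, so that a non-integrable difference is
  never at distance \<open>0\<close>.\<close>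

definition L2_tendsto ::
    "'a measure \<Rightarrow> ('i \<Rightarrow> 'a \<Rightarrow> complex) \<Rightarrow> ('a \<Rightarrow> complex) \<Rightarrow> 'i filter \<Rightarrow> bool" where
  "L2_tendsto M u f F \<longleftrightarrow>
     ((\<lambda>n. \<integral>\<^sup>+x. ennreal ((cmod (u n x - f x))\<^sup>2) \<partial>M) \<longlongrightarrow> 0) F"

definition gauss :: "(real ^ 'n) measure" where
  "gauss = density lborel
     (\<lambda>x. ennreal ((2 * pi) powr (- real CARD('n) / 2) * exp (- (norm x)\<^sup>2 / 2)))"


section \<open>Smooth functions, the Schwartz space and the space \<open>\<K>\<close>\<close>

definition partial :: "'n \<Rightarrow> (real ^ 'n \<Rightarrow> complex) \<Rightarrow> real ^ 'n \<Rightarrow> complex" where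
  "partial i f x = frechet_derivative f (at x) (axis i 1)"

definition partials :: "'n list \<Rightarrow> (real ^ 'n \<Rightarrow> complex) \<Rightarrow> real ^ 'n \<Rightarrow> complex" where
  "partials is f = foldr partial is f"

definition smooth :: "(real ^ 'n \<Rightarrow> complex) \<Rightarrow> bool" where
  "smooth f \<longleftrightarrow> (\<forall>is x. partials is f differentiable (at x))"

definition schwartz :: "(real ^ 'n \<Rightarrow> complex) set" where
  "schwartz = {f. smooth f \<and>
     (\<forall>is (N::nat). bounded (range (\<lambda>x. (norm x) ^ N *\<^sub>R partials is f x)))}"

definition K_space :: "(real ^ 'n \<Rightarrow> complex) set" where
  "K_space = {\<phi>. smooth \<phi> \<and> (\<lambda>x. of_real (exp (- (norm x)\<^sup>2 / 4)) * \<phi> x) \<in> schwartz}"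


section \<open>Hermite polynomials and the Ornstein--Uhlenbeck operator\<close>

definition ou_expr :: "(real ^ 'n \<Rightarrow> complex) \<Rightarrow> real ^ 'n \<Rightarrow> complex" where
  "ou_expr f x = (\<Sum>i\<in>UNIV. partial i (partial i f) x) - (\<Sum>i\<in>UNIV. of_real (x $ i) * partial i f x)"

text \<open>Probabilists' normalization: \<open>H\<^sub>n(x) = (-1)\<^sup>n e\<^bsup>x\<^sup>2/2\<^esup> (d/dx)\<^sup>n e\<^bsup>-x\<^sup>2/2\<^esup>\<close>, which amounts to
  \<open>H\<^sub>n\<^sub>+\<^sub>1 = x H\<^sub>n - H\<^sub>n'\<close>.\<close>

fun hermite_poly :: "nat \<Rightarrow> real poly" where
  "hermite_poly 0 = 1"
| "hermite_poly (Suc n) = [:0, 1:] * hermite_poly n - pderiv (hermite_poly n)"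

definition hermite :: "nat ^ 'n \<Rightarrow> real ^ 'n \<Rightarrow> complex" where
  "hermite \<alpha> x = of_real (\<Prod>i\<in>UNIV. poly (hermite_poly (\<alpha> $ i)) (x $ i))"

definition ou_eigenvalue :: "nat ^ 'n \<Rightarrow> real" where
  "ou_eigenvalue \<alpha> = (THE l. \<forall>x. ou_expr (hermite \<alpha>) x = of_real l * hermite \<alpha> x)"

lemma rodrigues:
  "(deriv ^^ n) (\<lambda>y. exp (- y\<^sup>2 / 2)) = (\<lambda>y::real. (-1) ^ n * poly (hermite_poly n) y * exp (- y\<^sup>2 / 2))"
proof (induction n)
  case (Suc n)
  show ?case
  proof
    fix y :: real
    have "((\<lambda>y::real. (-1) ^ n * poly (hermite_poly n) y * exp (- y\<^sup>2 / 2)) has_real_derivative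
        (-1) ^ Suc n * poly (hermite_poly (Suc n)) y * exp (- y\<^sup>2 / 2)) (at y)"
      by (auto intro!: derivative_eq_intros simp: algebra_simps)
    then show "(deriv ^^ Suc n) (\<lambda>y. exp (- y\<^sup>2 / 2)) y =
        (-1) ^ Suc n * poly (hermite_poly (Suc n)) y * exp (- y\<^sup>2 / 2)"
      using Suc by (simp add: DERIV_imp_deriv)
  qed
qed auto

lemma pderiv_of_nat_mult: "pderiv (of_nat m * p) = of_nat m * pderiv (p :: real poly)"
  by (simp add: of_nat_poly pderiv_smult)

lemma hermite_poly_ode:
  "pderiv (pderiv (hermite_poly n)) - [:0, 1:] * pderiv (hermite_poly n) = - of_nat n * hermite_poly n"
  and pderiv_hermite_poly_Suc: "pderiv (hermite_poly (Suc n)) = of_nat (Suc n) * hermite_poly n"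
proof -
  have x: "pderiv [:0, 1::real:] = 1" by (simp add: pderiv_pCons)
  have d: "pderiv (hermite_poly (Suc n)) = of_nat (Suc n) * hermite_poly n"
    if "pderiv (pderiv (hermite_poly n)) - [:0, 1:] * pderiv (hermite_poly n) = - of_nat n * hermite_poly n" for n
    using that unfolding hermite_poly.simps pderiv_diff pderiv_mult x
    by (simp add: algebra_simps)
  show ode: "pderiv (pderiv (hermite_poly n)) - [:0, 1:] * pderiv (hermite_poly n) = - of_nat n * hermite_poly n" for n
  proof (induction n)
    case 0
    show ?case by (simp add: pderiv_1)
  next
    case (Suc n)
    show ?case unfolding d[OF Suc] pderiv_of_nat_mult unfolding hermite_poly.simps
      by (simp only: right_diff_distrib left_diff_distrib) (simp add: algebra_simps)
  qed
  show "pderiv (hermite_poly (Suc n)) = of_nat (Suc n) * hermite_poly n"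
    by (rule d[OF ode])
qed

lemma hermite_poly_nonzero: "hermite_poly n \<noteq> 0"
proof (induction n)
  case (Suc n)
  have "pderiv (hermite_poly (Suc n)) \<noteq> 0"
    unfolding pderiv_hermite_poly_Suc using Suc by (simp add: of_nat_poly del: of_nat_Suc)
  then show ?case by (metis pderiv_0)
qed simp

lemma partial_tensor:
  fixes p :: "'n::finite \<Rightarrow> real poly"
  shows "partial i (\<lambda>x. of_real (\<Prod>j\<in>UNIV. poly (p j) (x $ j))) =
    (\<lambda>x. of_real (\<Prod>j\<in>UNIV. poly ((p(i := pderiv (p i))) j) (x $ j)))"
proof
  fix x :: "real ^ 'n"
  have c: "((\<lambda>x::real^'n. poly (p j) (x $ j)) has_derivative (\<lambda>h. poly (pderiv (p j)) (x $ j) * h $ j)) (at x)" for j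
  proof -
    have "((\<lambda>x::real^'n. x $ j) has_derivative (\<lambda>h. h $ j)) (at x)"
      by (intro bounded_linear_imp_has_derivative bounded_linear_vec_nth)
    from has_derivative_compose[OF this
        has_field_derivative_imp_has_derivative[OF poly_DERIV[of "p j" "x $ j"]]]
    show ?thesis by simp
  qed
  have D: "((\<lambda>x::real^'n. complex_of_real (\<Prod>j\<in>UNIV. poly (p j) (x $ j))) has_derivative
      (\<lambda>h. of_real (\<Sum>k\<in>UNIV. poly (pderiv (p k)) (x $ k) * h $ k * (\<Prod>j\<in>UNIV - {k}. poly (p j) (x $ j))))) (at x)"
    by (rule has_derivative_of_real[OF has_derivative_prod[OF c]])
  have "partial i (\<lambda>x. of_real (\<Prod>j\<in>UNIV. poly (p j) (x $ j))) x =
      of_real (\<Sum>k\<in>UNIV. poly (pderiv (p k)) (x $ k) * (axis i 1 :: real^'n) $ k * (\<Prod>j\<in>UNIV - {k}. poly (p j) (x $ j)))"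
    unfolding partial_def by (rule fun_cong[OF frechet_derivative_at[OF D], symmetric])
  also have "(\<Sum>k\<in>UNIV. poly (pderiv (p k)) (x $ k) * (axis i 1 :: real^'n) $ k * (\<Prod>j\<in>UNIV - {k}. poly (p j) (x $ j)))
      = (\<Sum>k\<in>UNIV. if k = i then poly (pderiv (p i)) (x $ i) * (\<Prod>j\<in>UNIV - {i}. poly (p j) (x $ j)) else 0)"
    by (intro sum.cong) (auto simp: axis_def)
  also have "\<dots> = (\<Prod>j\<in>UNIV. poly ((p(i := pderiv (p i))) j) (x $ j))"
    by (simp add: prod.remove[of UNIV i])
  finally show "partial i (\<lambda>x. of_real (\<Prod>j\<in>UNIV. poly (p j) (x $ j))) x =
      of_real (\<Prod>j\<in>UNIV. poly ((p(i := pderiv (p i))) j) (x $ j))" .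
qed

lemma ou_expr_hermite:
  "ou_expr (hermite \<alpha>) x = of_real (- real (\<Sum>i\<in>UNIV. \<alpha> $ i)) * hermite \<alpha> x"
proof -
  define p where "p = (\<lambda>i. hermite_poly (\<alpha> $ i))"
  define R where "R i = (\<Prod>j\<in>UNIV - {i}. poly (p j) (x $ j))" for i
  have split: "(\<Prod>j\<in>UNIV. poly ((p(i := q)) j) (x $ j)) = poly q (x $ i) * R i" for i q
    by (simp add: prod.remove[of UNIV i] R_def)
  have H: "hermite \<alpha> = (\<lambda>x. of_real (\<Prod>j\<in>UNIV. poly (p j) (x $ j)))"
    by (auto simp: hermite_def p_def)
  have H': "hermite \<alpha> x = of_real (poly (p i) (x $ i) * R i)" for i
    unfolding H split[of i "p i", symmetric] by simp
  have "partial i (partial i (hermite \<alpha>)) x - of_real (x $ i) * partial i (hermite \<alpha>) x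
      = of_real (- real (\<alpha> $ i)) * hermite \<alpha> x" for i
  proof -
    have "poly (pderiv (pderiv (p i)) - [:0, 1:] * pderiv (p i)) (x $ i)
        = - real (\<alpha> $ i) * poly (p i) (x $ i)"
      unfolding p_def hermite_poly_ode by (simp add: of_nat_poly)
    then have "poly (pderiv (pderiv (p i))) (x $ i) - x $ i * poly (pderiv (p i)) (x $ i)
        = - real (\<alpha> $ i) * poly (p i) (x $ i)"
      by simp
    then have "(poly (pderiv (pderiv (p i))) (x $ i) - x $ i * poly (pderiv (p i)) (x $ i)) * R i
        = - real (\<alpha> $ i) * poly (p i) (x $ i) * R i"
      by simp
    then have "poly (pderiv (pderiv (p i))) (x $ i) * R i - x $ i * (poly (pderiv (p i)) (x $ i) * R i)
        = - real (\<alpha> $ i) * (poly (p i) (x $ i) * R i)"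
      by (simp only: left_diff_distrib mult.assoc)
    then show ?thesis
      unfolding H'[of i] unfolding H partial_tensor split fun_upd_same fun_upd_upd
      by (metis of_real_diff of_real_mult)
  qed
  then have "ou_expr (hermite \<alpha>) x = (\<Sum>i\<in>UNIV. of_real (- real (\<alpha> $ i)) * hermite \<alpha> x)"
    unfolding ou_expr_def sum_subtractf[symmetric] by simp
  then show ?thesis
    by (simp add: sum_distrib_right[symmetric] sum_negf)
qed

lemma hermite_nonzero: "\<exists>x. hermite \<alpha> x \<noteq> 0"
proof -
  have "\<exists>t. poly (hermite_poly n) t \<noteq> 0" for n
    using hermite_poly_nonzero[of n] poly_all_0_iff_0 by blast
  then obtain t where t: "\<And>n. poly (hermite_poly n) (t n) \<noteq> 0" by metis
  have "hermite \<alpha> (\<chi> i. t (\<alpha> $ i)) \<noteq> 0"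
    unfolding hermite_def by (simp add: t)
  then show ?thesis ..
qed

lemma ou_eigenvalue_eq: "ou_eigenvalue \<alpha> = - real (\<Sum>i\<in>UNIV. \<alpha> $ i)"
  unfolding ou_eigenvalue_def
proof (rule the_equality)
  show "\<forall>x. ou_expr (hermite \<alpha>) x = of_real (- real (\<Sum>i\<in>UNIV. \<alpha> $ i)) * hermite \<alpha> x"
    by (simp add: ou_expr_hermite)
  fix l
  assume l: "\<forall>x. ou_expr (hermite \<alpha>) x = of_real l * hermite \<alpha> x"
  obtain x where "hermite \<alpha> x \<noteq> 0" using hermite_nonzero by blast
  then show "l = - real (\<Sum>i\<in>UNIV. \<alpha> $ i)"
    using l ou_expr_hermite[of \<alpha> x] by (metis mult_right_cancel of_real_eq_iff)
qed


section \<open>The unitary group\<close>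

text \<open>Functional calculus of the self-adjoint realization of \<open>\<L>\<close>, which is diagonal in the
  complete orthogonal system of Hermite polynomials: \<open>m(\<L>) f\<close> is the unconditional
  \<open>L\<^sup>2(\<gamma>)\<close>-sum of \<open>m(\<lambda>\<^sub>\<alpha>) \<langle>f, H\<^sub>\<alpha>\<rangle> / \<parallel>H\<^sub>\<alpha>\<parallel>\<^sup>2 H\<^sub>\<alpha>\<close>, where \<open>\<L> H\<^sub>\<alpha> = \<lambda>\<^sub>\<alpha> H\<^sub>\<alpha>\<close>. For \<open>m = id\<close> this is \<open>\<L>\<close>
  on its domain. The value is a representative, determined up to \<open>\<gamma>\<close>-null sets.\<close>

definition hermite_coeff :: "(real ^ 'n \<Rightarrow> complex) \<Rightarrow> nat ^ 'n \<Rightarrow> complex" where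
  "hermite_coeff f \<alpha> = L2_inner gauss f (hermite \<alpha>) / L2_inner gauss (hermite \<alpha>) (hermite \<alpha>)"

definition ou_calculus ::
    "(real \<Rightarrow> complex) \<Rightarrow> (real ^ 'n \<Rightarrow> complex) \<Rightarrow> real ^ 'n \<Rightarrow> complex" where
  "ou_calculus m f = (SOME g. g \<in> L2 gauss \<and>
     L2_tendsto gauss
       (\<lambda>A x. \<Sum>\<alpha>\<in>A. m (ou_eigenvalue \<alpha>) * hermite_coeff f \<alpha> * hermite \<alpha> x) g
       (finite_subsets_at_top UNIV))"

definition ou_group :: "real \<Rightarrow> (real ^ 'n \<Rightarrow> complex) \<Rightarrow> real ^ 'n \<Rightarrow> complex" where
  "ou_group t = ou_calculus (\<lambda>s. exp (\<i> * of_real t * of_real s))"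


section \<open>Reflection and Fourier transform\<close>

definition reflect :: "(real ^ 'n \<Rightarrow> complex) \<Rightarrow> real ^ 'n \<Rightarrow> complex" where
  "reflect f x = f (- x)"

definition int_iterate :: "('a \<Rightarrow> 'a) \<Rightarrow> int \<Rightarrow> 'a \<Rightarrow> 'a" where
  "int_iterate T k = (if k \<ge> 0 then T ^^ nat k else (inv T) ^^ nat (- k))"

definition fourier :: "(real ^ 'n \<Rightarrow> complex) \<Rightarrow> real ^ 'n \<Rightarrow> complex" where
  "fourier f \<xi> = (LINT x|lborel. exp (- 2 * of_real pi * \<i> * of_real (\<xi> \<bullet> x)) * f x)"

text \<open>Plancherel extension: the closure in \<open>L\<^sup>2 \<times> L\<^sup>2\<close> of the Fourier integral on
  \<open>L\<^sup>1 \<inter> L\<^sup>2\<close>; again determined up to null sets.\<close>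

definition fourier_L2 :: "(real ^ 'n \<Rightarrow> complex) \<Rightarrow> real ^ 'n \<Rightarrow> complex" where
  "fourier_L2 f = (SOME g. g \<in> L2 lborel \<and>
     (\<exists>u::nat \<Rightarrow> real ^ 'n \<Rightarrow> complex. (\<forall>n. u n \<in> L2 lborel \<and> integrable lborel (u n)) \<and>
        L2_tendsto lborel u f sequentially \<and>
        L2_tendsto lborel (\<lambda>n. fourier (u n)) g sequentially))"

end

theory Submission
  imports Defs "HOL-Probability.Probability"
begin

text \<open>
  In the orthogonal system of Hermite polynomials the group is diagonal: \<open>e\<^bsup>it\<L>\<^esup>\<close> multiplies \<open>H\<^sub>\<alpha>\<close> by the phase
  \<open>e\<^bsup>-it|\<alpha>|\<^esup>\<close>. At \<open>t = k\<pi>\<close> the phase is \<open>(-1)\<^bsup>k|\<alpha>|\<^esup>\<close>. This is the effect on \<open>H\<^sub>\<alpha>\<close> of the substitution \<open>x \<mapsto> (-1)\<^sup>k x\<close>,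
  since \<open>H\<^sub>\<alpha>\<close> has the parity of \<open>|\<alpha>|\<close> (\<open>hermite_minus\<close>). At \<open>t = \<pi>/2 + k\<pi>\<close> there is a further factor
  \<open>(-i)\<^bsup>|\<alpha>|\<^esup>\<close>. This is, up to the constant \<open>(4\<pi>)\<^bsup>d/2\<^esup>\<close>, the eigenvalue of the Fourier transform with kernel
  \<open>e\<^bsup>-i\<langle>x,y\<rangle>/2\<^esup>\<close> on \<open>e\<^bsup>-|y|\<^sup>2/4\<^esup> H\<^sub>\<alpha>(y)\<close> (\<open>fourier_hermite\<close>).

  So in each identity both sides have the same integrals against all \<open>H\<^sub>\<alpha>\<close>, and it remains to see that these
  determine a function. This is \<open>hermite_complete\<close>, for all functions that stay \<open>\<gamma>\<close>-integrable after
  multiplication by any \<open>e\<^bsup>c|x|\<^esup>\<close>. That class is larger than \<open>L\<^sup>2(\<gamma>)\<close>: it contains \<open>e\<^bsup>|x|\<^sup>2/4\<^esup>\<close> times the Fourier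
  transform of any integrable function. If \<open>g\<close> in the class is orthogonal to all \<open>H\<^sub>\<alpha>\<close>, then expanding the
  exponential shows \<open>\<integral> g e\<^bsup>i\<langle>\<xi>,x\<rangle>\<^esup> d\<gamma> = 0\<close> for all \<open>\<xi>\<close>, hence \<open>g d\<gamma>\<close> annihilates all polynomials in
  \<open>sin (x\<^sub>1/r), \<dots>, sin (x\<^sub>d/r)\<close>. By the Weierstrass approximation theorem it annihilates
  \<open>G (r sin (x\<^sub>1/r), \<dots>, r sin (x\<^sub>d/r))\<close> for bounded continuous \<open>G\<close>, and as \<open>r \<rightarrow> \<infinity>\<close> also \<open>G\<close> itself.

  The group and the Fourier transform on \<open>L\<^sup>2\<close> are given by choice, so the objects chosen must be shown to exist.
  For the group this is Bessel's inequality together with the Riesz--Fischer argument (\<open>hermite_series\<close>). For the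
  Fourier transform the weighted partial sums of the Hermite expansion of \<open>f\<close> serve as approximating sequence
  (\<open>is_fourier_L2_exists\<close>), and the multiplication formula \<open>\<integral> \<F>u h = \<integral> u \<F>h\<close>, which is continuous in
  \<open>L\<^sup>2\<close>, computes the Hermite integrals of any value that can be chosen (\<open>ou_group_half_is_fourier_L2\<close>).
\<close>

section \<open>Gaussian integrals in several dimensions\<close>

text \<open>Products over the standard basis, whose members are vectors, turn into products over the index type;
  this is what connects the construction of Lebesgue measure with coordinates.\<close>

lemma prod_Basis_vec:
  fixes g :: "'n::finite \<Rightarrow> 'b::comm_monoid_mult"
  shows "(\<Prod>b\<in>(Basis :: (real^'n) set). g (THE i. b = axis i 1)) = (\<Prod>i\<in>UNIV. g i)"
proof -
  have B: "(Basis :: (real^'n) set) = range (\<lambda>i. axis i 1)"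
    by (auto simp: Basis_vec_def)
  have inj: "inj (\<lambda>i. axis i 1 :: real^'n)"
    by (rule injI) (simp add: axis_eq_axis)
  have "(THE j. (axis i 1 :: real^'n) = axis j 1) = i" for i
    by (rule the_equality) (auto simp: axis_eq_axis)
  then show ?thesis
    unfolding B by (subst prod.reindex[OF inj]) simp
qed

text \<open>Lebesgue measure on \<open>real ^ 'n\<close> is a product measure, so Fubini reduces everything that is a product
  over the coordinates, in particular Gaussians and Hermite polynomials, to dimension one.\<close>

lemma
  fixes f :: "'n::finite \<Rightarrow> real \<Rightarrow> complex"
  assumes f: "\<And>i. integrable lborel (f i)"
  shows integrable_lborel_prod: "integrable lborel (\<lambda>x::real^'n. \<Prod>i\<in>UNIV. f i (x $ i))"
    and integral_lborel_prod:
      "(LINT x|lborel. (\<Prod>i\<in>UNIV. f i ((x::real^'n) $ i))) = (\<Prod>i\<in>UNIV. LINT t|lborel. f i t)"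
proof -
  interpret product_sigma_finite "\<lambda>_::real^'n. lborel :: real measure"
    by (rule product_sigma_finite.intro) (rule lborel.sigma_finite_measure_axioms)
  define ix where "ix b = (THE i. b = axis i 1)" for b :: "real^'n"
  define F where "F b = f (ix b)" for b :: "real^'n"
  have [measurable]: "f i \<in> borel_measurable borel" for i
    using f[of i] by auto
  have ixB: "b = axis (ix b) 1" if "b \<in> Basis" for b :: "real^'n"
    using that unfolding ix_def by (auto simp: Basis_vec_def axis_eq_axis)
  have eq: "(\<Prod>i\<in>UNIV. f i ((\<Sum>b\<in>(Basis::(real^'n) set). y b *\<^sub>R b) $ i)) = (\<Prod>b\<in>(Basis::(real^'n) set). F b (y b))"
    for y :: "real^'n \<Rightarrow> real"
  proof -
    have "(\<Sum>b\<in>(Basis::(real^'n) set). y b *\<^sub>R b) $ ix c = y c" if c: "c \<in> Basis" for c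
    proof -
      have "(\<Sum>b\<in>(Basis::(real^'n) set). y b *\<^sub>R b) \<bullet> c = y c"
        using c by (rule inner_sum_left_Basis)
      moreover have "v \<bullet> c = v $ ix c" for v :: "real^'n"
        using ixB[OF c] by (metis inner_axis inner_real_def mult_1_right)
      ultimately show ?thesis by simp
    qed
    then have "(\<Prod>b\<in>(Basis::(real^'n) set). F b (y b)) = (\<Prod>b\<in>(Basis::(real^'n) set). (\<lambda>i. f i ((\<Sum>b\<in>(Basis::(real^'n) set). y b *\<^sub>R b) $ i)) (THE i. b = axis i 1))"
      unfolding F_def ix_def by (intro prod.cong) auto
    also have "\<dots> = (\<Prod>i\<in>UNIV. f i ((\<Sum>b\<in>(Basis::(real^'n) set). y b *\<^sub>R b) $ i))"
      by (rule prod_Basis_vec)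
    finally show ?thesis ..
  qed
  have M: "(\<lambda>y. \<Sum>b\<in>(Basis::(real^'n) set). y b *\<^sub>R b) \<in> measurable (\<Pi>\<^sub>M b\<in>Basis. lborel) borel"
    by measurable
  have fm: "(\<lambda>x::real^'n. \<Prod>i\<in>UNIV. f i (x $ i)) \<in> borel_measurable borel"
    by measurable
  have Fint: "integrable lborel (F b)" for b using f by (simp add: F_def)
  have "integrable (\<Pi>\<^sub>M b\<in>(Basis::(real^'n) set). lborel) (\<lambda>x. \<Prod>b\<in>Basis. F b (x b))"
    by (rule product_integrable_prod) (auto simp: Fint)
  then show "integrable lborel (\<lambda>x::real^'n. \<Prod>i\<in>UNIV. f i (x $ i))"
    unfolding lborel_eq[where 'a="real^'n"] integrable_distr_eq[OF M fm] eq .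
  have "(LINT x|lborel. (\<Prod>i\<in>UNIV. f i ((x::real^'n) $ i))) = (\<integral>x. (\<Prod>b\<in>(Basis::(real^'n) set). F b (x b)) \<partial>(\<Pi>\<^sub>M b\<in>(Basis::(real^'n) set). lborel))"
    unfolding lborel_eq[where 'a="real^'n"] integral_distr[OF M fm] eq ..
  also have "\<dots> = (\<Prod>b\<in>(Basis::(real^'n) set). LINT t|lborel. F b t)"
    by (rule product_integral_prod) (auto simp: Fint)
  also have "\<dots> = (\<Prod>i\<in>UNIV. LINT t|lborel. f i t)"
    unfolding F_def ix_def by (rule prod_Basis_vec)
  finally show "(LINT x|lborel. (\<Prod>i\<in>UNIV. f i ((x::real^'n) $ i))) = (\<Prod>i\<in>UNIV. LINT t|lborel. f i t)" .
qed

lemma power_le_fact_exp: "t \<ge> 0 \<Longrightarrow> t ^ n \<le> fact n * exp (t::real)"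
proof -
  assume t: "t \<ge> 0"
  have "t ^ n /\<^sub>R fact n \<le> exp t"
    unfolding exp_def using t sum_le_suminf[OF summable_exp_generic[of t], of "{n}"] by simp
  then show ?thesis by (simp add: field_simps)
qed

text \<open>Exponential rather than polynomial majorants are used throughout: they multiply well and are
  absorbed by every Gaussian.\<close>

lemma poly_exp_bound:
  fixes p :: "real poly"
  obtains C where "C \<ge> 0" "\<And>t. \<bar>poly p t\<bar> \<le> C * exp \<bar>t\<bar>"
proof
  define C where "C = (\<Sum>i\<le>degree p. \<bar>coeff p i\<bar> * fact i)"
  show "C \<ge> 0" unfolding C_def by (intro sum_nonneg) auto
  fix t
  have "\<bar>poly p t\<bar> \<le> (\<Sum>i\<le>degree p. \<bar>coeff p i * t ^ i\<bar>)"
    unfolding poly_altdef by (rule sum_abs)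
  also have "\<dots> \<le> (\<Sum>i\<le>degree p. \<bar>coeff p i\<bar> * (fact i * exp \<bar>t\<bar>))"
    by (intro sum_mono) (auto simp: abs_mult power_abs intro!: mult_left_mono power_le_fact_exp)
  also have "\<dots> = C * exp \<bar>t\<bar>"
    by (simp add: C_def sum_distrib_right mult.assoc)
  finally show "\<bar>poly p t\<bar> \<le> C * exp \<bar>t\<bar>" .
qed

lemma integrable_gaussian_real: "a > 0 \<Longrightarrow> integrable lborel (\<lambda>t::real. exp (- a * t\<^sup>2))"
proof -
  assume a: "a > 0"
  have "integrable lborel (\<lambda>t. std_normal_density (0 + sqrt (2 * a) * t))"
    using a by (intro lborel_integrable_real_affine) auto
  then have "integrable lborel (\<lambda>t. sqrt (2 * pi) * std_normal_density (0 + sqrt (2 * a) * t))"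
    by (rule integrable_mult_right)
  then show ?thesis
    using a by (simp add: std_normal_density_def power_mult_distrib)
qed

text \<open>Completing the square; it trades a factor \<open>e\<^bsup>c|x|\<^esup>\<close> for half of the Gaussian exponent.\<close>

lemma linear_le_quadratic:
  fixes a c s :: real
  assumes "a > 0"
  shows "c * s \<le> c\<^sup>2 / (2 * a) + a * s\<^sup>2 / 2"
proof -
  have "0 \<le> (c - a * s)\<^sup>2 / (2 * a)" using assms by auto
  also have "\<dots> = c\<^sup>2 / (2 * a) + a * s\<^sup>2 / 2 - c * s"
    using assms by (simp add: power2_eq_square field_simps)
  finally show ?thesis by simp
qed

lemma integrable_exp_gaussian_real:
  assumes "a > 0" shows "integrable lborel (\<lambda>t::real. exp (c * \<bar>t\<bar> - a * t\<^sup>2))"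
proof (rule Bochner_Integration.integrable_bound)
  show "integrable lborel (\<lambda>t::real. exp (c\<^sup>2 / (2 * a)) * exp (- (a / 2) * t\<^sup>2))"
    using assms by (intro integrable_mult_right integrable_gaussian_real) auto
  have "exp (c * \<bar>t\<bar> - a * t\<^sup>2) \<le> exp (c\<^sup>2 / (2 * a)) * exp (- (a / 2) * t\<^sup>2)" for t :: real
    using linear_le_quadratic[OF assms, of c "\<bar>t\<bar>"] unfolding exp_add[symmetric] by (simp add: algebra_simps)
  then show "AE t in lborel. norm (exp (c * \<bar>t\<bar> - a * t\<^sup>2)) \<le> norm (exp (c\<^sup>2 / (2 * a)) * exp (- (a / 2) * (t::real)\<^sup>2))"
    by auto
qed auto

lemma norm_vec_square: "(norm (x::real^'n))\<^sup>2 = (\<Sum>i\<in>UNIV. (x $ i)\<^sup>2)"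
  unfolding power2_norm_eq_inner inner_vec_def by (simp add: power2_eq_square)

lemma exp_norm_square_prod: "exp (- a * (norm (x::real^'n))\<^sup>2) = (\<Prod>i\<in>UNIV. exp (- a * (x $ i)\<^sup>2))"
  by (simp add: norm_vec_square sum_distrib_left exp_sum[symmetric] sum_negf)

lemma integrable_gaussian_vec:
  assumes "a > 0" shows "integrable lborel (\<lambda>x::real^'n. exp (- a * (norm x)\<^sup>2))"
proof -
  have "integrable lborel (\<lambda>x::real^'n. \<Prod>i\<in>UNIV. (\<lambda>t. complex_of_real (exp (- a * t\<^sup>2))) (x $ i))"
    using integrable_gaussian_real[OF assms] by (intro integrable_lborel_prod) (simp only: integrable_of_real)
  then have "integrable lborel (\<lambda>x::real^'n. complex_of_real (exp (- a * (norm x)\<^sup>2)))"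
    unfolding exp_norm_square_prod by simp
  then have "integrable lborel (\<lambda>x::real^'n. Re (complex_of_real (exp (- a * (norm x)\<^sup>2))))"
    by (rule integrable_Re)
  then show ?thesis by (simp only: Re_complex_of_real)
qed

lemma integrable_exp_gaussian_vec:
  assumes "a > 0" shows "integrable lborel (\<lambda>x::real^'n. exp (c * norm x - a * (norm x)\<^sup>2))"
proof (rule Bochner_Integration.integrable_bound)
  show "integrable lborel (\<lambda>x::real^'n. exp (c\<^sup>2 / (2 * a)) * exp (- (a / 2) * (norm x)\<^sup>2))"
    using assms by (intro integrable_mult_right integrable_gaussian_vec) auto
  have "exp (c * norm x - a * (norm x)\<^sup>2) \<le> exp (c\<^sup>2 / (2 * a)) * exp (- (a / 2) * (norm x)\<^sup>2)" for x :: "real^'n"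
    using linear_le_quadratic[OF assms, of c "norm x"] unfolding exp_add[symmetric] by (simp add: algebra_simps)
  then show "AE x in lborel. norm (exp (c * norm x - a * (norm x)\<^sup>2)) \<le> norm (exp (c\<^sup>2 / (2 * a)) * exp (- (a / 2) * (norm (x::real^'n))\<^sup>2))"
    by auto
qed auto

section \<open>Hermite polynomials in one dimension\<close>

text \<open>The two families of integrals behind the theorem are special cases: \<open>c = 1/2\<close>, \<open>a = 0\<close> gives inner products
  in \<open>L\<^sup>2(\<gamma>)\<close>, and \<open>c = 1/4\<close>, \<open>a = - x / 2\<close> gives the Fourier transforms of \<open>p(y) e\<^bsup>-y\<^sup>2/4\<^esup>\<close>.\<close>

definition poly_gauss_int :: "real \<Rightarrow> real \<Rightarrow> real poly \<Rightarrow> complex" where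
  "poly_gauss_int c a p = (LINT y|lborel. of_real (poly p y * exp (- c * y\<^sup>2)) * cis (a * y))"

lemma integrable_poly_gauss:
  assumes "c > 0"
  shows "integrable lborel (\<lambda>y. of_real (poly p y * exp (- c * y\<^sup>2)) * cis (a * y))"
proof -
  obtain C where C: "C \<ge> 0" "\<And>t. \<bar>poly p t\<bar> \<le> C * exp \<bar>t\<bar>" using poly_exp_bound by blast
  show ?thesis
  proof (rule Bochner_Integration.integrable_bound)
    show "integrable lborel (\<lambda>t. C * exp (1 * \<bar>t\<bar> - c * t\<^sup>2))"
      by (intro integrable_mult_right integrable_exp_gaussian_real assms)
    have "(\<lambda>y. poly p y) \<in> borel_measurable borel"
      by (intro borel_measurable_continuous_onI continuous_intros)
    moreover have "(\<lambda>y. cis (a * y)) \<in> borel_measurable borel"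
      by (intro borel_measurable_continuous_onI continuous_intros)
    ultimately show "(\<lambda>y. of_real (poly p y * exp (- c * y\<^sup>2)) * cis (a * y)) \<in> borel_measurable lborel" 
      by measurable
    have "\<bar>poly p y\<bar> * exp (- (c * y\<^sup>2)) \<le> C * exp \<bar>y\<bar> * exp (-(c * y\<^sup>2))" for y
      by (intro mult_right_mono C) auto
    then show "AE y in lborel. norm (complex_of_real (poly p y * exp (- c * y\<^sup>2)) * cis (a * y)) \<le> norm (C * exp (1 * \<bar>y\<bar> - c * y\<^sup>2))"
      using C(1) by (simp add: norm_mult abs_mult exp_diff exp_minus divide_inverse mult.assoc del: of_real_mult)
  qed
qed

lemma poly_gauss_int_add: "c > 0 \<Longrightarrow> poly_gauss_int c a (p + q) = poly_gauss_int c a p + poly_gauss_int c a q"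
  unfolding poly_gauss_int_def by (subst Bochner_Integration.integral_add[symmetric, OF integrable_poly_gauss integrable_poly_gauss])
    (auto simp: algebra_simps)

lemma poly_gauss_int_smult: "poly_gauss_int c a (smult r p) = r * poly_gauss_int c a p"
  unfolding poly_gauss_int_def integral_mult_right_zero[symmetric] by (intro Bochner_Integration.integral_cong) (auto simp: algebra_simps)

lemma poly_gauss_int_diff: "c > 0 \<Longrightarrow> poly_gauss_int c a (p - q) = poly_gauss_int c a p - poly_gauss_int c a q"
  using poly_gauss_int_add[of c a p "smult (-1) q"] unfolding poly_gauss_int_smult by simp

text \<open>The integral over the line of the derivative of \<open>p(y) e\<^bsup>-cy\<^sup>2\<^esup> e\<^bsup>iay\<^esup>\<close> vanishes. This one identity yields both
  the orthogonality relations and the recursion for the Fourier transforms.\<close>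

lemma poly_gauss_int_by_parts:
  assumes c: "c > 0"
  shows "2 * c * poly_gauss_int c a ([:0, 1:] * p) = poly_gauss_int c a (pderiv p) + \<i> * a * poly_gauss_int c a p"
proof -
  define F where "F y = of_real (poly p y * exp (- c * y\<^sup>2)) * cis (a * y)" for y
  define f where "f y = of_real (poly (pderiv p) y * exp (- c * y\<^sup>2)) * cis (a * y)
      - 2 * c * (of_real (poly ([:0, 1:] * p) y * exp (- c * y\<^sup>2)) * cis (a * y))
      + \<i> * a * (of_real (poly p y * exp (- c * y\<^sup>2)) * cis (a * y))" for y
  have fint: "integrable lborel f"
    unfolding f_def by (intro Bochner_Integration.integrable_add Bochner_Integration.integrable_diff integrable_mult_right integrable_poly_gauss c)
  obtain C where C: "C \<ge> 0" "\<And>t. \<bar>poly p t\<bar> \<le> C * exp \<bar>t\<bar>" using poly_exp_bound by blast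
  have bd: "norm (F y) \<le> C * exp (\<bar>y\<bar> - c * y\<^sup>2)" for y
  proof -
    have "\<bar>poly p y\<bar> * exp (- (c * y\<^sup>2)) \<le> C * exp \<bar>y\<bar> * exp (-(c * y\<^sup>2))" for y
      by (intro mult_right_mono C) auto
    then show ?thesis using C(1) by (simp add: F_def norm_mult abs_mult exp_diff exp_minus divide_inverse mult.assoc del: of_real_mult)
  qed
  have top: "(F \<longlongrightarrow> 0) at_top"
  proof (rule Lim_null_comparison)
    show "eventually (\<lambda>y. norm (F y) \<le> C * exp (\<bar>y\<bar> - c * y\<^sup>2)) at_top" using bd by auto
    have "((\<lambda>y::real. exp (y - c * y\<^sup>2)) \<longlongrightarrow> 0) at_top" using c by real_asymp
    then have "((\<lambda>y::real. exp (\<bar>y\<bar> - c * y\<^sup>2)) \<longlongrightarrow> 0) at_top"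
      by (rule Lim_transform_eventually) (use eventually_ge_at_top[of 0] in eventually_elim, auto)
    then show "((\<lambda>y. C * exp (\<bar>y\<bar> - c * y\<^sup>2)) \<longlongrightarrow> 0) at_top"
      by (rule tendsto_mult_right_zero)
  qed
  have bot: "(F \<longlongrightarrow> 0) at_bot"
  proof (rule Lim_null_comparison)
    show "eventually (\<lambda>y. norm (F y) \<le> C * exp (\<bar>y\<bar> - c * y\<^sup>2)) at_bot" using bd by auto
    have "((\<lambda>y::real. exp (- y - c * y\<^sup>2)) \<longlongrightarrow> 0) at_bot" using c by real_asymp
    then have "((\<lambda>y::real. exp (\<bar>y\<bar> - c * y\<^sup>2)) \<longlongrightarrow> 0) at_bot"
      by (rule Lim_transform_eventually) (use eventually_le_at_bot[of 0] in eventually_elim, auto)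
    then show "((\<lambda>y. C * exp (\<bar>y\<bar> - c * y\<^sup>2)) \<longlongrightarrow> 0) at_bot"
      by (rule tendsto_mult_right_zero)
  qed
  have "(LBINT y=-\<infinity>..\<infinity>. f y) = 0 - 0"
  proof (rule interval_integral_FTC_integrable[where F=F])
    show "(-\<infinity>::ereal) < \<infinity>" by simp
    show "(F has_vector_derivative f y) (at y)" for y
    proof -
      have 1: "((\<lambda>y. of_real (poly p y * exp (- c * y\<^sup>2))) has_vector_derivative
          complex_of_real (poly (pderiv p) y * exp (- c * y\<^sup>2) - 2 * c * (y * poly p y * exp (- c * y\<^sup>2)))) (at y)"
        unfolding has_real_derivative_iff_has_vector_derivative[symmetric]
        by (intro has_vector_derivative_of_real) (auto intro!: derivative_eq_intros simp: algebra_simps)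
      have 2: "((\<lambda>y. cis (a * y)) has_vector_derivative (\<i> * a * cis (a * y))) (at y)"
      proof -
        have "((\<lambda>y. exp (\<i> * (of_real a * of_real y))) has_vector_derivative (\<i> * a * exp (\<i> * (of_real a * of_real y)))) (at y)"
          by (auto intro!: derivative_eq_intros has_vector_derivative_real_field simp: algebra_simps)
        then show ?thesis by (simp add: cis_conv_exp)
      qed
      show ?thesis unfolding F_def
        by (rule has_vector_derivative_eq_rhs[OF has_vector_derivative_mult[OF 1 2]])
           (simp add: f_def algebra_simps)
    qed
    have "continuous_on UNIV f" unfolding f_def by (intro continuous_intros)
    then show "isCont f y" for y by (simp add: continuous_on_eq_continuous_at)
    show "set_integrable lborel (einterval (-\<infinity>) \<infinity>) f" using fint by (simp add: set_integrable_def)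
    show "((F \<circ> real_of_ereal) \<longlongrightarrow> 0) (at_right (-\<infinity>))" 
      using bot by (simp add: ereal_tendsto_simps)
    show "((F \<circ> real_of_ereal) \<longlongrightarrow> 0) (at_left \<infinity>)" 
      using top by (simp add: ereal_tendsto_simps)
  qed
  then have "(LINT y|lborel. f y) = 0" by (simp add: interval_integral_to_infinity_eq interval_lebesgue_integral_def set_lebesgue_integral_def)
  moreover have "(LINT y|lborel. f y) = poly_gauss_int c a (pderiv p) - 2 * c * poly_gauss_int c a ([:0, 1:] * p) + \<i> * a * poly_gauss_int c a p"
    unfolding f_def poly_gauss_int_def
    by (subst Bochner_Integration.integral_add, (intro Bochner_Integration.integrable_add Bochner_Integration.integrable_diff integrable_mult_right integrable_poly_gauss c)+,
        subst Bochner_Integration.integral_diff, (intro Bochner_Integration.integrable_add Bochner_Integration.integrable_diff integrable_mult_right integrable_poly_gauss c)+) simp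
  ultimately show ?thesis by (simp add: algebra_simps)
qed

lemma pderiv_hermite_poly: "pderiv (hermite_poly n) = smult (real n) (hermite_poly (n - 1))"
proof (cases n)
  case (Suc m)
  then show ?thesis by (simp only: pderiv_hermite_poly_Suc diff_Suc_1 of_nat_poly) simp
qed (simp add: pderiv_1)

text \<open>Multiplication by \<open>x\<close> minus differentiation is the adjoint of differentiation with respect to the Gaussian.\<close>

lemma poly_gauss_int_mult_hermite_Suc:
  "poly_gauss_int (1/2) 0 (p * hermite_poly (Suc n)) = poly_gauss_int (1/2) 0 (pderiv p * hermite_poly n)"
proof -
  have "poly_gauss_int (1/2) 0 ([:0, 1:] * (p * hermite_poly n)) = poly_gauss_int (1/2) 0 (pderiv (p * hermite_poly n))"
    using poly_gauss_int_by_parts[of "1/2" 0 "p * hermite_poly n"] by simp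
  moreover have "p * hermite_poly (Suc n) = [:0, 1:] * (p * hermite_poly n) - p * pderiv (hermite_poly n)"
    unfolding hermite_poly.simps(2) right_diff_distrib by (simp only: mult.left_commute)
  moreover have "pderiv (p * hermite_poly n) - p * pderiv (hermite_poly n) = pderiv p * hermite_poly n"
    by (simp add: pderiv_mult)
  ultimately show ?thesis
    using poly_gauss_int_diff[of "1/2" 0] by (metis half_gt_zero zero_less_one)
qed

lemma poly_gauss_int_hermite_orthogonal:
  "poly_gauss_int (1/2) 0 (hermite_poly m * hermite_poly n) = (if m = n then fact n * poly_gauss_int (1/2) 0 1 else 0)"
proof (induction m arbitrary: n)
  case 0
  have "poly_gauss_int (1/2) 0 0 = 0" by (simp add: poly_gauss_int_def)
  then show ?case
    using poly_gauss_int_mult_hermite_Suc[of 1] by (cases n) (simp_all del: hermite_poly.simps(2) add: pderiv_1)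
next
  case (Suc m)
  show ?case
  proof (cases n)
    case 0
    have "poly_gauss_int (1/2) 0 0 = 0" by (simp add: poly_gauss_int_def)
    then show ?thesis using poly_gauss_int_mult_hermite_Suc[of 1] 0
      by (simp del: hermite_poly.simps(2) add: pderiv_1)
  next
    case (Suc k)
    have "poly_gauss_int (1/2) 0 (hermite_poly (Suc m) * hermite_poly (Suc k)) 
       = real (Suc m) * poly_gauss_int (1/2) 0 (hermite_poly m * hermite_poly k)"
      unfolding poly_gauss_int_mult_hermite_Suc pderiv_hermite_poly mult_smult_left poly_gauss_int_smult by simp
    then show ?thesis using Suc Suc.IH[of k] by simp
  qed
qed

text \<open>The characteristic function of the standard normal distribution, rescaled by \<open>sqrt (2 * c)\<close>.\<close>

lemma poly_gauss_int_1:
  assumes c: "c > 0"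
  shows "poly_gauss_int c a 1 = sqrt (pi / c) * exp (- a\<^sup>2 / (4 * c))"
proof -
  define s where "s = sqrt (2 * c)"
  have s: "s > 0" "s\<^sup>2 = 2 * c" using c by (auto simp: s_def)
  have "complex_of_real (exp (- ((a / s)\<^sup>2) / 2)) = char std_normal_distribution (a / s)"
    by (simp add: char_std_normal_distribution)
  also have "\<dots> = (LINT x|lborel. std_normal_density x *\<^sub>R cis (a / s * x))"
    unfolding char_def by (subst integral_density) (auto simp: cis_conv_exp)
  also have "\<dots> = s * (LINT x|lborel. std_normal_density (0 + s * x) *\<^sub>R cis (a / s * (0 + s * x)))"
    using s by (subst lborel_integral_real_affine[where c=s and t=0]) (auto simp: scaleR_conv_of_real)
  also have "(LINT x|lborel. std_normal_density (0 + s * x) *\<^sub>R cis (a / s * (0 + s * x))) = (LINT x|lborel. complex_of_real (1 / sqrt (2 * pi)) * (of_real (exp (- c * x\<^sup>2)) * cis (a * x)))"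
    using s by (intro Bochner_Integration.integral_cong) (auto simp: std_normal_density_def power_mult_distrib scaleR_conv_of_real)
  also have "\<dots> = (1 / sqrt (2 * pi)) * poly_gauss_int c a 1"
    by (subst integral_mult_right_zero) (simp add: poly_gauss_int_def)
  finally have "complex_of_real (exp (- ((a / s)\<^sup>2) / 2)) = of_real (s / sqrt (2 * pi)) * poly_gauss_int c a 1"
    by simp
  moreover have "(a / s)\<^sup>2 / 2 = a\<^sup>2 / (4 * c)" using s by (simp add: power_divide)
  ultimately have E: "complex_of_real (exp (- a\<^sup>2 / (4 * c))) = of_real (s / sqrt (2 * pi)) * poly_gauss_int c a 1"
    by simp
  have K: "sqrt (pi / c) * (s / sqrt (2 * pi)) = 1"
    using c by (simp add: s_def real_sqrt_divide real_sqrt_mult)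
  have "complex_of_real (sqrt (pi / c)) * of_real (exp (- a\<^sup>2 / (4 * c))) =
      of_real (sqrt (pi / c) * (s / sqrt (2 * pi))) * poly_gauss_int c a 1"
    unfolding E of_real_mult mult.assoc ..
  then show ?thesis
    unfolding K by simp
qed

text \<open>Hermite functions are eigenfunctions of the Fourier transform. Write \<open>I\<^sub>n\<close> for the left-hand side. Integration
  by parts gives \<open>I\<^sub>n\<^sub>+\<^sub>1 = n I\<^sub>n\<^sub>-\<^sub>1 - i x I\<^sub>n\<close>; multiplied by \<open>i\<^bsup>n+1\<^esup>\<close> this is the three-term recursion
  \<open>H\<^sub>n\<^sub>+\<^sub>1 = x H\<^sub>n - n H\<^sub>n\<^sub>-\<^sub>1\<close>.\<close>

lemma poly_gauss_int_hermite:
  "poly_gauss_int (1/4) (- x / 2) (hermite_poly n) =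
     of_real (sqrt (4 * pi) * exp (- x\<^sup>2 / 4) * poly (hermite_poly n) x) * (- \<i>) ^ n"
proof (induction n rule: less_induct)
  case (less n)
  define K where "K = sqrt (4 * pi) * exp (- x\<^sup>2 / 4)"
  let ?I = "\<lambda>p. poly_gauss_int (1/4) (- x / 2) p"
  let ?h = "hermite_poly"
  have I1: "?I 1 = K" unfolding K_def by (subst poly_gauss_int_1) (auto simp: power_divide mult.commute)
  have rec: "?I (?h (Suc m)) = real m * ?I (?h (m - 1)) - \<i> * x * ?I (?h m)" for m
    using poly_gauss_int_by_parts[of "1/4" "- x / 2" "?h m"]
    unfolding hermite_poly.simps poly_gauss_int_diff[of "1/4", simplified] pderiv_hermite_poly poly_gauss_int_smult
    by (simp add: field_simps)
  \<comment> \<open>The recursion reaches back two steps, so \<open>n = 1\<close> is treated separately.\<close>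
  consider "n = 0" | "n = 1" | m where "n = Suc (Suc m)" by (metis One_nat_def not0_implies_Suc)
  then show ?case
  proof cases
    case 1
    then show ?thesis using I1 by (simp add: K_def)
  next
    case 2
    then show ?thesis using rec[of 0] I1 by (simp add: K_def pderiv_1)
  next
    case 3
    have l: "m < n" "Suc m < n" using 3 by auto
    have P: "poly (?h n) x = x * poly (?h (Suc m)) x - real (Suc m) * poly (?h m) x"
      unfolding 3 hermite_poly.simps(2)[of "Suc m"] pderiv_hermite_poly by (simp del: hermite_poly.simps)
    have "?I (?h n) = real (Suc m) * ?I (?h m) - \<i> * x * ?I (?h (Suc m))"
      unfolding 3 using rec[of "Suc m"] by (simp del: hermite_poly.simps)
    also have "\<dots> = of_real (K * poly (?h n) x) * (- \<i>) ^ n"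
      unfolding P less[OF l(1), folded K_def] less[OF l(2), folded K_def]
      by (simp add: 3 algebra_simps del: hermite_poly.simps)
    finally show ?thesis unfolding K_def .
  qed
qed

section \<open>Hermite polynomials in several dimensions\<close>

abbreviation (input) gauss_dens :: "real^'n \<Rightarrow> real" where
  "gauss_dens x \<equiv> (2 * pi) powr (- real CARD('n) / 2) * exp (- (norm x)\<^sup>2 / 2)"

lemma sets_gauss [measurable_cong, simp]: "sets gauss = sets borel"
  by (simp add: gauss_def)

lemma space_gauss [simp]: "space gauss = UNIV"
  by (simp add: gauss_def)

lemma integral_gauss:
  fixes f :: "real^'n \<Rightarrow> complex"
  assumes "f \<in> borel_measurable borel"
  shows "(LINT x|gauss. f x) = (LINT x|lborel. of_real (gauss_dens x) * f x)"
  unfolding gauss_def using assms by (subst integral_density) (auto simp: scaleR_conv_of_real)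

lemma integrable_gauss:
  fixes f :: "real^'n \<Rightarrow> 'b::{banach, second_countable_topology}"
  assumes "f \<in> borel_measurable borel"
  shows "integrable gauss f \<longleftrightarrow> integrable lborel (\<lambda>x. exp (- (norm x)\<^sup>2 / 2) *\<^sub>R f x)"
proof -
  have "integrable gauss f \<longleftrightarrow> integrable lborel (\<lambda>x. gauss_dens x *\<^sub>R f x)"
    unfolding gauss_def using assms by (subst integrable_density) auto
  also have "(\<lambda>x. gauss_dens x *\<^sub>R f x) = (\<lambda>x. (2 * pi) powr (- real CARD('n) / 2) *\<^sub>R (exp (- (norm x)\<^sup>2 / 2) *\<^sub>R f x))"
    by simp
  also have "integrable lborel \<dots> \<longleftrightarrow> integrable lborel (\<lambda>x. exp (- (norm x)\<^sup>2 / 2) *\<^sub>R f x)"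
  proof
    let ?c = "(2 * pi) powr (- real CARD('n) / 2)" and ?h = "\<lambda>x. exp (- (norm x)\<^sup>2 / 2) *\<^sub>R f x"
    assume "integrable lborel (\<lambda>x. ?c *\<^sub>R ?h x)"
    then have "integrable lborel (\<lambda>x. inverse ?c *\<^sub>R (?c *\<^sub>R ?h x))" by (rule integrable_scaleR_right)
    moreover have "(\<lambda>x. inverse ?c *\<^sub>R (?c *\<^sub>R ?h x)) = ?h"
      by (subst scaleR_scaleR, subst left_inverse) simp_all
    ultimately show "integrable lborel ?h" by (simp only:)
  qed (rule integrable_scaleR_right)
  finally show ?thesis .
qed

lemma hermite_borel [measurable]: "hermite \<alpha> \<in> borel_measurable borel"
  unfolding hermite_def[abs_def] by (intro borel_measurable_continuous_onI continuous_intros)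

lemma cnj_hermite [simp]: "cnj (hermite \<alpha> x) = hermite \<alpha> x"
  by (simp add: hermite_def)

definition hermite_norm_sq :: "nat ^ 'n \<Rightarrow> real" where
  "hermite_norm_sq \<alpha> = (\<Prod>i\<in>UNIV. fact (\<alpha> $ i))"

lemma hermite_norm_sq_pos: "hermite_norm_sq \<alpha> > 0"
  unfolding hermite_norm_sq_def by (intro prod_pos) auto

lemma powr_half_card: "a > 0 \<Longrightarrow> a powr (real CARD('n::finite) / 2) = (\<Prod>i\<in>(UNIV::'n set). sqrt a)"
  by (simp add: powr_half_sqrt[symmetric] powr_power)

text \<open>The integrand factors over the coordinates, and the normalizing constant of \<open>\<gamma>\<close> cancels the \<open>d\<close> factors \<open>sqrt (2 * pi)\<close>.\<close>

lemma hermite_orthogonal: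
  fixes \<alpha> \<beta> :: "nat ^ 'n"
  shows "L2_inner gauss (hermite \<alpha>) (hermite \<beta>) = (if \<alpha> = \<beta> then of_real (hermite_norm_sq \<alpha>) else 0)"
proof -
  let ?g = "\<lambda>i y. complex_of_real (poly (hermite_poly (\<alpha> $ i) * hermite_poly (\<beta> $ i)) y * exp (- (1/2) * y\<^sup>2)) * cis (0 * y)"
  have e: "complex_of_real (gauss_dens x) * (hermite \<alpha> x * cnj (hermite \<beta> x)) = of_real ((2 * pi) powr (- real CARD('n) / 2)) * (\<Prod>i\<in>UNIV. ?g i (x $ i))"
    for x :: "real^'n"
  proof -
    have "exp (- (norm x)\<^sup>2 / 2) = (\<Prod>i\<in>UNIV. exp (- (1/2) * (x $ i)\<^sup>2))"
      using exp_norm_square_prod[of "1/2" x] by simp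
    then show ?thesis by (simp add: hermite_def prod.distrib mult_ac)
  qed
  have "L2_inner gauss (hermite \<alpha>) (hermite \<beta>) = (LINT x|lborel. of_real ((2 * pi) powr (- real CARD('n) / 2)) * (\<Prod>i\<in>UNIV. ?g i ((x::real^'n) $ i)))"
    unfolding L2_inner_def e[symmetric] unfolding cnj_hermite by (rule integral_gauss) measurable
  also have "\<dots> = of_real ((2 * pi) powr (- real CARD('n) / 2)) * (\<Prod>i\<in>UNIV. LINT y|lborel. ?g i y)"
    by (subst integral_mult_right_zero, subst integral_lborel_prod, rule integrable_poly_gauss) simp_all
  also have "(\<Prod>i\<in>UNIV. LINT y|lborel. ?g i y) = (\<Prod>i\<in>UNIV. poly_gauss_int (1/2) 0 (hermite_poly (\<alpha> $ i) * hermite_poly (\<beta> $ i)))"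
    unfolding poly_gauss_int_def ..
  also have "\<dots> = (if \<alpha> = \<beta> then of_real (hermite_norm_sq \<alpha> * (2 * pi) powr (real CARD('n) / 2)) else 0)"
  proof (cases "\<alpha> = \<beta>")
    case False
    then obtain i where "\<alpha> $ i \<noteq> \<beta> $ i" by (metis vec_eq_iff)
    then have "poly_gauss_int (1/2) 0 (hermite_poly (\<alpha> $ i) * hermite_poly (\<beta> $ i)) = 0"
      by (simp add: poly_gauss_int_hermite_orthogonal)
    then show ?thesis using False by (simp add: prod_zero_iff) blast
  next
    case True
    have "poly_gauss_int (1/2) 0 1 = complex_of_real (sqrt (2 * pi))" by (subst poly_gauss_int_1) (auto simp: mult.commute)
    then show ?thesis using True 
      by (simp add: poly_gauss_int_hermite_orthogonal hermite_norm_sq_def powr_half_card prod.distrib)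
  qed
  also have "of_real ((2 * pi) powr (- real CARD('n) / 2)) * \<dots> = (if \<alpha> = \<beta> then of_real (hermite_norm_sq \<alpha>) else 0)"
    by (simp add: powr_minus field_simps flip: of_real_mult)
  finally show ?thesis .
qed

text \<open>The frequency \<open>x / (4 * pi)\<close> turns the kernel into \<open>e\<^bsup>-i\<langle>x,y\<rangle>/2\<^esup>\<close>, which is the scale at which the Hermite
  functions for the weight \<open>e\<^bsup>-|y|\<^sup>2/4\<^esup>\<close> are eigenfunctions.\<close>

lemma fourier_hermite:
  fixes x :: "real^'n"
  shows "fourier (\<lambda>y. of_real (exp (- (norm y)\<^sup>2 / 4)) * hermite \<alpha> y) ((1 / (4 * pi)) *\<^sub>R x) =
    of_real ((4 * pi) powr (real CARD('n) / 2) * exp (- (norm x)\<^sup>2 / 4)) * (- \<i>) ^ (\<Sum>i\<in>UNIV. \<alpha> $ i) * hermite \<alpha> x"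
proof -
  let ?g = "\<lambda>i y. complex_of_real (poly (hermite_poly (\<alpha> $ i)) y * exp (- (1/4) * y\<^sup>2)) * cis ((- (x $ i) / 2) * y)"
  have ee: "exp (- (norm y)\<^sup>2 / 4) = (\<Prod>i\<in>UNIV. exp (- (1/4) * (y $ i)\<^sup>2))" for y :: "real^'n"
    using exp_norm_square_prod[of "1/4" y] by simp
  have e: "exp (- 2 * of_real pi * \<i> * of_real ((1 / (4 * pi)) *\<^sub>R x \<bullet> y)) * (complex_of_real (exp (- (norm y)\<^sup>2 / 4)) * hermite \<alpha> y) = (\<Prod>i\<in>UNIV. ?g i (y $ i))"
    for y :: "real^'n"
  proof -
    have "exp (- 2 * of_real pi * \<i> * of_real ((1 / (4 * pi)) *\<^sub>R x \<bullet> y)) = cis (- (x \<bullet> y) / 2)"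
      by (simp add: cis_conv_exp field_simps)
    also have "\<dots> = (\<Prod>i\<in>UNIV. cis ((- (x $ i) / 2) * y $ i))"
      by (simp add: cis_conv_exp exp_sum[symmetric] inner_vec_def sum_distrib_left sum_divide_distrib sum_negf)
    finally show ?thesis unfolding ee by (simp add: hermite_def prod.distrib mult_ac)
  qed
  have "fourier (\<lambda>y. of_real (exp (- (norm y)\<^sup>2 / 4)) * hermite \<alpha> y) ((1 / (4 * pi)) *\<^sub>R x) = (\<Prod>i\<in>UNIV. LINT y|lborel. ?g i y)"
    unfolding fourier_def e by (rule integral_lborel_prod, rule integrable_poly_gauss) simp
  also have "\<dots> = (\<Prod>i\<in>UNIV. poly_gauss_int (1/4) (- (x $ i) / 2) (hermite_poly (\<alpha> $ i)))"
    unfolding poly_gauss_int_def ..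
  also have "\<dots> = (\<Prod>i\<in>UNIV. complex_of_real (sqrt (4 * pi)) * of_real (exp (- (1/4) * (x $ i)\<^sup>2)) * of_real (poly (hermite_poly (\<alpha> $ i)) (x $ i)) * (- \<i>) ^ (\<alpha> $ i))"
    unfolding poly_gauss_int_hermite by simp
  also have "\<dots> = of_real ((4 * pi) powr (real CARD('n) / 2) * exp (- (norm x)\<^sup>2 / 4)) * (- \<i>) ^ (\<Sum>i\<in>UNIV. \<alpha> $ i) * hermite \<alpha> x"
    unfolding ee powr_half_card[OF mult_pos_pos[OF zero_less_numeral pi_gt_zero]]
    by (simp only: hermite_def prod.distrib power_sum of_real_mult of_real_prod mult_ac)
  finally show ?thesis .
qed

text \<open>The span of the Hermite polynomials is closed under multiplication by coordinates. Orthogonality to all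
  of them thus propagates to all polynomial multiples. When \<open>\<alpha> $ j = 0\<close> the subtraction on \<open>nat\<close> truncates,
  but then the factor in front vanishes.\<close>

lemma hermite_times_coord:
  "of_real (x $ j) * hermite \<alpha> x = hermite (\<alpha> + axis j 1) x + of_nat (\<alpha> $ j) * hermite (\<alpha> - axis j 1) x"
proof -
  define R where "R = (\<Prod>i\<in>UNIV - {j}. poly (hermite_poly (\<alpha> $ i)) (x $ i))"
  have R: "hermite \<beta> x = of_real (poly (hermite_poly (\<beta> $ j)) (x $ j) * R)" if "\<And>i. i \<noteq> j \<Longrightarrow> \<beta> $ i = \<alpha> $ i" for \<beta>
    unfolding hermite_def R_def using that by (subst prod.remove[of UNIV j]) auto
  have "hermite \<alpha> x = of_real (poly (hermite_poly (\<alpha> $ j)) (x $ j) * R)" 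
    by (rule R) auto
  moreover have "hermite (\<alpha> + axis j 1) x = of_real (poly (hermite_poly (Suc (\<alpha> $ j))) (x $ j) * R)" 
    by (subst R) (auto simp: axis_def)
  moreover have "hermite (\<alpha> - axis j 1) x = of_real (poly (hermite_poly (\<alpha> $ j - 1)) (x $ j) * R)"
    by (subst R) (auto simp: axis_def)
  moreover have "poly (hermite_poly (Suc n)) t = t * poly (hermite_poly n) t - n * poly (hermite_poly (n - 1)) t" for n t
    by (simp add: pderiv_hermite_poly)
  ultimately show ?thesis by (simp add: algebra_simps del: hermite_poly.simps)
qed

lemma hermite_exp_bound:
  obtains C c where "C \<ge> 0" "\<And>x. norm (hermite \<alpha> x) \<le> C * exp (c * norm x)"
proof -
  have "\<forall>i. \<exists>C\<ge>0. \<forall>t. \<bar>poly (hermite_poly (\<alpha> $ i)) t\<bar> \<le> C * exp \<bar>t\<bar>"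
    by (metis poly_exp_bound)
  then obtain C where C: "\<And>i. C i \<ge> 0" "\<And>i t. \<bar>poly (hermite_poly (\<alpha> $ i)) t\<bar> \<le> C i * exp \<bar>t\<bar>"
    by metis
  have "norm (hermite \<alpha> x) \<le> (\<Prod>i\<in>UNIV. C i) * exp (real CARD('a) * norm x)" for x
  proof -
    have "norm (hermite \<alpha> x) = (\<Prod>i\<in>UNIV. \<bar>poly (hermite_poly (\<alpha> $ i)) (x $ i)\<bar>)"
      by (simp only: hermite_def norm_of_real abs_prod)
    also have "\<dots> \<le> (\<Prod>i\<in>UNIV. C i * exp (norm x))"
    proof (rule prod_mono, safe)
      fix i
      have "\<bar>poly (hermite_poly (\<alpha> $ i)) (x $ i)\<bar> \<le> C i * exp \<bar>x $ i\<bar>" by (rule C)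
      also have "\<dots> \<le> C i * exp (norm x)" using C(1) component_le_norm_cart[of x i] by (intro mult_left_mono) auto
      finally show "\<bar>poly (hermite_poly (\<alpha> $ i)) (x $ i)\<bar> \<le> C i * exp (norm x)" .
    qed auto
    also have "\<dots> = (\<Prod>i\<in>UNIV. C i) * exp (real CARD('a) * norm x)"
      by (simp add: prod.distrib exp_of_nat_mult)
    finally show ?thesis .
  qed
  moreover have "(\<Prod>i\<in>UNIV. C i) \<ge> 0" using C(1) by (intro prod_nonneg) auto
  ultimately show ?thesis using that by blast
qed

lemma hermite_minus: "hermite \<alpha> (- x) = (- 1) ^ (\<Sum>i\<in>UNIV. \<alpha> $ i) * hermite \<alpha> x"
proof -
  have p: "poly (hermite_poly n) (- t) = (- 1) ^ n * poly (hermite_poly n) t" for n t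
  proof (induction n rule: less_induct)
    case (less n)
    have r: "poly (hermite_poly (Suc n)) t = t * poly (hermite_poly n) t - n * poly (hermite_poly (n - 1)) t" for n t
      by (simp add: pderiv_hermite_poly)
    consider "n = 0" | "n = 1" | m where "n = Suc (Suc m)" by (metis One_nat_def not0_implies_Suc)
    then show ?case
    proof cases
      case 3
      then show ?thesis using less[of m] less[of "Suc m"] unfolding 3 r[of "Suc m"]
        by (simp add: algebra_simps del: hermite_poly.simps)
    qed (auto simp: pderiv_1)
  qed
  show ?thesis by (simp add: hermite_def p prod.distrib power_sum)
qed

section \<open>Completeness of the Hermite polynomials\<close>

text \<open>This class contains \<open>L\<^sup>2(\<gamma>)\<close>, but also \<open>e\<^bsup>|x|\<^sup>2/4\<^esup>\<close> times any bounded measurable function. The latter allows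
  the Fourier transform of an integrable function, of which only boundedness is known, to be compared with
  a Hermite expansion.\<close>

definition exp_moments :: "(real^'n \<Rightarrow> complex) \<Rightarrow> bool" where
  "exp_moments g \<longleftrightarrow> g \<in> borel_measurable borel \<and> (\<forall>c. integrable gauss (\<lambda>x. exp (c * norm x) * cmod (g x)))"

lemma exp_moments_measurable [measurable_dest]: "exp_moments g \<Longrightarrow> g \<in> borel_measurable borel"
  by (simp add: exp_moments_def)

lemma integrable_gauss_exp_norm: "integrable (gauss :: (real^'n) measure) (\<lambda>x. exp (c * norm x))"
proof -
  have "integrable lborel (\<lambda>x::real^'n. exp (c * norm x - (1/2) * (norm x)\<^sup>2))"
    by (rule integrable_exp_gaussian_vec) simp
  then show ?thesis
    by (subst integrable_gauss) (auto simp: exp_add[symmetric] algebra_simps)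
qed

lemma L2_imp_exp_moments:
  fixes f :: "real^'n \<Rightarrow> complex"
  assumes "f \<in> L2 gauss" shows "exp_moments f"
  unfolding exp_moments_def
proof safe
  have f: "f \<in> borel_measurable borel" "integrable gauss (\<lambda>x. (cmod (f x))\<^sup>2)" 
    using assms by (auto simp: L2_def)
  show "f \<in> borel_measurable borel" by (rule f)
  fix c
  show "integrable gauss (\<lambda>x. exp (c * norm x) * cmod (f x))"
  proof (rule Bochner_Integration.integrable_bound)
    show "integrable gauss (\<lambda>x. exp ((2 * c) * norm x) + (cmod (f x))\<^sup>2)"
      by (intro Bochner_Integration.integrable_add integrable_gauss_exp_norm f)
    show "(\<lambda>x. exp (c * norm x) * cmod (f x)) \<in> borel_measurable gauss"
      using f(1) by measurable
    have "exp (c * norm x) * cmod (f x) \<le> exp ((2 * c) * norm x) + (cmod (f x))\<^sup>2" for x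
    proof -
      have "exp ((2 * c) * norm x) = (exp (c * norm x))\<^sup>2" by (simp add: exp_double[symmetric] mult.assoc)
      moreover have "a * b \<le> a\<^sup>2 + b\<^sup>2" if "a \<ge> 0" "b \<ge> 0" for a b :: real
        using that sum_squares_bound[of a b] mult_nonneg_nonneg[of a b] by linarith
      ultimately show ?thesis by simp
    qed
    then show "AE x in gauss. norm (exp (c * norm x) * cmod (f x)) \<le> norm (exp ((2 * c) * norm x) + (cmod (f x))\<^sup>2)"
      by (auto simp: norm_mult)
  qed
qed

lemma exp_moments_diff:
  assumes f: "exp_moments f" and g: "exp_moments g" shows "exp_moments (\<lambda>x. f x - g x)"
  unfolding exp_moments_def
proof safe
  note [measurable] = f g
  show "(\<lambda>x. f x - g x) \<in> borel_measurable borel" by measurable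
  fix c
  show "integrable gauss (\<lambda>x. exp (c * norm x) * cmod (f x - g x))"
  proof (rule Bochner_Integration.integrable_bound)
    show "integrable gauss (\<lambda>x. exp (c * norm x) * cmod (f x) + exp (c * norm x) * cmod (g x))"
      using f g by (intro Bochner_Integration.integrable_add) (auto simp: exp_moments_def)
    show "(\<lambda>x. exp (c * norm x) * cmod (f x - g x)) \<in> borel_measurable gauss" by measurable
    have "cmod (f x - g x) \<le> cmod (f x) + cmod (g x)" for x by (rule norm_triangle_ineq4)
    then show "AE x in gauss. norm (exp (c * norm x) * cmod (f x - g x)) \<le> norm (exp (c * norm x) * cmod (f x) + exp (c * norm x) * cmod (g x))"
      unfolding distrib_left[symmetric] by (auto simp: norm_mult)
  qed
qed

lemma exp_moments_integrable:
  fixes v :: "real^'n \<Rightarrow> complex"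
  assumes g: "exp_moments g" and [measurable]: "v \<in> borel_measurable borel"
    and b: "\<And>x. norm (v x) \<le> C * exp (c * norm x)"
  shows "integrable gauss (\<lambda>x. g x * v x)"
proof (rule Bochner_Integration.integrable_bound)
  note [measurable] = g
  show "integrable gauss (\<lambda>x. C * (exp (c * norm x) * cmod (g x)))"
    using g by (intro integrable_mult_right) (auto simp: exp_moments_def)
  show "(\<lambda>x. g x * v x) \<in> borel_measurable gauss" by measurable
  have "norm (g x * v x) \<le> C * (exp (c * norm x) * cmod (g x))" for x
    using mult_left_mono[OF b norm_ge_zero[of "g x"], of x] by (simp add: norm_mult mult_ac)
  then show "AE x in gauss. norm (g x * v x) \<le> norm (C * (exp (c * norm x) * cmod (g x)))"
    unfolding real_norm_def by (intro AE_I2 order_trans[OF _ abs_ge_self])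
qed

lemma exp_moments_integrable_bounded:
  fixes v :: "real^'n \<Rightarrow> complex"
  assumes g: "exp_moments g" and "v \<in> borel_measurable borel" and b: "\<And>x. norm (v x) \<le> C"
  shows "integrable gauss (\<lambda>x. g x * v x)"
  using exp_moments_integrable[OF g assms(2), of C 0] b by simp

lemma measurable_cis_inner [measurable]: "(\<lambda>x. cis (\<xi> \<bullet> x)) \<in> borel_measurable borel"
  by (intro borel_measurable_continuous_onI continuous_intros)

text \<open>Expand the exponential. By the recursion \<open>hermite_times_coord\<close> all moments of \<open>g d\<gamma>\<close> in the direction \<open>\<xi>\<close>
  vanish, and \<open>e\<^bsup>|\<xi>||x|\<^esup> |g|\<close> dominates the partial sums of the series.\<close>

lemma integral_cis_eq_0:
  fixes g :: "real^'n \<Rightarrow> complex"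
  assumes g: "exp_moments g" and m: "\<And>\<alpha>. (LINT x|gauss. g x * hermite \<alpha> x) = 0"
  shows "(LINT x|gauss. g x * cis (\<xi> \<bullet> x)) = 0"
proof -
  note [measurable] = g
  have int: "integrable gauss (\<lambda>x. g x * (of_real ((\<xi> \<bullet> x) ^ n) * hermite \<alpha> x))" for n \<alpha>
  proof -
    obtain C c where C: "C \<ge> 0" "\<And>x. norm (hermite \<alpha> x) \<le> C * exp (c * norm x)" using hermite_exp_bound by blast
    show ?thesis
    proof (rule exp_moments_integrable[OF g])
      fix x :: "real^'n"
      have "\<bar>\<xi> \<bullet> x\<bar> ^ n \<le> (norm \<xi> * norm x) ^ n" by (intro power_mono Cauchy_Schwarz_ineq2) auto
      also have "\<dots> \<le> fact n * exp (norm \<xi> * norm x)" by (rule power_le_fact_exp) auto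
      finally have "norm (of_real ((\<xi> \<bullet> x) ^ n) * hermite \<alpha> x) \<le> (fact n * exp (norm \<xi> * norm x)) * (C * exp (c * norm x))"
        unfolding norm_mult by (intro mult_mono C) (auto simp: power_abs norm_power)
      then show "norm (of_real ((\<xi> \<bullet> x) ^ n) * hermite \<alpha> x) \<le> (fact n * C) * exp ((norm \<xi> + c) * norm x)"
        by (simp add: exp_add algebra_simps)
    qed measurable
  qed
  have zero: "(LINT x|gauss. g x * (of_real ((\<xi> \<bullet> x) ^ n) * hermite \<alpha> x)) = 0" for n \<alpha>
  proof (induction n arbitrary: \<alpha>)
    case 0
    then show ?case using m by simp
  next
    case (Suc n)
    have e: "g x * (of_real ((\<xi> \<bullet> x) ^ Suc n) * hermite \<alpha> x) =
      (\<Sum>j\<in>UNIV. of_real (\<xi> $ j) * (g x * (of_real ((\<xi> \<bullet> x) ^ n) * hermite (\<alpha> + axis j 1) x))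
         + of_real (\<xi> $ j * real (\<alpha> $ j)) * (g x * (of_real ((\<xi> \<bullet> x) ^ n) * hermite (\<alpha> - axis j 1) x)))" for x
    proof -
      have "complex_of_real (\<xi> \<bullet> x) * hermite \<alpha> x = (\<Sum>j\<in>UNIV. of_real (\<xi> $ j) * (of_real (x $ j) * hermite \<alpha> x))"
        by (simp add: inner_vec_def sum_distrib_right mult.assoc)
      also have "\<dots> = (\<Sum>j\<in>UNIV. of_real (\<xi> $ j) * (hermite (\<alpha> + axis j 1) x + of_nat (\<alpha> $ j) * hermite (\<alpha> - axis j 1) x))"
        unfolding hermite_times_coord ..
      finally have "g x * (of_real ((\<xi> \<bullet> x) ^ Suc n) * hermite \<alpha> x) = g x * of_real ((\<xi> \<bullet> x) ^ n) * (\<Sum>j\<in>UNIV. of_real (\<xi> $ j) * (hermite (\<alpha> + axis j 1) x + of_nat (\<alpha> $ j) * hermite (\<alpha> - axis j 1) x))"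
        by (simp add: mult_ac)
      then show ?thesis by (simp add: sum_distrib_left algebra_simps)
    qed
    show ?case unfolding e
      by (subst Bochner_Integration.integral_sum, (intro Bochner_Integration.integrable_add integrable_mult_right int),
          subst Bochner_Integration.integral_add, (intro integrable_mult_right int)+)
         (simp only: integral_mult_right_zero Suc.IH mult_zero_right add_0 sum.neutral_const)
  qed
  have h0: "hermite 0 x = 1" for x :: "real^'n" by (simp add: hermite_def)
  have int0: "integrable gauss (\<lambda>x. g x * of_real ((\<xi> \<bullet> x) ^ n))" for n
    using int[of n 0] by (simp add: h0)
  have zero0: "(LINT x|gauss. g x * of_real ((\<xi> \<bullet> x) ^ n)) = 0" for n
    using zero[of n 0] by (simp add: h0)
  define s where "s N x = (\<Sum>n<N. \<i> ^ n / fact n * (g x * of_real ((\<xi> \<bullet> x) ^ n)))" for N x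
  have s_eq: "s N x = g x * (\<Sum>n<N. (\<i> * of_real (\<xi> \<bullet> x)) ^ n /\<^sub>R fact n)" for N x
    by (simp add: s_def sum_distrib_left power_mult_distrib scaleR_conv_of_real field_simps)
  have "(\<lambda>N. LINT x|gauss. s N x) \<longlonglongrightarrow> (LINT x|gauss. g x * cis (\<xi> \<bullet> x))"
  proof (rule integral_dominated_convergence)
    show "(\<lambda>x. g x * cis (\<xi> \<bullet> x)) \<in> borel_measurable gauss" by measurable
    show "s N \<in> borel_measurable gauss" for N unfolding s_def[abs_def] by measurable
    show "integrable gauss (\<lambda>x. exp (norm \<xi> * norm x) * cmod (g x))" using g by (simp add: exp_moments_def)
    show "AE x in gauss. (\<lambda>N. s N x) \<longlonglongrightarrow> g x * cis (\<xi> \<bullet> x)"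
    proof (rule AE_I2)
      fix x
      have "(\<lambda>N. \<Sum>n<N. (\<i> * complex_of_real (\<xi> \<bullet> x)) ^ n /\<^sub>R fact n) \<longlonglongrightarrow> exp (\<i> * complex_of_real (\<xi> \<bullet> x))"
        using exp_converges[of "\<i> * complex_of_real (\<xi> \<bullet> x)"] by (simp add: sums_def)
      then show "(\<lambda>N. s N x) \<longlonglongrightarrow> g x * cis (\<xi> \<bullet> x)"
        unfolding s_eq cis_conv_exp by (rule tendsto_mult_left)
    qed
    show "AE x in gauss. norm (s N x) \<le> exp (norm \<xi> * norm x) * cmod (g x)" for N
    proof (rule AE_I2)
      fix x
      have "norm (\<Sum>n<N. (\<i> * complex_of_real (\<xi> \<bullet> x)) ^ n /\<^sub>R fact n) \<le> (\<Sum>n<N. \<bar>\<xi> \<bullet> x\<bar> ^ n /\<^sub>R fact n)"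
        by (rule order_trans[OF norm_sum]) (simp add: norm_power norm_mult)
      also have "\<dots> \<le> exp \<bar>\<xi> \<bullet> x\<bar>"
        unfolding exp_def by (rule sum_le_suminf[OF summable_exp_generic]) auto
      also have "\<dots> \<le> exp (norm \<xi> * norm x)" using Cauchy_Schwarz_ineq2[of \<xi> x] by simp
      finally show "norm (s N x) \<le> exp (norm \<xi> * norm x) * cmod (g x)"
        unfolding s_eq norm_mult by (subst mult.commute) (intro mult_right_mono, auto)
    qed
  qed
  moreover have "(LINT x|gauss. s N x) = 0" for N
    unfolding s_def by (subst Bochner_Integration.integral_sum, intro integrable_mult_right int0)
      (simp only: integral_mult_right_zero zero0 mult_zero_right sum.neutral_const)
  ultimately show ?thesis by (simp add: LIMSEQ_const_iff)
qed

text \<open>A map that factors through the torus of period \<open>2 * pi * r\<close> and tends to the identity as \<open>r \<rightarrow> \<infinity>\<close>. Through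
  it polynomials become trigonometric polynomials, hence bounded functions.\<close>

definition sine_map :: "real \<Rightarrow> real^'n \<Rightarrow> real^'n" where
  "sine_map r x = (\<chi> i. r * sin (x $ i / r))"

lemma measurable_sine_map [measurable]: "sine_map r \<in> borel_measurable borel"
  unfolding sine_map_def[abs_def] divide_inverse by (intro borel_measurable_continuous_onI continuous_intros)

text \<open>A polynomial in sines is a trigonometric polynomial, and these integrate to zero against \<open>g d\<gamma>\<close> by assumption.
  Measurability and boundedness are carried along because the next step needs them for the same polynomial.\<close>

lemma integral_polynomial_sine_map_eq_0:
  fixes g :: "real^'n \<Rightarrow> complex"
  assumes g: "exp_moments g" and m: "\<And>\<xi>. (LINT x|gauss. g x * cis (\<xi> \<bullet> x)) = 0"
    and p: "real_polynomial_function p"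
  shows "(\<lambda>x. p (sine_map r x)) \<in> borel_measurable borel \<and> (\<exists>B. \<forall>x. \<bar>p (sine_map r x)\<bar> \<le> B) \<and>
    (LINT x|gauss. g x * of_real (p (sine_map r x))) = 0"
proof -
  note [measurable] = g
  \<comment> \<open>Multiplication by a member of this space of bounded functions annihilates \<open>g d\<gamma>\<close> together with all its
    characters. It is closed under multiplication by sines, hence, by induction on the polynomial below, under
    multiplication by polynomials in sines; this handles products, where a statement on single integrals would not do.\<close>
  define V where "V v \<longleftrightarrow> v \<in> borel_measurable borel \<and> (\<exists>B. \<forall>x. \<bar>v x\<bar> \<le> B) \<and>
      (\<forall>\<xi>. (LINT x|gauss. g x * (of_real (v x) * cis (\<xi> \<bullet> x))) = 0)" for v :: "real^'n \<Rightarrow> real"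
  have int: "integrable gauss (\<lambda>x. g x * (of_real (v x) * cis (\<xi> \<bullet> x)))" if v: "V v" for v \<xi>
  proof -
    obtain B where B: "\<And>x. \<bar>v x\<bar> \<le> B" and [measurable]: "v \<in> borel_measurable borel" using v by (auto simp: V_def)
    show ?thesis by (rule exp_moments_integrable_bounded[OF g, where C=B]) (measurable, simp add: norm_mult B)
  qed
  have V1: "V (\<lambda>x. 1)" using m unfolding V_def by auto
  have Vadd: "V (\<lambda>x. u x + v x)" if u: "V u" and v: "V v" for u v
  proof -
    obtain B where B: "\<And>x. \<bar>u x\<bar> \<le> B" using u by (auto simp: V_def)
    obtain B' where B': "\<And>x. \<bar>v x\<bar> \<le> B'" using v by (auto simp: V_def)
    have "\<bar>u x + v x\<bar> \<le> B + B'" for x using B[of x] B'[of x] by linarith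
    moreover have "(LINT x|gauss. g x * (of_real (u x + v x) * cis (\<xi> \<bullet> x))) = 0" for \<xi>
      using u v Bochner_Integration.integral_add[OF int[OF u] int[OF v], of \<xi> \<xi>] by (simp add: V_def algebra_simps)
    ultimately show ?thesis using u v unfolding V_def by (auto intro: borel_measurable_add)
  qed
  have Vcmult: "V (\<lambda>x. c * v x)" if v: "V v" for c v
  proof -
    obtain B where B: "\<And>x. \<bar>v x\<bar> \<le> B" using v by (auto simp: V_def)
    have "\<bar>c * v x\<bar> \<le> \<bar>c\<bar> * B" for x using mult_left_mono[OF B, of "\<bar>c\<bar>" x] by (simp add: abs_mult)
    moreover have "(LINT x|gauss. g x * (of_real (c * v x) * cis (\<xi> \<bullet> x))) = 0" for \<xi>
    proof -
      have "(LINT x|gauss. g x * (of_real (c * v x) * cis (\<xi> \<bullet> x))) = (LINT x|gauss. of_real c * (g x * (of_real (v x) * cis (\<xi> \<bullet> x))))"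
        by (simp add: mult_ac)
      then show ?thesis using v by (simp only: integral_mult_right_zero) (simp add: V_def)
    qed
    ultimately show ?thesis using v unfolding V_def by auto
  qed
  have Vsin: "V (\<lambda>x. sin (\<eta> \<bullet> x) * v x)" if v: "V v" for \<eta> v
  proof -
    obtain B where B: "\<And>x. \<bar>v x\<bar> \<le> B" and [measurable]: "v \<in> borel_measurable borel" using v by (auto simp: V_def)
    have "\<bar>sin (\<eta> \<bullet> x) * v x\<bar> \<le> B" for x
      using B[of x] mult_mono[of "\<bar>sin (\<eta> \<bullet> x)\<bar>" 1 "\<bar>v x\<bar>" B] by (simp add: abs_mult)
    moreover have "(LINT x|gauss. g x * (of_real (sin (\<eta> \<bullet> x) * v x) * cis (\<xi> \<bullet> x))) = 0" for \<xi>
    proof -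
      have s: "complex_of_real (sin t) = (cis t - cis (- t)) / (2 * \<i>)" for t by (simp add: complex_eq_iff)
      have "g x * (of_real (sin (\<eta> \<bullet> x) * v x) * cis (\<xi> \<bullet> x)) =
        1 / (2 * \<i>) * (g x * (of_real (v x) * cis ((\<xi> + \<eta>) \<bullet> x)) - g x * (of_real (v x) * cis ((\<xi> - \<eta>) \<bullet> x)))" for x
      proof -
        have "cis ((\<xi> + \<eta>) \<bullet> x) = cis (\<xi> \<bullet> x) * cis (\<eta> \<bullet> x)" "cis ((\<xi> - \<eta>) \<bullet> x) = cis (\<xi> \<bullet> x) * cis (- (\<eta> \<bullet> x))"
          by (simp_all add: cis_mult inner_left_distrib inner_diff_left)
        then show ?thesis unfolding of_real_mult s by (simp add: field_simps)
      qed
      then have "(LINT x|gauss. g x * (of_real (sin (\<eta> \<bullet> x) * v x) * cis (\<xi> \<bullet> x))) =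
        1 / (2 * \<i>) * ((LINT x|gauss. g x * (of_real (v x) * cis ((\<xi> + \<eta>) \<bullet> x))) - (LINT x|gauss. g x * (of_real (v x) * cis ((\<xi> - \<eta>) \<bullet> x))))"
        by (simp only: integral_mult_right_zero Bochner_Integration.integral_diff[OF int[OF v] int[OF v]])
      then show ?thesis using v by (simp add: V_def)
    qed
    moreover have "(\<lambda>x. sin (\<eta> \<bullet> x) * v x) \<in> borel_measurable borel" by measurable
    ultimately show ?thesis unfolding V_def by auto
  qed
  have Vsum: "V (\<lambda>x. \<Sum>i\<in>I. u i x)" if "finite I" "\<And>i. V (u i)" for I :: "'n set" and u
    using that(1)
  proof induction
    case empty
    show ?case using Vcmult[OF V1, of 0] by simp
  next
    case (insert i I)
    then show ?case using Vadd[OF that(2)[of i] insert.IH] by simp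
  qed
  have mult: "V (\<lambda>x. p (sine_map r x) * v x)" if "V v" for v
    using p that
  proof (induction arbitrary: v)
    case (linear f)
    have e: "f (sine_map r x) * v x = (\<Sum>i\<in>UNIV. (f (axis i 1) * r) * (sin ((1 / r) *\<^sub>R axis i 1 \<bullet> x) * v x))" for x
    proof -
      interpret bounded_linear f by fact
      have "f (sine_map r x) = f (\<Sum>i\<in>UNIV. (r * sin (x $ i / r)) *\<^sub>R axis i 1)"
        unfolding sine_map_def by (subst basis_expansion[symmetric]) (simp add: scalar_mult_eq_scaleR)
      also have "\<dots> = (\<Sum>i\<in>UNIV. (r * sin (x $ i / r)) * f (axis i 1))" by (simp add: sum scaleR)
      finally show ?thesis by (simp add: sum_distrib_left sum_distrib_right inner_axis' mult_ac)
    qed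
    show ?case unfolding e by (intro Vsum Vcmult Vsin linear) auto
  next
    case (const c)
    then show ?case by (rule Vcmult)
  next
    case (add p q)
    then show ?case using Vadd[OF add.IH(1) add.IH(2)] by (simp add: algebra_simps)
  next
    case (mult p q)
    show ?case using mult.IH(1)[OF mult.IH(2)[OF mult.prems]] by (simp add: mult.assoc)
  qed
  have *: "V (\<lambda>x. p (sine_map r x))" using mult[OF V1] by simp
  then have "(LINT x|gauss. g x * (of_real (p (sine_map r x)) * cis (0 \<bullet> x))) = 0" unfolding V_def by blast
  then show ?thesis using * by (auto simp: V_def)
qed

text \<open>By the Weierstrass theorem on a cube of side \<open>2 * r\<close>, \<open>G \<circ> sine_map r\<close> is a uniform limit of polynomials in sines,
  so its integral vanishes; then \<open>r \<rightarrow> \<infinity>\<close> by dominated convergence.\<close>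

lemma integral_bounded_continuous_eq_0:
  fixes g :: "real^'n \<Rightarrow> complex"
  assumes g: "exp_moments g" and m: "\<And>\<alpha>. (LINT x|gauss. g x * hermite \<alpha> x) = 0"
    and G: "continuous_on UNIV G" and B: "\<And>x. \<bar>G x\<bar> \<le> B"
  shows "(LINT x|gauss. g x * of_real (G x)) = 0"
proof -
  note [measurable] = g
  have Gm [measurable]: "G \<in> borel_measurable borel" using G by (rule borel_measurable_continuous_onI)
  have gi: "integrable gauss (\<lambda>x. cmod (g x))" 
    using g unfolding exp_moments_def by (metis (no_types, lifting) Bochner_Integration.integrable_cong exp_zero mult_1 mult_zero_left)
  have z: "(LINT x|gauss. g x * of_real (G (sine_map r x))) = 0" if r: "r > 0" for r
  proof -
    let ?S = "cbox (\<chi> i. - r) (\<chi> i. r) :: (real^'n) set"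
    have inS: "sine_map r x \<in> ?S" for x :: "real^'n"
      using r by (auto simp: mem_box_cart sine_map_def mult_le_cancel_left1 intro: order_trans[OF _ mult_left_mono[OF sin_ge_minus_one, of r]])
    have i1: "integrable gauss (\<lambda>x. g x * of_real (G (sine_map r x)))"
      by (rule exp_moments_integrable_bounded[OF g, where C=B]) (measurable, simp add: B)
    \<comment> \<open>Replace \<open>G\<close> by a polynomial that is uniformly \<open>e\<close>-close on the cube containing the range of \<open>sine_map r\<close>.\<close>
    have bnd: "cmod (LINT x|gauss. g x * of_real (G (sine_map r x))) \<le> e * (LINT x|gauss. cmod (g x))" if e: "e > 0" for e
    proof -
      obtain p where p: "real_polynomial_function p" "\<And>x. x \<in> ?S \<Longrightarrow> \<bar>G x - p x\<bar> < e"
        using Stone_Weierstrass_real_polynomial_function[OF compact_cbox _ e, of "(\<chi> i. - r)" "(\<chi> i. r)" G] continuous_on_subset[OF G]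
        by (metis subset_UNIV)
      have P: "(\<lambda>x. p (sine_map r x)) \<in> borel_measurable borel" "\<exists>B. \<forall>x. \<bar>p (sine_map r x)\<bar> \<le> B"
        "(LINT x|gauss. g x * of_real (p (sine_map r x))) = 0"
        using integral_polynomial_sine_map_eq_0[OF g integral_cis_eq_0[OF g m] p(1), of r] by auto
      note [measurable] = P(1)
      obtain B' where B': "\<And>x. \<bar>p (sine_map r x)\<bar> \<le> B'" using P(2) by blast
      have i2: "integrable gauss (\<lambda>x. g x * of_real (p (sine_map r x)))"
        by (rule exp_moments_integrable_bounded[OF g, where C=B']) (measurable, simp add: B')
      have "(LINT x|gauss. g x * of_real (G (sine_map r x))) = (LINT x|gauss. g x * of_real (G (sine_map r x)) - g x * of_real (p (sine_map r x)))"
        using P(3) by (simp add: Bochner_Integration.integral_diff[OF i1 i2])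
      also have "cmod \<dots> \<le> (LINT x|gauss. e * cmod (g x))"
      proof (rule Bochner_Integration.integral_norm_bound_integral)
        show "integrable gauss (\<lambda>x. g x * of_real (G (sine_map r x)) - g x * of_real (p (sine_map r x)))"
          by (rule Bochner_Integration.integrable_diff[OF i1 i2])
        show "integrable gauss (\<lambda>x. e * cmod (g x))" using gi by simp
        fix x
        have "\<bar>G (sine_map r x) - p (sine_map r x)\<bar> \<le> e" using p(2)[OF inS] less_imp_le by blast
        then have "cmod (g x) * \<bar>G (sine_map r x) - p (sine_map r x)\<bar> \<le> cmod (g x) * e" by (intro mult_left_mono) auto
        then show "cmod (g x * of_real (G (sine_map r x)) - g x * of_real (p (sine_map r x))) \<le> e * cmod (g x)"
          by (simp add: right_diff_distrib[symmetric] norm_mult mult.commute flip: of_real_diff)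
      qed
      finally show ?thesis by simp
    qed
    have "cmod (LINT x|gauss. g x * of_real (G (sine_map r x))) \<le> 0 + e" if e: "e > 0" for e
    proof -
      let ?K = "LINT x|gauss. cmod (g x)"
      have K: "?K \<ge> 0" by (rule Bochner_Integration.integral_nonneg) auto
      have "cmod (LINT x|gauss. g x * of_real (G (sine_map r x))) \<le> (e / (?K + 1)) * ?K"
        using add_nonneg_pos[OF K zero_less_one] e by (intro bnd divide_pos_pos)
      also have "\<dots> \<le> e" using add_nonneg_pos[OF K zero_less_one] e by (simp add: field_simps)
      finally show ?thesis by simp
    qed
    then have "cmod (LINT x|gauss. g x * of_real (G (sine_map r x))) \<le> 0" by (rule field_le_epsilon)
    then show ?thesis by simp
  qed
  have "(\<lambda>n. LINT x|gauss. g x * of_real (G (sine_map (real (Suc n)) x))) \<longlonglongrightarrow> (LINT x|gauss. g x * of_real (G x))"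
  proof (rule integral_dominated_convergence)
    show "integrable gauss (\<lambda>x. B * cmod (g x))" using gi by simp
    show "AE x in gauss. (\<lambda>n. g x * of_real (G (sine_map (real (Suc n)) x))) \<longlonglongrightarrow> g x * of_real (G x)"
    proof (rule AE_I2)
      fix x :: "real^'n"
      have "(\<lambda>n. real (Suc n) * sin (t / real (Suc n))) \<longlonglongrightarrow> t" for t :: real by real_asymp
      then have "(\<lambda>n. sine_map (real (Suc n)) x) \<longlonglongrightarrow> x"
        unfolding sine_map_def by (intro vec_tendstoI) simp
      moreover have "isCont G x" using G by (simp add: continuous_on_eq_continuous_at)
      ultimately have "(\<lambda>n. G (sine_map (real (Suc n)) x)) \<longlonglongrightarrow> G x" by (rule isCont_tendsto_compose[rotated])
      then show "(\<lambda>n. g x * of_real (G (sine_map (real (Suc n)) x))) \<longlonglongrightarrow> g x * of_real (G x)"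
        by (intro tendsto_intros)
    qed
    show "AE x in gauss. norm (g x * of_real (G (sine_map (real (Suc n)) x))) \<le> B * cmod (g x)" for n
      using mult_right_mono[OF B norm_ge_zero] by (auto simp: norm_mult mult.commute)
  qed measurable
  then show ?thesis using z by (simp add: LIMSEQ_const_iff)
qed

text \<open>The density \<open>g\<close> integrates to zero over closed sets, whose indicators are limits of bounded continuous
  functions, hence over all Borel sets.\<close>

theorem hermite_complete:
  fixes g :: "real^'n \<Rightarrow> complex"
  assumes g: "exp_moments g" and m: "\<And>\<alpha>. (LINT x|gauss. g x * hermite \<alpha> x) = 0"
  shows "AE x in gauss. g x = 0"
proof (rule sigma_finite_measure.density_zero)
  have "emeasure (gauss :: (real^'n) measure) UNIV < \<infinity>"
    using integrable_gauss_exp_norm[of 0, where 'n='n] by (simp add: integrable_iff_bounded)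
  then have "finite_measure (gauss :: (real^'n) measure)" by (intro finite_measureI) simp
  then show "sigma_finite_measure (gauss :: (real^'n) measure)" by (rule finite_measure.axioms)
  note [measurable] = g
  have gi: "integrable gauss (\<lambda>x. cmod (g x))" 
    using g unfolding exp_moments_def by (metis (no_types, lifting) Bochner_Integration.integrable_cong exp_zero mult_1 mult_zero_left)
  show gi': "integrable gauss g" using gi by (subst integrable_norm_iff[symmetric]) auto
  have closed0: "set_lebesgue_integral gauss C g = 0" if C: "closed C" for C :: "(real^'n) set"
  proof (cases "C = {}")
    case False
    have [measurable]: "C \<in> sets borel" using C by auto
    \<comment> \<open>Continuous functions that decrease to the indicator of \<open>C\<close>.\<close>
    define G where "G k x = max 0 (1 - real k * infdist x C)" for k x
    have cG: "continuous_on UNIV (G k)" for k unfolding G_def by (intro continuous_intros)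
    then have [measurable]: "G k \<in> borel_measurable borel" for k by (rule borel_measurable_continuous_onI)
    have G1: "\<bar>G k x\<bar> \<le> 1" for k x using infdist_nonneg[of x C] by (auto simp: G_def)
    have "(\<lambda>k. LINT x|gauss. g x * of_real (G k x)) \<longlonglongrightarrow> (LINT x|gauss. g x * of_real (indicator C x))"
    proof (rule integral_dominated_convergence[OF _ _ gi])
      show "AE x in gauss. (\<lambda>k. g x * of_real (G k x)) \<longlonglongrightarrow> g x * of_real (indicator C x)"
      proof (rule AE_I2)
        fix x
        have "(\<lambda>k. G k x) \<longlonglongrightarrow> indicator C x"
        proof (cases "x \<in> C")
          case True
          then show ?thesis by (simp add: G_def)
        next
          case xC: False
          then have d: "infdist x C > 0" using C False in_closed_iff_infdist_zero[of C x] infdist_nonneg[of x C] by auto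
          obtain K where K: "1 < real K * infdist x C" using reals_Archimedean3[OF d] by blast
          have "eventually (\<lambda>k. G k x = 0) sequentially"
            using eventually_ge_at_top[of K]
          proof eventually_elim
            case (elim k)
            then have "real K * infdist x C \<le> real k * infdist x C" using d by (intro mult_right_mono) auto
            then show ?case using K by (simp add: G_def)
          qed
          then show ?thesis using xC by (simp add: tendsto_eventually)
        qed
        then show "(\<lambda>k. g x * of_real (G k x)) \<longlonglongrightarrow> g x * of_real (indicator C x)" by (intro tendsto_intros)
      qed
      show "AE x in gauss. norm (g x * of_real (G k x)) \<le> cmod (g x)" for k
        using mult_left_mono[OF G1 norm_ge_zero] by (auto simp: norm_mult)
    qed measurable
    then have "(LINT x|gauss. g x * of_real (indicator C x)) = 0"
      using integral_bounded_continuous_eq_0[OF g m cG G1] by (simp add: LIMSEQ_const_iff)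
    then show ?thesis by (simp add: set_lebesgue_integral_def scaleR_conv_of_real mult.commute)
  qed (simp add: set_lebesgue_integral_def)
  fix A :: "(real^'n) set" assume A: "A \<in> sets gauss"
  have "Int_stable (Collect closed :: (real^'n) set set)" by (auto simp: Int_stable_def)
  moreover have "Collect closed \<subseteq> Pow (UNIV :: (real^'n) set)" by simp
  moreover have "A \<in> sigma_sets UNIV (Collect closed)" using A by (simp add: borel_eq_closed)
  ultimately show "set_lebesgue_integral gauss A g = 0"
  proof (induction rule: sigma_sets_induct_disjoint)
    case (basic A)
    then show ?case using closed0 by simp
  next
    case empty
    show ?case by (simp add: set_lebesgue_integral_def)
  next
    case (compl A)
    then have [measurable]: "A \<in> sets borel" by (simp add: borel_eq_closed)
    have "set_integrable gauss A g" "set_integrable gauss (UNIV - A) g"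
      unfolding set_integrable_def by (intro integrable_mult_indicator gi', simp)+
    then have "set_lebesgue_integral gauss (A \<union> (UNIV - A)) g = set_lebesgue_integral gauss A g + set_lebesgue_integral gauss (UNIV - A) g"
      by (intro set_integral_Un) auto
    then show ?case using closed0[OF closed_UNIV] compl.IH by simp
  next
    case (union A)
    then have [measurable]: "A i \<in> sets borel" for i using union.hyps(2) by (auto simp: borel_eq_closed)
    have "set_lebesgue_integral gauss (\<Union>i. A i) g = (\<Sum>i. set_lebesgue_integral gauss (A i) g)"
      using union.hyps(1) by (intro lebesgue_integral_countable_add)
        (auto simp: disjoint_family_on_def set_integrable_def intro!: integrable_mult_indicator gi')
    then show ?case using union.IH by simp
  qed
qed

section \<open>Square-integrable functions\<close>

lemma norm_sq_add_le: "ennreal ((cmod (a + b))\<^sup>2) \<le> 2 * ennreal ((cmod a)\<^sup>2) + 2 * ennreal ((cmod b)\<^sup>2)"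
proof -
  have "(cmod (a + b))\<^sup>2 \<le> (cmod a + cmod b)\<^sup>2" by (intro power_mono norm_triangle_ineq) auto
  also have "\<dots> \<le> 2 * (cmod a)\<^sup>2 + 2 * (cmod b)\<^sup>2"
    using sum_squares_bound[of "cmod a" "cmod b"] by (simp add: power2_sum)
  finally have "ennreal ((cmod (a + b))\<^sup>2) \<le> ennreal (2 * (cmod a)\<^sup>2 + 2 * (cmod b)\<^sup>2)" by (rule ennreal_leI)
  then show ?thesis by (simp add: ennreal_mult)
qed

lemma nn_integral_norm_sq_add_le:
  assumes [measurable]: "f \<in> borel_measurable M" "g \<in> borel_measurable M"
  shows "(\<integral>\<^sup>+x. ennreal ((cmod (f x + g x))\<^sup>2) \<partial>M) \<le>
    2 * (\<integral>\<^sup>+x. ennreal ((cmod (f x))\<^sup>2) \<partial>M) + 2 * (\<integral>\<^sup>+x. ennreal ((cmod (g x))\<^sup>2) \<partial>M)"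
proof -
  have "(\<integral>\<^sup>+x. ennreal ((cmod (f x + g x))\<^sup>2) \<partial>M) \<le>
     (\<integral>\<^sup>+x. 2 * ennreal ((cmod (f x))\<^sup>2) + 2 * ennreal ((cmod (g x))\<^sup>2) \<partial>M)"
    by (intro nn_integral_mono norm_sq_add_le)
  also have "\<dots> = 2 * (\<integral>\<^sup>+x. ennreal ((cmod (f x))\<^sup>2) \<partial>M) + 2 * (\<integral>\<^sup>+x. ennreal ((cmod (g x))\<^sup>2) \<partial>M)"
    by (subst nn_integral_add) (auto simp: nn_integral_cmult)
  finally show ?thesis .
qed

lemma L2_iff_nn_integral:
  assumes "f \<in> borel_measurable M"
  shows "f \<in> L2 M \<longleftrightarrow> (\<integral>\<^sup>+x. ennreal ((cmod (f x))\<^sup>2) \<partial>M) < \<infinity>"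
  using assms by (auto simp: L2_def integrable_iff_bounded)

lemma L2_add: "f \<in> L2 M \<Longrightarrow> g \<in> L2 M \<Longrightarrow> (\<lambda>x. f x + g x) \<in> L2 M"
proof -
  assume fg: "f \<in> L2 M" "g \<in> L2 M"
  then have [measurable]: "f \<in> borel_measurable M" "g \<in> borel_measurable M" by (auto simp: L2_def)
  have "2 * (\<integral>\<^sup>+x. ennreal ((cmod (f x))\<^sup>2) \<partial>M) + 2 * (\<integral>\<^sup>+x. ennreal ((cmod (g x))\<^sup>2) \<partial>M) < \<infinity>"
    using fg by (simp add: L2_iff_nn_integral ennreal_mult_less_top)
  then show "(\<lambda>x. f x + g x) \<in> L2 M"
    using nn_integral_norm_sq_add_le[of f M g] by (simp add: L2_iff_nn_integral order_le_less_trans)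
qed

lemma L2_cmult: "f \<in> L2 M \<Longrightarrow> (\<lambda>x. c * f x) \<in> L2 M"
  by (auto simp: L2_def norm_mult power_mult_distrib)

lemma L2_diff: "f \<in> L2 M \<Longrightarrow> g \<in> L2 M \<Longrightarrow> (\<lambda>x. f x - g x) \<in> L2 M"
  using L2_add[of f M "\<lambda>x. (-1) * g x"] L2_cmult[of g M "-1"] by simp

lemma L2_sum: "finite A \<Longrightarrow> (\<And>a. a \<in> A \<Longrightarrow> u a \<in> L2 M) \<Longrightarrow> (\<lambda>x. \<Sum>a\<in>A. u a x) \<in> L2 M"
proof (induction rule: finite_induct)
  case empty
  show ?case by (simp add: L2_def)
next
  case (insert a A)
  then show ?case by (simp add: L2_add)
qed

lemma L2_mult_integrable:
  assumes f: "f \<in> L2 M" and g: "g \<in> L2 M"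
  shows "integrable M (\<lambda>x. f x * g x)"
proof (rule Bochner_Integration.integrable_bound)
  show "integrable M (\<lambda>x. (cmod (f x))\<^sup>2 + (cmod (g x))\<^sup>2)"
    using f g by (auto simp: L2_def)
  have [measurable]: "f \<in> borel_measurable M" "g \<in> borel_measurable M" using f g by (auto simp: L2_def)
  show "(\<lambda>x. f x * g x) \<in> borel_measurable M" by measurable
  have "a * b \<le> a\<^sup>2 + b\<^sup>2" if "a \<ge> 0" "b \<ge> 0" for a b :: real
    using that sum_squares_bound[of a b] mult_nonneg_nonneg[of a b] by linarith
  then show "AE x in M. norm (f x * g x) \<le> norm ((cmod (f x))\<^sup>2 + (cmod (g x))\<^sup>2)"
    by (auto simp: norm_mult)
qed

lemma L2_cnj: "f \<in> L2 M \<Longrightarrow> (\<lambda>x. cnj (f x)) \<in> L2 M"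
proof -
  assume f: "f \<in> L2 M"
  have [measurable]: "cnj \<in> borel_measurable borel"
    by (intro borel_measurable_continuous_onI continuous_intros)
  have [measurable]: "f \<in> borel_measurable M" using f by (simp add: L2_def)
  have "(\<lambda>x. cnj (f x)) \<in> borel_measurable M" by measurable
  then show "(\<lambda>x. cnj (f x)) \<in> L2 M" using f by (simp add: L2_def)
qed

text \<open>Only eventually are the \<open>u i\<close> square-integrable: this is a consequence of the convergence, and it is
  what makes the lemma applicable to a sequence of Fourier transforms.\<close>

lemma L2_tendsto_inner:
  assumes u: "\<And>i. u i \<in> borel_measurable M" and f: "f \<in> L2 M" and h: "h \<in> L2 M" and lim: "L2_tendsto M u f F"
  shows "((\<lambda>i. LINT x|M. u i x * h x) \<longlongrightarrow> (LINT x|M. f x * h x)) F"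
proof -
  have [measurable]: "u i \<in> borel_measurable M" "f \<in> borel_measurable M" "h \<in> borel_measurable M" for i
    using u f h by (auto simp: L2_def)
  define D where "D i = (\<integral>\<^sup>+x. ennreal ((cmod (u i x - f x))\<^sup>2) \<partial>M)" for i
  define K where "K = (\<integral>\<^sup>+x. ennreal ((cmod (h x))\<^sup>2) \<partial>M)"
  have K: "K < \<infinity>" using h by (simp add: L2_iff_nn_integral K_def)
  have D0: "(D \<longlongrightarrow> 0) F" using lim unfolding L2_tendsto_def D_def .
  have bound: "ennreal ((norm ((LINT x|M. u i x * h x) - (LINT x|M. f x * h x)))\<^sup>2) \<le> K * D i" if Di: "D i < \<infinity>" for i
  proof -
    have d: "(\<lambda>x. u i x - f x) \<in> L2 M" using Di by (subst L2_iff_nn_integral) (auto simp: D_def)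
    then have "(\<lambda>x. (u i x - f x) + f x) \<in> L2 M" using f by (rule L2_add)
    then have ui: "u i \<in> L2 M" by simp
    have "(LINT x|M. u i x * h x) - (LINT x|M. f x * h x) = (LINT x|M. (u i x - f x) * h x)"
      by (simp add: left_diff_distrib Bochner_Integration.integral_diff[OF L2_mult_integrable[OF ui h] L2_mult_integrable[OF f h]])
    also have "ennreal (norm \<dots>) \<le> (\<integral>\<^sup>+x. norm ((u i x - f x) * h x) \<partial>M)"
      by (rule integral_norm_bound_ennreal[OF L2_mult_integrable[OF d h]])
    also have "\<dots> = (\<integral>\<^sup>+x. ennreal (cmod (u i x - f x)) * ennreal (cmod (h x)) \<partial>M)"
      by (simp add: norm_mult ennreal_mult)
    finally have "(ennreal (norm ((LINT x|M. u i x * h x) - (LINT x|M. f x * h x))))\<^sup>2 \<le> (\<integral>\<^sup>+x. ennreal (cmod (u i x - f x)) * ennreal (cmod (h x)) \<partial>M)\<^sup>2"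
      by (rule power_mono) simp
    also have "\<dots> \<le> (\<integral>\<^sup>+x. (ennreal (cmod (u i x - f x)))\<^sup>2 \<partial>M) * (\<integral>\<^sup>+x. (ennreal (cmod (h x)))\<^sup>2 \<partial>M)"
      by (rule Cauchy_Schwarz_nn_integral) measurable
    also have "\<dots> = K * D i" by (simp add: D_def K_def ennreal_power mult.commute)
    finally show ?thesis by (simp add: ennreal_power)
  qed
  have ev: "eventually (\<lambda>i. ennreal ((norm ((LINT x|M. u i x * h x) - (LINT x|M. f x * h x)))\<^sup>2) \<le> K * D i) F"
    using order_tendstoD(2)[OF D0, of \<infinity>] by (auto elim!: eventually_mono intro: bound)
  have KD: "((\<lambda>i. K * D i) \<longlongrightarrow> 0) F"
    using ennreal_tendsto_cmult[OF _ D0, of K] K by simp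
  have "((\<lambda>i. ennreal ((norm ((LINT x|M. u i x * h x) - (LINT x|M. f x * h x)))\<^sup>2)) \<longlongrightarrow> 0) F"
    by (rule tendsto_sandwich[OF _ ev tendsto_const KD]) simp
  then have "((\<lambda>i. (norm ((LINT x|M. u i x * h x) - (LINT x|M. f x * h x)))\<^sup>2) \<longlongrightarrow> 0) F"
    by (subst (asm) ennreal_0[symmetric], subst (asm) tendsto_ennreal_iff) auto
  then have "((\<lambda>i. sqrt ((norm ((LINT x|M. u i x * h x) - (LINT x|M. f x * h x)))\<^sup>2)) \<longlongrightarrow> sqrt 0) F"
    by (rule tendsto_real_sqrt)
  then have "((\<lambda>i. (LINT x|M. u i x * h x) - (LINT x|M. f x * h x)) \<longlongrightarrow> 0) F"
    by (simp add: tendsto_norm_zero_iff)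
  then show ?thesis by (rule LIM_zero_cancel)
qed

text \<open>The Riesz--Fischer argument. With increments \<open>d\<^sub>n\<close> of squared norm at most \<open>4\<^bsup>-n\<^esup>\<close>, the function \<open>\<Sum> 2\<^sup>n |d\<^sub>n|\<^sup>2\<close>
  has finite integral, so \<open>|d\<^sub>n| = O(2\<^bsup>-n/2\<^esup>)\<close> almost everywhere and the sequence converges pointwise. Fatou's lemma
  turns this into convergence in mean with the same rate.\<close>

lemma L2_fast_Cauchy_limit:
  fixes u :: "nat \<Rightarrow> 'a \<Rightarrow> complex"
  assumes [measurable]: "\<And>n. u n \<in> borel_measurable M"
    and cau: "\<And>m n. n \<le> m \<Longrightarrow> (\<integral>\<^sup>+x. ennreal ((cmod (u m x - u n x))\<^sup>2) \<partial>M) \<le> ennreal ((1/4) ^ n)"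
  obtains g where "g \<in> borel_measurable M" "\<And>n. (\<integral>\<^sup>+x. ennreal ((cmod (u n x - g x))\<^sup>2) \<partial>M) \<le> ennreal ((1/4) ^ n)"
proof
  define d where "d n x = u (Suc n) x - u n x" for n x
  define g where "g x = lim (\<lambda>n. u n x)" for x
  have [measurable]: "d n \<in> borel_measurable M" for n unfolding d_def[abs_def] by measurable
  show [measurable]: "g \<in> borel_measurable M" unfolding g_def[abs_def] by measurable
  \<comment> \<open>The factor \<open>2 ^ n\<close> splits the gain \<open>4 ^ n\<close> evenly between summability of the integrals and decay of the increments.\<close>
  define h where "h x = (\<Sum>n. ennreal (2 ^ n * (cmod (d n x))\<^sup>2))" for x
  have [measurable]: "h \<in> borel_measurable M" unfolding h_def[abs_def] by measurable
  have "(\<integral>\<^sup>+x. h x \<partial>M) = (\<Sum>n. \<integral>\<^sup>+x. ennreal (2 ^ n * (cmod (d n x))\<^sup>2) \<partial>M)"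
    unfolding h_def by (rule nn_integral_suminf) measurable
  also have "\<dots> \<le> (\<Sum>n. ennreal ((1/2) ^ n))"
  proof (intro suminf_le allI)
    fix n
    have "(\<integral>\<^sup>+x. ennreal (2 ^ n * (cmod (d n x))\<^sup>2) \<partial>M) = ennreal (2 ^ n) * (\<integral>\<^sup>+x. ennreal ((cmod (d n x))\<^sup>2) \<partial>M)"
      by (simp add: ennreal_mult nn_integral_cmult)
    also have "\<dots> \<le> ennreal (2 ^ n) * ennreal ((1/4) ^ n)"
      unfolding d_def by (intro mult_left_mono cau) auto
    also have "\<dots> = ennreal ((1/2) ^ n)"
      by (simp add: ennreal_mult[symmetric] power_mult_distrib[symmetric])
    finally show "(\<integral>\<^sup>+x. ennreal (2 ^ n * (cmod (d n x))\<^sup>2) \<partial>M) \<le> ennreal ((1/2) ^ n)" .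
  qed auto
  also have "\<dots> < \<infinity>" by (simp add: suminf_ennreal_eq[OF _ geometric_sums[of "1/2::real"]])
  finally have "AE x in M. h x \<noteq> \<infinity>" by (intro nn_integral_PInf_AE) auto
  then have conv: "AE x in M. (\<lambda>n. u n x) \<longlonglongrightarrow> g x"
  proof eventually_elim
    case (elim x)
    obtain H where H: "h x = ennreal H" "H \<ge> 0" using elim by (cases "h x") auto
    have bd: "cmod (d n x) \<le> sqrt H * sqrt (1/2) ^ n" for n
    proof -
      define T where "T n = ennreal (2 ^ n * (cmod (d n x))\<^sup>2)" for n
      have "sum T {n} \<le> suminf T" by (rule sum_le_suminf) auto
      then have "T n \<le> ennreal H" using H(1) unfolding h_def T_def[symmetric] by simp
      then have "ennreal (2 ^ n * (cmod (d n x))\<^sup>2) \<le> ennreal H" unfolding T_def .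
      then have "2 ^ n * (cmod (d n x))\<^sup>2 \<le> H" using H(2) by (simp add: ennreal_le_iff)
      then have "(cmod (d n x))\<^sup>2 \<le> H * (1/2) ^ n" by (simp add: field_simps)
      then have "cmod (d n x) \<le> sqrt (H * (1/2) ^ n)" by (rule real_le_rsqrt)
      then show ?thesis by (simp add: real_sqrt_mult real_sqrt_power)
    qed
    have "summable (\<lambda>n. sqrt H * sqrt (1/2) ^ n)"
      by (intro summable_mult summable_geometric) (auto simp: real_sqrt_lt_1_iff)
    then have "summable (\<lambda>n. d n x)" by (rule summable_comparison_test') (rule bd)
    then have "(\<lambda>n. \<Sum>k<n. d k x) \<longlonglongrightarrow> (\<Sum>k. d k x)" by (rule summable_LIMSEQ)
    moreover have "(\<Sum>k<n. d k x) = u n x - u 0 x" for n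
      unfolding d_def by (rule sum_lessThan_telescope)
    ultimately have "(\<lambda>n. u n x - u 0 x + u 0 x) \<longlonglongrightarrow> (\<Sum>k. d k x) + u 0 x" by (intro tendsto_add tendsto_const) simp
    then have "convergent (\<lambda>n. u n x)" by (auto simp: convergent_def)
    then show ?case unfolding g_def by (simp add: convergent_LIMSEQ_iff)
  qed
  fix n
  have "(\<integral>\<^sup>+x. ennreal ((cmod (u n x - g x))\<^sup>2) \<partial>M) \<le> (\<integral>\<^sup>+x. liminf (\<lambda>m. ennreal ((cmod (u n x - u m x))\<^sup>2)) \<partial>M)"
  proof (rule nn_integral_mono_AE)
    show "AE x in M. ennreal ((cmod (u n x - g x))\<^sup>2) \<le> liminf (\<lambda>m. ennreal ((cmod (u n x - u m x))\<^sup>2))"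
      using conv
    proof eventually_elim
      case (elim x)
      then have t: "(\<lambda>m. ennreal ((cmod (u n x - u m x))\<^sup>2)) \<longlonglongrightarrow> ennreal ((cmod (u n x - g x))\<^sup>2)"
        by (intro tendsto_ennrealI tendsto_intros)
      show ?case unfolding lim_imp_Liminf[OF trivial_limit_sequentially t] ..
    qed
  qed
  also have "\<dots> \<le> liminf (\<lambda>m. \<integral>\<^sup>+x. ennreal ((cmod (u n x - u m x))\<^sup>2) \<partial>M)"
    by (rule nn_integral_liminf) measurable
  also have "\<dots> \<le> liminf (\<lambda>m. ennreal ((1/4) ^ n))"
  proof (rule Liminf_mono)
    show "eventually (\<lambda>m. (\<integral>\<^sup>+x. ennreal ((cmod (u n x - u m x))\<^sup>2) \<partial>M) \<le> ennreal ((1/4) ^ n)) sequentially"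
      using eventually_ge_at_top[of n] by eventually_elim
        (use cau in \<open>simp add: norm_minus_commute[of "u n x" "u m x" for x m]\<close>)
  qed
  also have "\<dots> = ennreal ((1/4) ^ n)" by (simp add: Liminf_const)
  finally show "(\<integral>\<^sup>+x. ennreal ((cmod (u n x - g x))\<^sup>2) \<partial>M) \<le> ennreal ((1/4) ^ n)" .
qed

section \<open>Hermite expansions and the functional calculus\<close>

text \<open>Integrability comes for free: the Bochner integral of a function that is not integrable is \<open>0\<close>, whereas
  \<open>hermite_orthogonal\<close> gives a positive value.\<close>

lemma hermite_L2 [simp]: "hermite \<alpha> \<in> L2 gauss"
proof -
  have "L2_inner gauss (hermite \<alpha>) (hermite \<alpha>) \<noteq> 0" using hermite_norm_sq_pos[of \<alpha>] by (simp add: hermite_orthogonal)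
  then have "integrable gauss (\<lambda>x. hermite \<alpha> x * cnj (hermite \<alpha> x))"
    unfolding L2_inner_def using not_integrable_integral_eq by blast
  then have "integrable gauss (\<lambda>x. complex_of_real ((cmod (hermite \<alpha> x))\<^sup>2))"
    by (simp only: complex_norm_square)
  then have "integrable gauss (\<lambda>x. Re (complex_of_real ((cmod (hermite \<alpha> x))\<^sup>2)))" by (rule integrable_Re)
  then have "integrable gauss (\<lambda>x. (cmod (hermite \<alpha> x))\<^sup>2)" by (simp only: Re_complex_of_real)
  then show ?thesis by (simp add: L2_def)
qed

lemma hermite_sum_L2: "finite A \<Longrightarrow> (\<lambda>x. \<Sum>\<alpha>\<in>A. a \<alpha> * hermite \<alpha> x) \<in> L2 gauss"
  by (intro L2_sum L2_cmult hermite_L2)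

lemma integral_hermite_mult:
  "(LINT x|gauss. hermite \<alpha> x * hermite \<beta> x) = (if \<alpha> = \<beta> then of_real (hermite_norm_sq \<alpha>) else 0)"
  using hermite_orthogonal[of \<alpha> \<beta>] by (simp add: L2_inner_def)

lemma integral_hermite_sum:
  assumes f: "f \<in> L2 gauss" and A: "finite A"
  shows "(LINT x|gauss. f x * (\<Sum>\<alpha>\<in>A. a \<alpha> * hermite \<alpha> x)) = (\<Sum>\<alpha>\<in>A. a \<alpha> * (LINT x|gauss. f x * hermite \<alpha> x))"
proof -
  have "(LINT x|gauss. f x * (\<Sum>\<alpha>\<in>A. a \<alpha> * hermite \<alpha> x)) = (LINT x|gauss. (\<Sum>\<alpha>\<in>A. a \<alpha> * (f x * hermite \<alpha> x)))"
    by (simp add: sum_distrib_left mult_ac)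
  also have "\<dots> = (\<Sum>\<alpha>\<in>A. LINT x|gauss. a \<alpha> * (f x * hermite \<alpha> x))"
    by (rule Bochner_Integration.integral_sum) (intro integrable_mult_right L2_mult_integrable f hermite_L2)
  finally show ?thesis by simp
qed

lemma hermite_sum_coeff:
  assumes A: "finite A"
  shows "(LINT x|gauss. (\<Sum>\<alpha>\<in>A. a \<alpha> * hermite \<alpha> x) * hermite \<beta> x) = (if \<beta> \<in> A then a \<beta> * of_real (hermite_norm_sq \<beta>) else 0)"
proof -
  have "(LINT x|gauss. (\<Sum>\<alpha>\<in>A. a \<alpha> * hermite \<alpha> x) * hermite \<beta> x) = (\<Sum>\<alpha>\<in>A. a \<alpha> * (LINT x|gauss. hermite \<beta> x * hermite \<alpha> x))"
    by (subst integral_hermite_sum[symmetric]) (simp_all add: A mult.commute)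
  also have "\<dots> = (\<Sum>\<alpha>\<in>A. if \<alpha> = \<beta> then a \<beta> * of_real (hermite_norm_sq \<beta>) else 0)"
    by (intro sum.cong) (auto simp: integral_hermite_mult)
  finally show ?thesis using A by (simp add: sum.delta)
qed

lemma integral_norm_sq:
  "complex_of_real (LINT x|M. (cmod (f x))\<^sup>2) = (LINT x|M. f x * cnj (f x))"
  unfolding complex_norm_square[symmetric] by (rule integral_complex_of_real[symmetric])

lemma cnj_mult_norm_sq: "cnj a * (a * of_real h) = of_real ((cmod a)\<^sup>2 * h)"
  by (simp only: of_real_mult complex_norm_square mult_ac)

lemma hermite_sum_norm:
  assumes A: "finite A"
  shows "(LINT x|gauss. (cmod (\<Sum>\<alpha>\<in>A. a \<alpha> * hermite \<alpha> x))\<^sup>2) = (\<Sum>\<alpha>\<in>A. (cmod (a \<alpha>))\<^sup>2 * hermite_norm_sq \<alpha>)"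
proof -
  have "complex_of_real (LINT x|gauss. (cmod (\<Sum>\<alpha>\<in>A. a \<alpha> * hermite \<alpha> x))\<^sup>2) =
     (LINT x|gauss. (\<Sum>\<alpha>\<in>A. a \<alpha> * hermite \<alpha> x) * (\<Sum>\<alpha>\<in>A. cnj (a \<alpha>) * hermite \<alpha> x))"
    by (subst integral_norm_sq) simp
  also have "\<dots> = (\<Sum>\<alpha>\<in>A. cnj (a \<alpha>) * (a \<alpha> * of_real (hermite_norm_sq \<alpha>)))"
    by (subst integral_hermite_sum[OF hermite_sum_L2[OF A] A], intro sum.cong) (auto simp: hermite_sum_coeff A)
  also have "\<dots> = of_real (\<Sum>\<alpha>\<in>A. (cmod (a \<alpha>))\<^sup>2 * hermite_norm_sq \<alpha>)"
    unfolding cnj_mult_norm_sq of_real_sum ..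
  finally show ?thesis by (simp only: of_real_eq_iff)
qed

lemma hermite_coeff_mult_norm_sq: "(LINT x|gauss. f x * hermite \<alpha> x) = hermite_coeff f \<alpha> * of_real (hermite_norm_sq \<alpha>)"
  using hermite_norm_sq_pos[of \<alpha>] by (simp add: hermite_coeff_def L2_inner_def integral_hermite_mult)

text \<open>Expand \<open>\<parallel>f - S\<parallel>\<^sup>2 \<ge> 0\<close> for the partial sum \<open>S\<close> of the Hermite expansion of \<open>f\<close>.\<close>

lemma hermite_Bessel_inequality:
  assumes f: "f \<in> L2 gauss" and A: "finite A"
  shows "(\<Sum>\<alpha>\<in>A. (cmod (hermite_coeff f \<alpha>))\<^sup>2 * hermite_norm_sq \<alpha>) \<le> (LINT x|gauss. (cmod (f x))\<^sup>2)"
proof -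
  define S where "S x = (\<Sum>\<alpha>\<in>A. hermite_coeff f \<alpha> * hermite \<alpha> x)" for x
  define B where "B = (\<Sum>\<alpha>\<in>A. (cmod (hermite_coeff f \<alpha>))\<^sup>2 * hermite_norm_sq \<alpha>)"
  have S: "S \<in> L2 gauss" unfolding S_def[abs_def] by (rule hermite_sum_L2[OF A])
  have cS: "cnj (S x) = (\<Sum>\<alpha>\<in>A. cnj (hermite_coeff f \<alpha>) * hermite \<alpha> x)" for x by (simp add: S_def)
  have fS: "(LINT x|gauss. f x * cnj (S x)) = of_real B"
    unfolding cS integral_hermite_sum[OF f A] hermite_coeff_mult_norm_sq B_def
      cnj_mult_norm_sq of_real_sum ..
  have fS': "integrable gauss (\<lambda>x. f x * cnj (S x))" by (rule L2_mult_integrable[OF f L2_cnj[OF S]])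
  define r where "r x = Re (f x * cnj (S x))" for x
  have r: "integrable gauss r" unfolding r_def[abs_def] using fS' by (rule integrable_Re)
  have e: "(cmod (f x - S x))\<^sup>2 = (cmod (f x))\<^sup>2 - 2 * r x + (cmod (S x))\<^sup>2" for x
    unfolding cmod_power2 r_def by (simp add: power2_eq_square algebra_simps)
  have i: "integrable gauss (\<lambda>x. (cmod (f x))\<^sup>2)" "integrable gauss (\<lambda>x. (cmod (S x))\<^sup>2)" using f S by (auto simp: L2_def)
  have "0 \<le> (LINT x|gauss. (cmod (f x - S x))\<^sup>2)" by simp
  also have "\<dots> = (LINT x|gauss. (cmod (f x))\<^sup>2) - 2 * (LINT x|gauss. r x) + (LINT x|gauss. (cmod (S x))\<^sup>2)"
    unfolding e using i r by simp
  also have "(LINT x|gauss. r x) = B" unfolding r_def using fS by (simp only: integral_Re[OF fS'] Re_complex_of_real)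
  also have "(LINT x|gauss. (cmod (S x))\<^sup>2) = B" unfolding S_def B_def by (rule hermite_sum_norm[OF A])
  finally show ?thesis unfolding B_def by simp
qed

text \<open>Choose an increasing sequence \<open>C k\<close> of finite index sets that leave less than \<open>4\<^bsup>-k\<^esup>\<close> of the squared norms
  outside. The corresponding partial sums converge fast, and every finite set that contains \<open>C k\<close> is as close
  to the limit as \<open>C k\<close>, up to a constant.\<close>

lemma hermite_series:
  fixes a :: "nat^'n \<Rightarrow> complex"
  assumes sm: "(\<lambda>\<alpha>. (cmod (a \<alpha>))\<^sup>2 * hermite_norm_sq \<alpha>) summable_on UNIV"
  obtains g where "g \<in> L2 gauss"
    "L2_tendsto gauss (\<lambda>A x. \<Sum>\<alpha>\<in>A. a \<alpha> * hermite \<alpha> x) g (finite_subsets_at_top UNIV)"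
proof -
  define w where "w \<alpha> = (cmod (a \<alpha>))\<^sup>2 * hermite_norm_sq \<alpha>" for \<alpha>
  have w0: "w \<alpha> \<ge> 0" for \<alpha> using hermite_norm_sq_pos[of \<alpha>] by (simp add: w_def)
  define s where "s = infsum w UNIV"
  have hs: "(w has_sum s) UNIV" using sm unfolding w_def s_def by (rule has_sum_infsum)
  define S where "S A x = (\<Sum>\<alpha>\<in>A. a \<alpha> * hermite \<alpha> x)" for A x
  have SL: "S A \<in> L2 gauss" if "finite A" for A unfolding S_def[abs_def] by (rule hermite_sum_L2[OF that])
  have Sm [measurable]: "S A \<in> borel_measurable borel" for A unfolding S_def[abs_def] by measurable
  \<comment> \<open>The rate \<open>4 ^ (- k)\<close> is the one required by \<open>L2_fast_Cauchy_limit\<close>.\<close>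
  have "\<exists>A. finite A \<and> s - sum w A < (1/4) ^ k" for k
  proof -
    have "eventually (\<lambda>A. sum w A > s - (1/4) ^ k) (finite_subsets_at_top UNIV)"
      using hs unfolding has_sum_def by (rule order_tendstoD) simp
    then obtain A where "finite A" "sum w A > s - (1/4) ^ k" unfolding eventually_finite_subsets_at_top by blast
    then show ?thesis by (intro exI[of _ A]) auto
  qed
  then obtain A where A: "\<And>k. finite (A k)" "\<And>k. s - sum w (A k) < (1/4) ^ k" by metis
  define C where "C k = (\<Union>j\<le>k. A j)" for k
  have C: "finite (C k)" for k by (simp add: C_def A)
  have Cmono: "C k \<subseteq> C m" if "k \<le> m" for k m using that by (force simp: C_def)
  have near: "(\<integral>\<^sup>+x. ennreal ((cmod (S B x - S (C k) x))\<^sup>2) \<partial>gauss) \<le> ennreal ((1/4) ^ k)"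
    if B: "finite B" "C k \<subseteq> B" for B k
  proof -
    have eq: "S B x - S (C k) x = (\<Sum>\<alpha>\<in>B - C k. a \<alpha> * hermite \<alpha> x)" for x
      unfolding S_def by (rule sum_diff[OF B, symmetric])
    have "(\<integral>\<^sup>+x. ennreal ((cmod (S B x - S (C k) x))\<^sup>2) \<partial>gauss) = ennreal (LINT x|gauss. (cmod (\<Sum>\<alpha>\<in>B - C k. a \<alpha> * hermite \<alpha> x))\<^sup>2)"
      unfolding eq using hermite_sum_L2[of "B - C k" a] B by (intro nn_integral_eq_integral) (auto simp: L2_def)
    also have "\<dots> = ennreal (sum w (B - C k))"
      using hermite_sum_norm[of "B - C k" a] B by (simp add: w_def)
    also have "\<dots> \<le> ennreal ((1/4) ^ k)"
    proof (rule ennreal_leI)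
      have "sum w (A k) + sum w (B - C k) = sum w (A k \<union> (B - C k))"
        using A B by (intro sum.union_disjoint[symmetric]) (auto simp: C_def)
      also have "\<dots> \<le> s" using A B w0 by (intro finite_sum_le_has_sum[OF hs]) auto
      finally show "sum w (B - C k) \<le> (1/4) ^ k" using A(2)[of k] by linarith
    qed
    finally show ?thesis .
  qed
  obtain g where g: "g \<in> borel_measurable gauss" "\<And>n. (\<integral>\<^sup>+x. ennreal ((cmod (S (C n) x - g x))\<^sup>2) \<partial>gauss) \<le> ennreal ((1/4) ^ n)"
    by (rule L2_fast_Cauchy_limit[of "\<lambda>n. S (C n)" gauss]) (use near[OF C Cmono] in auto)
  have gm [measurable]: "g \<in> borel_measurable borel" using g(1) by simp
  have "(\<lambda>x. S (C 0) x - g x) \<in> L2 gauss"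
    using g(2)[of 0] by (subst L2_iff_nn_integral) (auto intro: order_le_less_trans)
  then have "(\<lambda>x. S (C 0) x - (S (C 0) x - g x)) \<in> L2 gauss" by (rule L2_diff[OF SL[OF C]])
  moreover have "(\<lambda>x. S (C 0) x - (S (C 0) x - g x)) = g" by (rule ext) simp
  ultimately have gL: "g \<in> L2 gauss" by (simp only:)
  have "L2_tendsto gauss S g (finite_subsets_at_top UNIV)"
    unfolding L2_tendsto_def
  proof (rule order_tendstoI)
    fix e :: ennreal assume "0 < e"
    have "(\<lambda>k. ennreal (4 * (1/4) ^ k)) \<longlonglongrightarrow> ennreal (4 * 0)"
      by (intro tendsto_ennrealI tendsto_intros LIMSEQ_power_zero) auto
    then have "eventually (\<lambda>k. ennreal (4 * (1/4) ^ k) < e) sequentially"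
      using \<open>0 < e\<close> by (intro order_tendstoD) auto
    then obtain k where k: "ennreal (4 * (1/4) ^ k) < e" by (auto simp: eventually_sequentially)
    have "(\<integral>\<^sup>+x. ennreal ((cmod (S B x - g x))\<^sup>2) \<partial>gauss) < e" if B: "finite B" "C k \<subseteq> B" for B
    proof -
      have "(\<integral>\<^sup>+x. ennreal ((cmod (S B x - g x))\<^sup>2) \<partial>gauss) = (\<integral>\<^sup>+x. ennreal ((cmod ((S B x - S (C k) x) + (S (C k) x - g x)))\<^sup>2) \<partial>gauss)"
        by simp
      also have "\<dots> \<le> 2 * (\<integral>\<^sup>+x. ennreal ((cmod (S B x - S (C k) x))\<^sup>2) \<partial>gauss) + 2 * (\<integral>\<^sup>+x. ennreal ((cmod (S (C k) x - g x))\<^sup>2) \<partial>gauss)"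
        by (rule nn_integral_norm_sq_add_le) measurable
      also have "\<dots> \<le> 2 * ennreal ((1/4) ^ k) + 2 * ennreal ((1/4) ^ k)"
        by (intro add_mono mult_left_mono near B g) auto
      also have "\<dots> = ennreal (2 * (1/4) ^ k + 2 * (1/4) ^ k)" by (subst ennreal_plus) (auto simp: ennreal_mult)
      also have "\<dots> = ennreal (4 * (1/4) ^ k)" by simp
      finally show ?thesis using k by simp
    qed
    then show "eventually (\<lambda>A. (\<integral>\<^sup>+x. ennreal ((cmod (S A x - g x))\<^sup>2) \<partial>gauss) < e) (finite_subsets_at_top UNIV)"
      unfolding eventually_finite_subsets_at_top using C[of k] by blast
  qed auto
  then show ?thesis using gL that unfolding S_def by blast
qed

text \<open>For a multiplier of modulus at most \<open>1\<close> the defining series converges by Bessel's inequality, so the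
  choice in the definition of \<open>ou_calculus\<close> is not vacuous.\<close>

lemma
  fixes f :: "real^'n \<Rightarrow> complex"
  assumes f: "f \<in> L2 gauss" and m: "\<And>s. cmod (m s) \<le> 1"
  shows ou_calculus_L2: "ou_calculus m f \<in> L2 gauss"
    and ou_calculus_lim: "L2_tendsto gauss
       (\<lambda>A x. \<Sum>\<alpha>\<in>A. m (ou_eigenvalue \<alpha>) * hermite_coeff f \<alpha> * hermite \<alpha> x) (ou_calculus m f)
       (finite_subsets_at_top UNIV)" (is ?lim)
    and ou_calculus_coeff: "(LINT x|gauss. ou_calculus m f x * hermite \<beta> x) = m (ou_eigenvalue \<beta>) * (LINT x|gauss. f x * hermite \<beta> x)"
proof -
  define a where "a \<alpha> = m (ou_eigenvalue \<alpha>) * hermite_coeff f \<alpha>" for \<alpha>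
  have le: "(cmod (a \<alpha>))\<^sup>2 * hermite_norm_sq \<alpha> \<le> (cmod (hermite_coeff f \<alpha>))\<^sup>2 * hermite_norm_sq \<alpha>" for \<alpha>
    using hermite_norm_sq_pos[of \<alpha>] mult_right_mono[OF m norm_ge_zero, of "ou_eigenvalue \<alpha>" "hermite_coeff f \<alpha>"]
    by (intro mult_right_mono power_mono) (auto simp: a_def norm_mult)
  have "(\<lambda>\<alpha>. (cmod (a \<alpha>))\<^sup>2 * hermite_norm_sq \<alpha>) summable_on UNIV"
  proof (rule nonneg_bdd_above_summable_on)
    show "(cmod (a \<alpha>))\<^sup>2 * hermite_norm_sq \<alpha> \<ge> 0" for \<alpha> using hermite_norm_sq_pos[of \<alpha>] by simp
    show "bdd_above (sum (\<lambda>\<alpha>. (cmod (a \<alpha>))\<^sup>2 * hermite_norm_sq \<alpha>) ` {F. F \<subseteq> UNIV \<and> finite F})"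
      by (intro bdd_aboveI[of _ "LINT x|gauss. (cmod (f x))\<^sup>2"]) (auto intro: order_trans[OF sum_mono[OF le] hermite_Bessel_inequality[OF f]])
  qed
  then obtain g where g: "g \<in> L2 gauss" "L2_tendsto gauss (\<lambda>A x. \<Sum>\<alpha>\<in>A. a \<alpha> * hermite \<alpha> x) g (finite_subsets_at_top UNIV)"
    using hermite_series by blast
  have "\<exists>g. g \<in> L2 gauss \<and> L2_tendsto gauss
      (\<lambda>A x. \<Sum>\<alpha>\<in>A. m (ou_eigenvalue \<alpha>) * hermite_coeff f \<alpha> * hermite \<alpha> x) g (finite_subsets_at_top UNIV)"
    by (intro exI conjI) (rule g(1), rule g(2)[unfolded a_def])
  from someI_ex[OF this] have *: "ou_calculus m f \<in> L2 gauss \<and> ?lim"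
    unfolding ou_calculus_def .
  then show L: "ou_calculus m f \<in> L2 gauss" and lim: ?lim by auto
  define u where "u A x = (\<Sum>\<alpha>\<in>(if finite A then A else {}). a \<alpha> * hermite \<alpha> x)" for A x
  have um: "u A \<in> borel_measurable gauss" for A unfolding u_def[abs_def] by measurable
  have "L2_tendsto gauss u (ou_calculus m f) (finite_subsets_at_top UNIV)"
    using lim unfolding L2_tendsto_def
    by (rule Lim_transform_eventually) (auto simp: u_def a_def)
  then have "((\<lambda>A. LINT x|gauss. u A x * hermite \<beta> x) \<longlongrightarrow> (LINT x|gauss. ou_calculus m f x * hermite \<beta> x)) (finite_subsets_at_top UNIV)"
    by (intro L2_tendsto_inner um L hermite_L2)
  \<comment> \<open>As soon as \<open>\<beta>\<close> belongs to the index set, orthogonality makes the integral constant.\<close>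
  moreover have "eventually (\<lambda>A. (LINT x|gauss. u A x * hermite \<beta> x) = a \<beta> * of_real (hermite_norm_sq \<beta>)) (finite_subsets_at_top UNIV)"
    unfolding eventually_finite_subsets_at_top
    by (intro exI[of _ "{\<beta>}"]) (auto simp: u_def hermite_sum_coeff)
  then have "((\<lambda>A. LINT x|gauss. u A x * hermite \<beta> x) \<longlongrightarrow> a \<beta> * of_real (hermite_norm_sq \<beta>)) (finite_subsets_at_top UNIV)"
    by (rule tendsto_eventually)
  ultimately have "(LINT x|gauss. ou_calculus m f x * hermite \<beta> x) = a \<beta> * of_real (hermite_norm_sq \<beta>)"
    using tendsto_unique[OF finite_subsets_at_top_neq_bot] by blast
  then show "(LINT x|gauss. ou_calculus m f x * hermite \<beta> x) = m (ou_eigenvalue \<beta>) * (LINT x|gauss. f x * hermite \<beta> x)"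
    by (simp add: hermite_coeff_mult_norm_sq a_def)
qed

text \<open>The form in which completeness is used: every formula for the group is proved by comparing
  Hermite integrals.\<close>

lemma AE_eq_if_same_hermite_integrals:
  assumes f: "exp_moments f" and g: "exp_moments g"
    and c: "\<And>\<alpha>. (LINT x|gauss. f x * hermite \<alpha> x) = (LINT x|gauss. g x * hermite \<alpha> x)"
  shows "AE x in gauss. f x = g x"
proof -
  have i: "integrable gauss (\<lambda>x. h x * hermite \<alpha> x)" if "exp_moments h" for h \<alpha>
  proof -
    obtain C c where C: "C \<ge> 0" "\<And>x. norm (hermite \<alpha> x) \<le> C * exp (c * norm x)" using hermite_exp_bound by blast
    show ?thesis by (rule exp_moments_integrable[OF that hermite_borel C(2)])
  qed
  have "AE x in gauss. f x - g x = 0"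
    using c by (intro hermite_complete exp_moments_diff f g) (simp add: left_diff_distrib Bochner_Integration.integral_diff[OF i[OF f] i[OF g]])
  then show ?thesis by simp
qed

section \<open>Dilations and reflections\<close>

lemma lborel_scale:
  "c \<noteq> 0 \<Longrightarrow> (lborel :: (real^'n) measure) = density (distr lborel borel (\<lambda>x. c *\<^sub>R x)) (\<lambda>_. ennreal (\<bar>c\<bar> ^ CARD('n)))"
  by (rule lborel_affine[of c "0 :: real^'n", unfolded add_0_left DIM_cart DIM_real mult_1_right])

lemma nn_integral_lborel_scale:
  fixes f :: "real^'n \<Rightarrow> ennreal"
  assumes c: "c \<noteq> 0" and [measurable]: "f \<in> borel_measurable borel"
  shows "(\<integral>\<^sup>+x. f x \<partial>lborel) = ennreal (\<bar>c\<bar> ^ CARD('n)) * (\<integral>\<^sup>+x. f (c *\<^sub>R x) \<partial>lborel)"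
  by (subst lborel_scale[OF c]) (simp add: nn_integral_density nn_integral_distr nn_integral_cmult)

lemma integral_lborel_scale:
  fixes f :: "real^'n \<Rightarrow> complex"
  assumes c: "c \<noteq> 0" and [measurable]: "f \<in> borel_measurable borel"
  shows "(LINT x|lborel. f x) = of_real (\<bar>c\<bar> ^ CARD('n)) * (LINT x|lborel. f (c *\<^sub>R x))"
  by (subst lborel_scale[OF c]) (simp add: integral_density integral_distr scaleR_conv_of_real)

lemma integrable_lborel_scale:
  fixes f :: "real^'n \<Rightarrow> 'b::{banach, second_countable_topology}"
  assumes c: "c \<noteq> 0" and f: "integrable lborel f"
  shows "integrable lborel (\<lambda>x. f (c *\<^sub>R x))"
proof -
  have [measurable]: "f \<in> borel_measurable borel" using f by auto
  have "(\<integral>\<^sup>+x. norm (f x) \<partial>lborel) < \<infinity>" using f by (simp add: integrable_iff_bounded)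
  then have "(\<integral>\<^sup>+x. norm (f (c *\<^sub>R x)) \<partial>lborel) < \<infinity>"
    using c by (subst (asm) nn_integral_lborel_scale[OF c]) (auto simp: ennreal_mult_less_top)
  then show ?thesis by (simp add: integrable_iff_bounded)
qed

lemma L2_gauss_measurable: "f \<in> L2 gauss \<Longrightarrow> f \<in> borel_measurable borel"
  by (auto simp: L2_def)

lemma exp_moments_sign:
  fixes g :: "real^'n \<Rightarrow> complex"
  assumes g: "exp_moments g" and \<sigma>: "\<bar>\<sigma>\<bar> = 1"
  shows "exp_moments (\<lambda>x. g (\<sigma> *\<^sub>R x))"
  unfolding exp_moments_def
proof safe
  have [measurable]: "g \<in> borel_measurable borel" using g by (rule exp_moments_measurable)
  show "(\<lambda>x. g (\<sigma> *\<^sub>R x)) \<in> borel_measurable borel" by measurable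
  fix c
  have "integrable gauss (\<lambda>x. exp (c * norm x) * cmod (g x))" using g by (simp add: exp_moments_def)
  then have "integrable lborel (\<lambda>x. exp (- (norm x)\<^sup>2 / 2) *\<^sub>R (exp (c * norm x) * cmod (g x)))"
    by (subst (asm) integrable_gauss) measurable
  from integrable_lborel_scale[OF _ this, of \<sigma>]
  have "integrable lborel (\<lambda>x. exp (- (norm x)\<^sup>2 / 2) *\<^sub>R (exp (c * norm x) * cmod (g (\<sigma> *\<^sub>R x))))"
    using \<sigma> by auto
  then show "integrable gauss (\<lambda>x. exp (c * norm x) * cmod (g (\<sigma> *\<^sub>R x)))"
    by (subst integrable_gauss) measurable
qed

lemma hermite_sign:
  assumes "\<bar>\<sigma>\<bar> = 1"
  shows "hermite \<alpha> (\<sigma> *\<^sub>R x) = of_real \<sigma> ^ (\<Sum>i\<in>UNIV. \<alpha> $ i) * hermite \<alpha> x"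
proof -
  have "\<sigma> = 1 \<or> \<sigma> = -1" using assms by auto
  then show ?thesis using hermite_minus[of \<alpha> x] by auto
qed

text \<open>Substitute \<open>\<sigma> x\<close> for \<open>x\<close>, which preserves \<open>\<gamma>\<close>, and use the parity of the Hermite polynomial.\<close>

lemma integral_hermite_sign:
  fixes g :: "real^'n \<Rightarrow> complex"
  assumes [measurable]: "g \<in> borel_measurable borel" and \<sigma>: "\<bar>\<sigma>\<bar> = 1"
  shows "(LINT x|gauss. g (\<sigma> *\<^sub>R x) * hermite \<alpha> x) = of_real \<sigma> ^ (\<Sum>i\<in>UNIV. \<alpha> $ i) * (LINT x|gauss. g x * hermite \<alpha> x)"
proof -
  have s: "\<sigma> \<noteq> 0" using \<sigma> by auto
  have ss: "\<sigma> * \<sigma> = 1" using \<sigma> by (metis abs_mult_self_eq mult_1)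
  let ?N = "\<Sum>i\<in>UNIV. \<alpha> $ i"
  have "(LINT x|gauss. g x * hermite \<alpha> x) = (LINT x|lborel. of_real (gauss_dens x) * (g x * hermite \<alpha> x))"
    by (rule integral_gauss) measurable
  also have "\<dots> = (LINT x|lborel. of_real (gauss_dens (\<sigma> *\<^sub>R x)) * (g (\<sigma> *\<^sub>R x) * hermite \<alpha> (\<sigma> *\<^sub>R x)))"
    by (subst integral_lborel_scale[OF s]) (use \<sigma> in simp_all)
  also have "\<dots> = (LINT x|lborel. of_real \<sigma> ^ ?N * (of_real (gauss_dens x) * (g (\<sigma> *\<^sub>R x) * hermite \<alpha> x)))"
    using \<sigma> by (simp add: hermite_sign mult_ac)
  also have "\<dots> = of_real \<sigma> ^ ?N * (LINT x|gauss. g (\<sigma> *\<^sub>R x) * hermite \<alpha> x)"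
    by (subst integral_gauss) simp_all
  finally have "of_real \<sigma> ^ ?N * (LINT x|gauss. g x * hermite \<alpha> x) = (of_real \<sigma> * of_real \<sigma>) ^ ?N * (LINT x|gauss. g (\<sigma> *\<^sub>R x) * hermite \<alpha> x)"
    by (simp add: power_mult_distrib mult.assoc)
  also have "of_real \<sigma> * of_real \<sigma> = (1::complex)" using ss by (metis of_real_1 of_real_mult)
  finally show ?thesis by simp
qed

section \<open>The group at multiples of a half turn\<close>

abbreviation (input) parity_sign :: "int \<Rightarrow> real" where "parity_sign k \<equiv> (-1) powi k"

lemma abs_parity_sign: "\<bar>parity_sign k\<bar> = 1"
  by (simp add: power_int_minus_left)

lemma exp_phase_pi:
  "exp (\<i> * of_real (of_int k * pi) * of_real (- real N)) = of_real (parity_sign k) ^ N"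
proof -
  have "exp (\<i> * of_real (of_int k * pi) * of_real (- real N)) = exp (- (\<i> * of_real (pi * of_int k))) ^ N"
    unfolding exp_of_nat_mult[symmetric] by (simp add: mult_ac)
  also have "exp (- (\<i> * of_real (pi * of_int k))) = cis (- (pi * of_int k))" by (simp add: cis_conv_exp)
  also have "\<dots> = of_real (parity_sign k)"
    by (simp add: complex_eq_iff power_int_minus_left del: of_real_power_int)
  finally show ?thesis .
qed

lemma exp_phase_half:
  "exp (\<i> * of_real (pi / 2 + of_int k * pi) * of_real (- real N)) = (- \<i>) ^ N * of_real (parity_sign k) ^ N"
proof -
  have "exp (\<i> * of_real (pi / 2 + of_int k * pi) * of_real (- real N)) =
      exp (\<i> * of_real (pi / 2) * of_real (- real N)) * exp (\<i> * of_real (of_int k * pi) * of_real (- real N))"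
    unfolding exp_add[symmetric] by (simp add: algebra_simps)
  also have "exp (\<i> * of_real (pi / 2) * of_real (- real N)) = exp (- (\<i> * of_real (pi / 2))) ^ N"
    unfolding exp_of_nat_mult[symmetric] by (simp add: mult_ac)
  also have "exp (- (\<i> * of_real (pi / 2))) = cis (- (pi / 2))" by (simp add: cis_conv_exp)
  also have "\<dots> = - \<i>" by (simp add: complex_eq_iff)
  finally show ?thesis unfolding exp_phase_pi .
qed

lemma ou_group_AE_eqI:
  fixes f :: "real^'n \<Rightarrow> complex"
  assumes f: "f \<in> L2 gauss" and g: "exp_moments g"
    and c: "\<And>\<alpha>. (LINT x|gauss. g x * hermite \<alpha> x) =
      exp (\<i> * of_real t * of_real (- real (\<Sum>i\<in>UNIV. \<alpha> $ i))) * (LINT x|gauss. f x * hermite \<alpha> x)"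
  shows "AE x in gauss. ou_group t f x = g x"
proof (rule AE_eq_if_same_hermite_integrals)
  have m: "cmod (exp (\<i> * of_real t * of_real s)) \<le> 1" for s by simp
  show "exp_moments (ou_group t f)" unfolding ou_group_def by (intro L2_imp_exp_moments ou_calculus_L2 f m)
  show "(LINT x|gauss. ou_group t f x * hermite \<alpha> x) = (LINT x|gauss. g x * hermite \<alpha> x)" for \<alpha>
    unfolding c unfolding ou_group_def by (subst ou_calculus_coeff[OF f m]) (simp only: ou_eigenvalue_eq)
qed (rule g)

text \<open>The phase \<open>e\<^bsup>-ik\<pi>|\<alpha>|\<^esup>\<close> is the sign that \<open>H\<^sub>\<alpha>\<close> acquires under \<open>x \<mapsto> (-1)\<^sup>k x\<close>.\<close>

lemma ou_group_pi:
  fixes f :: "real^'n \<Rightarrow> complex"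
  assumes f: "f \<in> L2 gauss"
  shows "AE x in gauss. ou_group (of_int k * pi) f x = f (parity_sign k *\<^sub>R x)"
proof (rule ou_group_AE_eqI[OF f])
  show "exp_moments (\<lambda>x. f (parity_sign k *\<^sub>R x))" by (intro exp_moments_sign L2_imp_exp_moments f abs_parity_sign)
  have "f \<in> borel_measurable borel" using f by (rule L2_gauss_measurable)
  then show "(LINT x|gauss. f (parity_sign k *\<^sub>R x) * hermite \<alpha> x) = exp (\<i> * of_real (of_int k * pi) * of_real (- real (\<Sum>i\<in>UNIV. \<alpha> $ i))) * (LINT x|gauss. f x * hermite \<alpha> x)" for \<alpha>
    unfolding exp_phase_pi by (rule integral_hermite_sign[OF _ abs_parity_sign])
qed

section \<open>The Fourier transform of integrable functions\<close>

text \<open>Multiplication by this square root of the Gaussian density (up to a constant) identifies \<open>L\<^sup>2(\<gamma>)\<close> with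
  \<open>L\<^sup>2\<close> for Lebesgue measure.\<close>

abbreviation (input) wt :: "real^'n \<Rightarrow> complex" where
  "wt x \<equiv> of_real (exp (- (norm x)\<^sup>2 / 4))"

lemma fourier_dilated:
  "fourier u ((c / (4 * pi)) *\<^sub>R x) = (LINT y|lborel. cis (- (c * (x \<bullet> y)) / 2) * u y)"
proof -
  have "exp (- 2 * of_real pi * \<i> * of_real ((c / (4 * pi)) *\<^sub>R x \<bullet> y)) = cis (- (c * (x \<bullet> y)) / 2)" for y
    by (simp add: cis_conv_exp field_simps)
  then show ?thesis unfolding fourier_def by presburger
qed

lemma integrable_wt_hermite: "integrable lborel (\<lambda>x. wt x * hermite \<alpha> x)"
proof -
  obtain C c where C: "C \<ge> 0" "\<And>x. norm (hermite \<alpha> x) \<le> C * exp (c * norm x)" using hermite_exp_bound by blast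
  show ?thesis
  proof (rule Bochner_Integration.integrable_bound)
    show "integrable lborel (\<lambda>x::real^'a. C * exp (c * norm x - (1/4) * (norm x)\<^sup>2))"
      by (intro integrable_mult_right integrable_exp_gaussian_vec) simp
    show "(\<lambda>x. wt x * hermite \<alpha> x) \<in> borel_measurable lborel" by measurable
    have "norm (wt x * hermite \<alpha> x) \<le> C * exp (c * norm x - (1/4) * (norm x)\<^sup>2)" for x
    proof -
      have "exp (c * norm x - (1/4) * (norm x)\<^sup>2) = exp (- (norm x)\<^sup>2 / 4) * exp (c * norm x)"
        by (simp add: exp_add[symmetric])
      then show ?thesis
        using mult_left_mono[OF C(2)[of x], of "exp (- (norm x)\<^sup>2 / 4)"]
        by (simp only: norm_mult norm_of_real abs_exp_cancel mult_ac exp_ge_zero)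
    qed
    then show "AE x in lborel. norm (wt x * hermite \<alpha> x) \<le> norm (C * exp (c * norm x - (1/4) * (norm x)\<^sup>2))"
      unfolding real_norm_def by (intro AE_I2 order_trans[OF _ abs_ge_self])
  qed
qed

text \<open>The multiplication formula \<open>\<integral> \<F>u h = \<integral> u \<F>h\<close> (Fubini), combined with the eigenfunction property of the weighted
  Hermite polynomials.\<close>

lemma fourier_multiplication:
  fixes u :: "real^'n \<Rightarrow> complex"
  assumes u: "integrable lborel u"
  shows "(LINT x|lborel. fourier u ((1 / (4 * pi)) *\<^sub>R x) * (wt x * hermite \<alpha> x)) =
    of_real ((4 * pi) powr (real CARD('n) / 2)) * (- \<i>) ^ (\<Sum>i\<in>UNIV. \<alpha> $ i) * (LINT y|lborel. u y * (wt y * hermite \<alpha> y))"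
proof -
  have um [measurable]: "u \<in> borel_measurable borel" using u by auto
  have cm [measurable]: "(\<lambda>p::(real^'n) \<times> (real^'n). cis (- (fst p \<bullet> snd p) / 2)) \<in> borel_measurable borel"
    by (intro borel_measurable_continuous_onI continuous_intros) auto
  let ?h = "\<lambda>x. wt x * hermite \<alpha> x"
  let ?F = "\<lambda>x y. cis (- (x \<bullet> y) / 2) * (u y * ?h x)"
  have cm' [measurable]: "(\<lambda>p::(real^'n) \<times> (real^'n). cis (- (fst p \<bullet> snd p) / 2)) \<in> borel_measurable (lborel \<Otimes>\<^sub>M lborel)"
    using cm by (simp add: lborel_prod)
  have int: "integrable (lborel \<Otimes>\<^sub>M lborel) (\<lambda>p. ?F (fst p) (snd p))"
  proof (rule lborel_pair.Fubini_integrable)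
    show "(\<lambda>p. ?F (fst p) (snd p)) \<in> borel_measurable (lborel \<Otimes>\<^sub>M lborel)" by measurable
    have "integrable lborel (\<lambda>x. norm (?h x) * (LINT y|lborel. norm (u y)))"
      by (intro integrable_mult_left integrable_norm integrable_wt_hermite)
    then show "integrable lborel (\<lambda>x. LINT y|lborel. norm (?F (fst (x, y)) (snd (x, y))))"
      by (simp add: norm_mult mult_ac)
    show "AE x in lborel. integrable lborel (\<lambda>y. ?F (fst (x, y)) (snd (x, y)))"
    proof (rule AE_I2)
      fix x
      show "integrable lborel (\<lambda>y. ?F (fst (x, y)) (snd (x, y)))"
      proof (rule Bochner_Integration.integrable_bound)
        show "integrable lborel (\<lambda>y. u y * ?h x)" by (intro integrable_mult_left u)
        have [measurable]: "(\<lambda>y. cis (- (x \<bullet> y) / 2)) \<in> borel_measurable borel"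
          by (intro borel_measurable_continuous_onI continuous_intros) auto
        show "(\<lambda>y. ?F (fst (x, y)) (snd (x, y))) \<in> borel_measurable lborel" unfolding fst_conv snd_conv by measurable
        show "AE y in lborel. norm (?F (fst (x, y)) (snd (x, y))) \<le> norm (u y * ?h x)" by (simp add: norm_mult)
      qed
    qed
  qed
  have "(LINT x|lborel. fourier u ((1 / (4 * pi)) *\<^sub>R x) * ?h x) = (LINT x|lborel. LINT y|lborel. ?F x y)"
    unfolding fourier_dilated by (subst integral_mult_left_zero[symmetric]) (simp add: mult_ac)
  also have "\<dots> = (LINT y|lborel. LINT x|lborel. ?F x y)"
    using int by (intro lborel_pair.Fubini_integral[symmetric]) (simp add: split_beta')
  also have "\<dots> = (LINT y|lborel. u y * fourier ?h ((1 / (4 * pi)) *\<^sub>R y))"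
    unfolding fourier_dilated by (subst integral_mult_right_zero[symmetric]) (simp add: mult_ac inner_commute)
  also have "\<dots> = (LINT y|lborel. of_real ((4 * pi) powr (real CARD('n) / 2)) * (- \<i>) ^ (\<Sum>i\<in>UNIV. \<alpha> $ i) * (u y * ?h y))"
    unfolding fourier_hermite by (simp add: mult_ac)
  finally show ?thesis by (simp only: integral_mult_right_zero)
qed

lemma measurable_fourier:
  fixes u :: "real^'n \<Rightarrow> complex"
  assumes [measurable]: "u \<in> borel_measurable borel"
  shows "fourier u \<in> borel_measurable borel"
proof -
  have cm: "(\<lambda>p::(real^'n) \<times> (real^'n). exp (- 2 * of_real pi * \<i> * of_real (fst p \<bullet> snd p))) \<in> borel_measurable borel"
    by (intro borel_measurable_continuous_onI continuous_intros)
  then have [measurable]: "(\<lambda>p::(real^'n) \<times> (real^'n). exp (- 2 * of_real pi * \<i> * of_real (fst p \<bullet> snd p))) \<in> borel_measurable (borel \<Otimes>\<^sub>M borel)"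
    by (simp add: borel_prod)
  show ?thesis unfolding fourier_def[abs_def]
  proof (rule sigma_finite_measure.borel_measurable_lebesgue_integral)
    show "sigma_finite_measure (lborel :: (real^'n) measure)" by (rule lborel.sigma_finite_measure_axioms)
    have "(\<lambda>p. exp (- 2 * of_real pi * \<i> * of_real (fst p \<bullet> snd p)) * u (snd p)) \<in> borel_measurable (borel \<Otimes>\<^sub>M lborel)"
      by measurable
    then show "(\<lambda>(x, y). exp (- 2 * of_real pi * \<i> * of_real (x \<bullet> y)) * u y) \<in> borel_measurable (borel \<Otimes>\<^sub>M lborel)"
      by (simp add: split_beta')
  qed
qed

lemma norm_fourier_le: "cmod (fourier u \<xi>) \<le> (LINT x|lborel. cmod (u x))"
proof -
  have "cmod (fourier u \<xi>) \<le> (LINT x|lborel. norm (exp (- 2 * of_real pi * \<i> * of_real (\<xi> \<bullet> x)) * u x))"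
    unfolding fourier_def by (rule integral_norm_bound)
  then show ?thesis by (simp add: norm_mult)
qed

text \<open>The function on \<open>(\<real>\<^sup>d, \<gamma>)\<close> that the theorem assigns to a Fourier transform \<open>g\<close> when \<open>k = 0\<close>: the weight and the
  constants are moved to one side of the identity.\<close>

definition unweight :: "(real^'n \<Rightarrow> complex) \<Rightarrow> real^'n \<Rightarrow> complex" where
  "unweight g x = of_real ((4 * pi) powr (- real CARD('n) / 2) * exp ((norm x)\<^sup>2 / 4)) * g ((1 / (4 * pi)) *\<^sub>R x)"

lemma measurable_unweight [measurable]:
  fixes g :: "real^'n \<Rightarrow> complex"
  assumes [measurable]: "g \<in> borel_measurable borel"
  shows "unweight g \<in> borel_measurable borel"
proof -
  have "(\<lambda>x. of_real ((4 * pi) powr (- real CARD('n) / 2) * exp ((norm x)\<^sup>2 / 4)) * g ((1 / (4 * pi)) *\<^sub>R x)) \<in> borel_measurable borel"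
    by measurable
  then show ?thesis unfolding unweight_def[abs_def] .
qed

lemma exp_half_norm_sq_split: "exp (- (norm (x::real^'n))\<^sup>2 / 2) = exp (- (norm x)\<^sup>2 / 4) * exp (- (norm x)\<^sup>2 / 4)"
  by (simp add: exp_add[symmetric])

lemma wt_unweight:
  fixes x :: "real^'n"
  assumes "\<bar>\<sigma>\<bar> = 1"
  shows "wt x * unweight g (\<sigma> *\<^sub>R x) =
    of_real ((4 * pi) powr (- real CARD('n) / 2)) * g ((\<sigma> / (4 * pi)) *\<^sub>R x)"
proof -
  have n: "norm (\<sigma> *\<^sub>R x) = norm x" using assms by simp
  have e: "exp (- (norm x)\<^sup>2 / 4) * exp ((norm x)\<^sup>2 / 4) = 1"
    by (simp add: exp_add[symmetric])
  have "wt x * unweight g (\<sigma> *\<^sub>R x) = of_real ((4 * pi) powr (- real CARD('n) / 2)) *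
      (of_real (exp (- (norm x)\<^sup>2 / 4) * exp ((norm x)\<^sup>2 / 4)) * g ((1 / (4 * pi)) *\<^sub>R \<sigma> *\<^sub>R x))"
    unfolding unweight_def n of_real_mult by (simp only: mult_ac)
  then show ?thesis unfolding e by simp
qed

lemma gauss_dens_unweight:
  fixes x :: "real^'n"
  shows "of_real (gauss_dens x) * unweight g x = of_real ((2 * pi) powr (- real CARD('n) / 2)) *
    of_real ((4 * pi) powr (- real CARD('n) / 2)) * (wt x * g ((1 / (4 * pi)) *\<^sub>R x))"
proof -
  have e: "exp (- (norm x)\<^sup>2 / 2) * exp ((norm x)\<^sup>2 / 4) = exp (- (norm x)\<^sup>2 / 4)"
    by (simp add: exp_add[symmetric])
  have "of_real (gauss_dens x) * unweight g x = of_real ((2 * pi) powr (- real CARD('n) / 2)) *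
    of_real ((4 * pi) powr (- real CARD('n) / 2)) * (of_real (exp (- (norm x)\<^sup>2 / 2) * exp ((norm x)\<^sup>2 / 4)) * g ((1 / (4 * pi)) *\<^sub>R x))"
    unfolding unweight_def of_real_mult by (simp only: mult_ac)
  then show ?thesis unfolding e .
qed

text \<open>The hypothesis on \<open>g\<close> holds for the Fourier transform of \<open>wt f\<close>, in \<open>L\<^sup>1\<close> by \<open>fourier_multiplication\<close> and in \<open>L\<^sup>2\<close> by
  passing to the limit. Isolating it lets both cases share one proof.\<close>

lemma integral_unweight_hermite:
  fixes g :: "real^'n \<Rightarrow> complex"
  assumes [measurable]: "g \<in> borel_measurable borel"
    and c: "(LINT x|lborel. g ((1 / (4 * pi)) *\<^sub>R x) * (wt x * hermite \<alpha> x)) =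
      of_real ((4 * pi) powr (real CARD('n) / 2)) * (- \<i>) ^ (\<Sum>i\<in>UNIV. \<alpha> $ i) * (LINT y|lborel. wt y * f y * (wt y * hermite \<alpha> y))"
    and [measurable]: "f \<in> borel_measurable borel"
  shows "(LINT x|gauss. unweight g x * hermite \<alpha> x) = (- \<i>) ^ (\<Sum>i\<in>UNIV. \<alpha> $ i) * (LINT x|gauss. f x * hermite \<alpha> x)"
proof -
  let ?a = "complex_of_real ((2 * pi) powr (- real CARD('n) / 2))" and ?b = "complex_of_real ((4 * pi) powr (- real CARD('n) / 2))"
  have "(LINT x|gauss. unweight g x * hermite \<alpha> x) = (LINT x|lborel. of_real (gauss_dens x) * (unweight g x * hermite \<alpha> x))"
    by (rule integral_gauss) measurable
  also have "\<dots> = (LINT x|lborel. (?a * ?b) * (g ((1 / (4 * pi)) *\<^sub>R x) * (wt x * hermite \<alpha> x)))"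
    unfolding mult.assoc[symmetric] gauss_dens_unweight by (simp only: mult_ac)
  also have "\<dots> = (?a * ?b) * (of_real ((4 * pi) powr (real CARD('n) / 2)) * (- \<i>) ^ (\<Sum>i\<in>UNIV. \<alpha> $ i) * (LINT y|lborel. wt y * f y * (wt y * hermite \<alpha> y)))"
    unfolding integral_mult_right_zero c ..
  also have "\<dots> = (?b * of_real ((4 * pi) powr (real CARD('n) / 2))) * (- \<i>) ^ (\<Sum>i\<in>UNIV. \<alpha> $ i) * (LINT y|lborel. ?a * (wt y * f y * (wt y * hermite \<alpha> y)))"
    unfolding integral_mult_right_zero by (simp only: mult_ac)
  also have "?b * of_real ((4 * pi) powr (real CARD('n) / 2)) = 1"
    by (simp add: powr_minus flip: of_real_mult)
  also have "(LINT y|lborel. ?a * (wt y * f y * (wt y * hermite \<alpha> y))) = (LINT x|lborel. of_real (gauss_dens x) * (f x * hermite \<alpha> x))"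
    unfolding exp_half_norm_sq_split of_real_mult by (simp only: mult_ac)
  also have "\<dots> = (LINT x|gauss. f x * hermite \<alpha> x)"
    by (rule integral_gauss[symmetric]) measurable
  finally show ?thesis by simp
qed

lemma ou_group_half_AE_eqI:
  fixes f g :: "real^'n \<Rightarrow> complex"
  assumes f: "f \<in> L2 gauss" and g [measurable]: "g \<in> borel_measurable borel" and s: "exp_moments (unweight g)"
    and c: "\<And>\<alpha>. (LINT x|lborel. g ((1 / (4 * pi)) *\<^sub>R x) * (wt x * hermite \<alpha> x)) =
      of_real ((4 * pi) powr (real CARD('n) / 2)) * (- \<i>) ^ (\<Sum>i\<in>UNIV. \<alpha> $ i) * (LINT y|lborel. wt y * f y * (wt y * hermite \<alpha> y))"
  shows "AE x in gauss. wt x * ou_group (pi / 2 + of_int k * pi) f x =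
     of_real ((4 * pi) powr (- real CARD('n) / 2)) * g ((parity_sign k / (4 * pi)) *\<^sub>R x)"
proof -
  have fm: "f \<in> borel_measurable borel" using f by (rule L2_gauss_measurable)
  have "AE x in gauss. ou_group (pi / 2 + of_int k * pi) f x = unweight g (parity_sign k *\<^sub>R x)"
  proof (rule ou_group_AE_eqI[OF f])
    show "exp_moments (\<lambda>x. unweight g (parity_sign k *\<^sub>R x))" by (rule exp_moments_sign[OF s abs_parity_sign])
    show "(LINT x|gauss. unweight g (parity_sign k *\<^sub>R x) * hermite \<alpha> x) =
      exp (\<i> * of_real (pi / 2 + of_int k * pi) * of_real (- real (\<Sum>i\<in>UNIV. \<alpha> $ i))) * (LINT x|gauss. f x * hermite \<alpha> x)" for \<alpha>
      unfolding exp_phase_half integral_hermite_sign[OF measurable_unweight[OF g] abs_parity_sign] integral_unweight_hermite[OF g c fm]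
      by (simp only: mult_ac)
  qed
  then show ?thesis
    by eventually_elim (simp only: wt_unweight[OF abs_parity_sign])
qed

text \<open>The Fourier transform is bounded, and after the weight \<open>e\<^bsup>|x|\<^sup>2/4\<^esup>\<close> a Gaussian \<open>e\<^bsup>-|x|\<^sup>2/4\<^esup>\<close> is left for integrability.\<close>

lemma exp_moments_unweight_fourier:
  fixes u :: "real^'n \<Rightarrow> complex"
  assumes u: "integrable lborel u"
  shows "exp_moments (unweight (fourier u))"
  unfolding exp_moments_def
proof safe
  have um: "u \<in> borel_measurable borel" using u by auto
  note [measurable] = measurable_fourier[OF um]
  show "unweight (fourier u) \<in> borel_measurable borel" by measurable
  fix c
  let ?K = "(4 * pi) powr (- real CARD('n) / 2) * (LINT x|lborel. cmod (u x))"
  show "integrable gauss (\<lambda>x. exp (c * norm x) * cmod (unweight (fourier u) x))"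
  proof (subst integrable_gauss)
    show "(\<lambda>x. exp (c * norm x) * cmod (unweight (fourier u) x)) \<in> borel_measurable borel" by measurable
    show "integrable lborel (\<lambda>x. exp (- (norm x)\<^sup>2 / 2) *\<^sub>R (exp (c * norm x) * cmod (unweight (fourier u) x)))"
    proof (rule Bochner_Integration.integrable_bound)
      show "integrable lborel (\<lambda>x::real^'n. ?K * exp (c * norm x - (1/4) * (norm x)\<^sup>2))"
        by (intro integrable_mult_right integrable_exp_gaussian_vec) simp
      show "(\<lambda>x. exp (- (norm x)\<^sup>2 / 2) *\<^sub>R (exp (c * norm x) * cmod (unweight (fourier u) x))) \<in> borel_measurable lborel" by measurable
      have "norm (exp (- (norm x)\<^sup>2 / 2) *\<^sub>R (exp (c * norm x) * cmod (unweight (fourier u) x))) \<le> ?K * exp (c * norm x - (1/4) * (norm x)\<^sup>2)" for x :: "real^'n"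
      proof -
        have "norm (exp (- (norm x)\<^sup>2 / 2) *\<^sub>R (exp (c * norm x) * cmod (unweight (fourier u) x))) =
          ((4 * pi) powr (- real CARD('n) / 2) * exp (c * norm x - (1/4) * (norm x)\<^sup>2)) * cmod (fourier u ((1 / (4 * pi)) *\<^sub>R x))"
        proof -
          have "exp (c * norm x - (1/4) * (norm x)\<^sup>2) = exp (- (norm x)\<^sup>2 / 2) * (exp (c * norm x) * exp ((norm x)\<^sup>2 / 4))"
            by (simp add: exp_add[symmetric])
          then show ?thesis by (simp add: unweight_def norm_mult mult_ac)
        qed
        also have "\<dots> \<le> ((4 * pi) powr (- real CARD('n) / 2) * exp (c * norm x - (1/4) * (norm x)\<^sup>2)) * (LINT x|lborel. cmod (u x))"
          by (intro mult_left_mono norm_fourier_le) auto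
        finally show ?thesis by (simp only: mult_ac)
      qed
      then show "AE x in lborel. norm (exp (- (norm x)\<^sup>2 / 2) *\<^sub>R (exp (c * norm x) * cmod (unweight (fourier u) x))) \<le> norm (?K * exp (c * norm x - (1/4) * (norm (x::real^'n))\<^sup>2))"
        unfolding real_norm_def by (intro AE_I2 order_trans[OF _ abs_ge_self])
    qed
  qed
qed

lemma ou_group_half_fourier:
  fixes f :: "real^'n \<Rightarrow> complex"
  assumes f: "f \<in> L2 gauss" and i: "integrable lborel (\<lambda>y. wt y * f y)"
  shows "AE x in gauss. wt x * ou_group (pi / 2 + of_int k * pi) f x =
     of_real ((4 * pi) powr (- real CARD('n) / 2)) * fourier (\<lambda>y. wt y * f y) ((parity_sign k / (4 * pi)) *\<^sub>R x)"
proof (rule ou_group_half_AE_eqI[OF f])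
  have "(\<lambda>y. wt y * f y) \<in> borel_measurable borel" using i by auto
  then show "fourier (\<lambda>y. wt y * f y) \<in> borel_measurable borel" by (rule measurable_fourier)
qed (rule exp_moments_unweight_fourier[OF i], rule fourier_multiplication[OF i])

section \<open>The Fourier transform on square-integrable functions\<close>

lemma nn_integral_wt:
  fixes f :: "real^'n \<Rightarrow> complex"
  assumes [measurable]: "f \<in> borel_measurable borel"
  shows "(\<integral>\<^sup>+x. ennreal ((cmod (wt x * f x))\<^sup>2) \<partial>lborel) =
    ennreal ((2 * pi) powr (real CARD('n) / 2)) * (\<integral>\<^sup>+x. ennreal ((cmod (f x))\<^sup>2) \<partial>gauss)"
proof -
  have "ennreal ((cmod (wt x * f x))\<^sup>2) = ennreal ((2 * pi) powr (real CARD('n) / 2)) * (ennreal (gauss_dens x) * ennreal ((cmod (f x))\<^sup>2))" for x :: "real^'n"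
  proof -
    have "(2 * pi) powr (real CARD('n) / 2) * (gauss_dens x * (cmod (f x))\<^sup>2) =
      ((2 * pi) powr (real CARD('n) / 2) * (2 * pi) powr (- real CARD('n) / 2)) * (exp (- (norm x)\<^sup>2 / 2) * (cmod (f x))\<^sup>2)"
      by (simp only: mult_ac)
    also have "(2 * pi) powr (real CARD('n) / 2) * (2 * pi) powr (- real CARD('n) / 2) = 1"
      by (simp add: powr_minus)
    also have "1 * (exp (- (norm x)\<^sup>2 / 2) * (cmod (f x))\<^sup>2) = (cmod (wt x * f x))\<^sup>2"
      unfolding exp_half_norm_sq_split by (simp add: norm_mult power_mult_distrib power2_eq_square)
    finally show ?thesis by (simp only: ennreal_mult[symmetric] mult_nonneg_nonneg powr_ge_zero exp_ge_zero zero_le_power2)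
  qed
  then show ?thesis
    unfolding gauss_def by (simp add: nn_integral_density nn_integral_cmult)
qed

lemma L2_wt_iff:
  fixes f :: "real^'n \<Rightarrow> complex"
  assumes [measurable]: "f \<in> borel_measurable borel"
  shows "(\<lambda>x. wt x * f x) \<in> L2 lborel \<longleftrightarrow> f \<in> L2 gauss"
proof -
  have a: "(\<lambda>x. wt x * f x) \<in> borel_measurable lborel" and b: "f \<in> borel_measurable gauss" by measurable
  show ?thesis
    unfolding L2_iff_nn_integral[OF a] L2_iff_nn_integral[OF b] nn_integral_wt[OF assms] by (auto simp: ennreal_mult_less_top)
qed

lemma L2_wt: "f \<in> L2 gauss \<Longrightarrow> (\<lambda>x. wt x * f x) \<in> L2 lborel"
  using L2_wt_iff[OF L2_gauss_measurable] by blast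

lemma L2_tendsto_wt:
  fixes u :: "'i \<Rightarrow> real^'n \<Rightarrow> complex"
  assumes [measurable]: "\<And>n. u n \<in> borel_measurable borel" "f \<in> borel_measurable borel"
    and lim: "L2_tendsto gauss u f F"
  shows "L2_tendsto lborel (\<lambda>n x. wt x * u n x) (\<lambda>x. wt x * f x) F"
proof -
  have "((\<lambda>n. ennreal ((2 * pi) powr (real CARD('n) / 2)) * (\<integral>\<^sup>+x. ennreal ((cmod (u n x - f x))\<^sup>2) \<partial>gauss)) \<longlongrightarrow>
    ennreal ((2 * pi) powr (real CARD('n) / 2)) * 0) F"
    using lim unfolding L2_tendsto_def by (intro ennreal_tendsto_cmult) auto
  then show ?thesis
    unfolding L2_tendsto_def right_diff_distrib[symmetric] by (subst nn_integral_wt) auto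
qed

lemma nn_integral_dilate:
  fixes f :: "real^'n \<Rightarrow> ennreal"
  assumes c: "c \<noteq> 0" and [measurable]: "f \<in> borel_measurable borel"
  shows "(\<integral>\<^sup>+x. f (c *\<^sub>R x) \<partial>lborel) = ennreal (\<bar>1 / c\<bar> ^ CARD('n)) * (\<integral>\<^sup>+x. f x \<partial>lborel)"
  using c by (subst nn_integral_lborel_scale[of "1 / c"]) auto

lemma L2_tendsto_dilate:
  fixes u :: "'i \<Rightarrow> real^'n \<Rightarrow> complex"
  assumes c: "c \<noteq> 0" and [measurable]: "\<And>n. u n \<in> borel_measurable borel" "f \<in> borel_measurable borel"
    and lim: "L2_tendsto lborel u f F"
  shows "L2_tendsto lborel (\<lambda>n x. a * u n (c *\<^sub>R x)) (\<lambda>x. a * f (c *\<^sub>R x)) F"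
proof -
  let ?K = "ennreal (\<bar>1 / c\<bar> ^ CARD('n))"
  have "((\<lambda>n. ennreal ((cmod a)\<^sup>2) * (?K * (\<integral>\<^sup>+x. ennreal ((cmod (u n x - f x))\<^sup>2) \<partial>lborel))) \<longlongrightarrow> ennreal ((cmod a)\<^sup>2) * (?K * 0)) F"
    using lim unfolding L2_tendsto_def by (intro ennreal_tendsto_cmult) auto
  moreover have "(\<integral>\<^sup>+x. ennreal ((cmod (a * u n (c *\<^sub>R x) - a * f (c *\<^sub>R x)))\<^sup>2) \<partial>lborel) =
     ennreal ((cmod a)\<^sup>2) * (?K * (\<integral>\<^sup>+x. ennreal ((cmod (u n x - f x))\<^sup>2) \<partial>lborel))" for n
    by (subst nn_integral_dilate[OF c, symmetric])
       (simp_all add: right_diff_distrib[symmetric] norm_mult power_mult_distrib ennreal_mult nn_integral_cmult)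
  ultimately show ?thesis unfolding L2_tendsto_def by simp
qed

lemma L2_lborel_dilate:
  fixes f :: "real^'n \<Rightarrow> complex"
  assumes c: "c \<noteq> 0" and f: "f \<in> L2 lborel"
  shows "(\<lambda>x. a * f (c *\<^sub>R x)) \<in> L2 lborel"
proof (rule L2_cmult)
  have [measurable]: "f \<in> borel_measurable borel" using f by (simp add: L2_def)
  have "(\<lambda>x. f (c *\<^sub>R x)) \<in> borel_measurable lborel" by measurable
  then show "(\<lambda>x. f (c *\<^sub>R x)) \<in> L2 lborel" 
    using f integrable_lborel_scale[OF c, of "\<lambda>x. (cmod (f x))\<^sup>2"] by (simp add: L2_def)
qed

lemma exp_moments_unweight_L2:
  fixes g :: "real^'n \<Rightarrow> complex"
  assumes g: "g \<in> L2 lborel"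
  shows "exp_moments (unweight g)"
proof (rule L2_imp_exp_moments)
  have [measurable]: "g \<in> borel_measurable borel" using g by (simp add: L2_def)
  have "(\<lambda>x. wt x * unweight g x) = (\<lambda>x. of_real ((4 * pi) powr (- real CARD('n) / 2)) * g ((1 / (4 * pi)) *\<^sub>R x))"
    using wt_unweight[of 1 _ g] by simp
  moreover have "(\<lambda>x. of_real ((4 * pi) powr (- real CARD('n) / 2)) * g ((1 / (4 * pi)) *\<^sub>R x)) \<in> L2 lborel"
    by (rule L2_lborel_dilate[OF _ g]) simp
  ultimately show "unweight g \<in> L2 gauss" by (subst L2_wt_iff[symmetric]) simp_all
qed

text \<open>The property by which \<open>fourier_L2\<close> selects its value.\<close>

definition is_fourier_L2 :: "(real^'n \<Rightarrow> complex) \<Rightarrow> (real^'n \<Rightarrow> complex) \<Rightarrow> bool" where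
  "is_fourier_L2 f g \<longleftrightarrow> g \<in> L2 lborel \<and>
     (\<exists>u::nat \<Rightarrow> real ^ 'n \<Rightarrow> complex. (\<forall>n. u n \<in> L2 lborel \<and> integrable lborel (u n)) \<and>
        L2_tendsto lborel u f sequentially \<and>
        L2_tendsto lborel (\<lambda>n. fourier (u n)) g sequentially)"

text \<open>Both limits in the definition of \<open>is_fourier_L2\<close> pass through the multiplication formula, so \<open>g\<close> has the same
  integrals against weighted Hermite polynomials as if it were a Fourier integral. This also shows that \<open>g\<close> is
  unique up to null sets.\<close>

lemma ou_group_half_is_fourier_L2:
  fixes f g :: "real^'n \<Rightarrow> complex"
  assumes f: "f \<in> L2 gauss" and g: "is_fourier_L2 (\<lambda>y. wt y * f y) g"
  shows "AE x in gauss. wt x * ou_group (pi / 2 + of_int k * pi) f x =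
     of_real ((4 * pi) powr (- real CARD('n) / 2)) * g ((parity_sign k / (4 * pi)) *\<^sub>R x)"
proof -
  obtain u where gL: "g \<in> L2 lborel" and u: "\<And>n. u n \<in> L2 lborel" "\<And>n. integrable lborel (u n)"
    and l1: "L2_tendsto lborel u (\<lambda>y. wt y * f y) sequentially" and l2: "L2_tendsto lborel (\<lambda>n. fourier (u n)) g sequentially"
    using g unfolding is_fourier_L2_def by blast
  have gm [measurable]: "g \<in> borel_measurable borel" using gL by (simp add: L2_def)
  have um [measurable]: "u n \<in> borel_measurable borel" for n using u(1)[of n] by (simp add: L2_def)
  have fm [measurable]: "f \<in> borel_measurable borel" using f by (rule L2_gauss_measurable)
  have FL: "(\<lambda>y. wt y * f y) \<in> L2 lborel" using f by (rule L2_wt)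
  have Fm [measurable]: "fourier (u n) \<in> borel_measurable borel" for n by (rule measurable_fourier[OF um])
  show ?thesis
  proof (rule ou_group_half_AE_eqI[OF f gm exp_moments_unweight_L2[OF gL]])
    fix \<alpha> :: "nat^'n"
    \<comment> \<open>The dilation by \<open>4 * pi\<close> is moved to the test function, so that the convergence of \<open>fourier (u n)\<close> applies directly.\<close>
    let ?h = "\<lambda>x. wt x * hermite \<alpha> x"
    have hL: "?h \<in> L2 lborel" by (rule L2_wt[OF hermite_L2])
    have hL': "(\<lambda>x. ?h ((4 * pi) *\<^sub>R x)) \<in> L2 lborel" using L2_lborel_dilate[OF _ hL, of "4 * pi" 1] unfolding mult_1_left by simp
    have sc: "(LINT x|lborel. v ((1 / (4 * pi)) *\<^sub>R x) * ?h x) = of_real (\<bar>4 * pi\<bar> ^ CARD('n)) * (LINT x|lborel. v x * ?h ((4 * pi) *\<^sub>R x))"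
      if [measurable]: "v \<in> borel_measurable borel" for v
      by (subst integral_lborel_scale[of "4 * pi"]) simp_all
    have "(\<lambda>n. LINT x|lborel. fourier (u n) x * ?h ((4 * pi) *\<^sub>R x)) \<longlonglongrightarrow> (LINT x|lborel. g x * ?h ((4 * pi) *\<^sub>R x))"
      by (rule L2_tendsto_inner[OF _ gL hL' l2]) simp
    then have A: "(\<lambda>n. LINT x|lborel. fourier (u n) ((1 / (4 * pi)) *\<^sub>R x) * ?h x) \<longlonglongrightarrow> (LINT x|lborel. g ((1 / (4 * pi)) *\<^sub>R x) * ?h x)"
      unfolding sc[OF Fm] sc[OF gm] by (rule tendsto_mult_left)
    have "(\<lambda>n. LINT x|lborel. u n x * ?h x) \<longlonglongrightarrow> (LINT x|lborel. wt x * f x * ?h x)"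
      by (rule L2_tendsto_inner[OF _ FL hL l1]) simp
    then have "(\<lambda>n. LINT x|lborel. fourier (u n) ((1 / (4 * pi)) *\<^sub>R x) * ?h x) \<longlonglongrightarrow>
      of_real ((4 * pi) powr (real CARD('n) / 2)) * (- \<i>) ^ (\<Sum>i\<in>UNIV. \<alpha> $ i) * (LINT y|lborel. wt y * f y * ?h y)"
      unfolding fourier_multiplication[OF u(2)] by (rule tendsto_mult_left)
    then show "(LINT x|lborel. g ((1 / (4 * pi)) *\<^sub>R x) * ?h x) =
      of_real ((4 * pi) powr (real CARD('n) / 2)) * (- \<i>) ^ (\<Sum>i\<in>UNIV. \<alpha> $ i) * (LINT y|lborel. wt y * f y * ?h y)"
      by (rule LIMSEQ_unique[OF A])
  qed
qed

text \<open>\<open>fourier_L2\<close> is defined through sequences and the Hermite expansion through the net of finite sets; a common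
  sequence for two nets makes the passage possible.\<close>

lemma finite_subsets_sequence:
  fixes d e :: "'a set \<Rightarrow> ennreal"
  assumes d: "(d \<longlongrightarrow> 0) (finite_subsets_at_top UNIV)" and e: "(e \<longlongrightarrow> 0) (finite_subsets_at_top UNIV)"
  obtains A :: "nat \<Rightarrow> 'a set" where "\<And>n. finite (A n)" "(\<lambda>n. d (A n)) \<longlonglongrightarrow> 0" "(\<lambda>n. e (A n)) \<longlonglongrightarrow> 0"
proof -
  have "\<exists>A. finite A \<and> d A < ennreal (1 / Suc n) \<and> e A < ennreal (1 / Suc n)" for n
  proof -
    have "eventually (\<lambda>A. d A < ennreal (1 / Suc n) \<and> e A < ennreal (1 / Suc n)) (finite_subsets_at_top UNIV)"
      using order_tendstoD(2)[OF d, of "ennreal (1 / Suc n)"] order_tendstoD(2)[OF e, of "ennreal (1 / Suc n)"]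
      by (simp add: eventually_conj)
    then show ?thesis unfolding eventually_finite_subsets_at_top by blast
  qed
  then obtain A where A: "\<And>n. finite (A n)" "\<And>n. d (A n) < ennreal (1 / Suc n)" "\<And>n. e (A n) < ennreal (1 / Suc n)"
    by metis
  have "(\<lambda>n. 1 / real (Suc n)) \<longlonglongrightarrow> 0" by real_asymp
  then have l: "(\<lambda>n. ennreal (1 / Suc n)) \<longlonglongrightarrow> 0" using tendsto_ennrealI by fastforce
  have "(\<lambda>n. d (A n)) \<longlonglongrightarrow> 0"
    by (rule tendsto_sandwich[OF always_eventually always_eventually tendsto_const l]) (simp_all add: less_imp_le A del: of_nat_Suc)
  moreover have "(\<lambda>n. e (A n)) \<longlonglongrightarrow> 0"
    by (rule tendsto_sandwich[OF always_eventually always_eventually tendsto_const l]) (simp_all add: less_imp_le A del: of_nat_Suc)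
  ultimately show ?thesis using A(1) that by blast
qed

lemma integrable_fourier_integrand:
  fixes u :: "real^'n \<Rightarrow> complex"
  assumes u: "integrable lborel u"
  shows "integrable lborel (\<lambda>x. exp (- 2 * of_real pi * \<i> * of_real (\<xi> \<bullet> x)) * u x)"
proof (rule Bochner_Integration.integrable_bound[OF u])
  have [measurable]: "u \<in> borel_measurable borel" using u by auto
  have [measurable]: "(\<lambda>x. exp (- 2 * of_real pi * \<i> * of_real (\<xi> \<bullet> x))) \<in> borel_measurable borel"
    by (intro borel_measurable_continuous_onI continuous_intros)
  show "(\<lambda>x. exp (- 2 * of_real pi * \<i> * of_real (\<xi> \<bullet> x)) * u x) \<in> borel_measurable lborel" by measurable
qed (simp add: norm_mult)

lemma fourier_hermite_sum:
  fixes \<xi> :: "real^'n"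
  assumes A: "finite A"
  shows "fourier (\<lambda>x. wt x * (\<Sum>\<alpha>\<in>A. a \<alpha> * hermite \<alpha> x)) \<xi> =
    of_real ((4 * pi) powr (real CARD('n) / 2)) * (wt ((4 * pi) *\<^sub>R \<xi>) * (\<Sum>\<alpha>\<in>A. (- \<i>) ^ (\<Sum>i\<in>UNIV. \<alpha> $ i) * a \<alpha> * hermite \<alpha> ((4 * pi) *\<^sub>R \<xi>)))"
proof -
  let ?e = "\<lambda>x. exp (- 2 * of_real pi * \<i> * of_real (\<xi> \<bullet> x))"
  have F: "fourier (\<lambda>x. wt x * hermite \<alpha> x) \<xi> = of_real ((4 * pi) powr (real CARD('n) / 2)) * (wt ((4 * pi) *\<^sub>R \<xi>) * ((- \<i>) ^ (\<Sum>i\<in>UNIV. \<alpha> $ i) * hermite \<alpha> ((4 * pi) *\<^sub>R \<xi>)))" for \<alpha>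
    using fourier_hermite[of \<alpha> "(4 * pi) *\<^sub>R \<xi>"] by (simp add: mult.assoc)
  have "fourier (\<lambda>x. wt x * (\<Sum>\<alpha>\<in>A. a \<alpha> * hermite \<alpha> x)) \<xi> = (LINT x|lborel. (\<Sum>\<alpha>\<in>A. a \<alpha> * (?e x * (wt x * hermite \<alpha> x))))"
    unfolding fourier_def sum_distrib_left by (simp only: mult_ac)
  also have "\<dots> = (\<Sum>\<alpha>\<in>A. LINT x|lborel. a \<alpha> * (?e x * (wt x * hermite \<alpha> x)))"
    by (rule Bochner_Integration.integral_sum) (intro integrable_mult_right integrable_fourier_integrand integrable_wt_hermite)
  also have "\<dots> = (\<Sum>\<alpha>\<in>A. a \<alpha> * fourier (\<lambda>x. wt x * hermite \<alpha> x) \<xi>)"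
    unfolding fourier_def integral_mult_right_zero ..
  finally show ?thesis unfolding F by (simp only: sum_distrib_left mult_ac)
qed

text \<open>The weighted partial sums of the Hermite expansion of \<open>f\<close> are integrable, and their Fourier transforms are
  weighted partial sums of the expansion of \<open>ou_group (pi / 2) f\<close>, up to a dilation and a constant factor.
  Both sequences converge in \<open>L\<^sup>2\<close>.\<close>

lemma is_fourier_L2_exists:
  fixes f :: "real^'n \<Rightarrow> complex"
  assumes f: "f \<in> L2 gauss"
  shows "\<exists>g. is_fourier_L2 (\<lambda>y. wt y * f y) g"
proof -
  have fm [measurable]: "f \<in> borel_measurable borel" using f by (rule L2_gauss_measurable)
  let ?c = "hermite_coeff f" and ?C = "complex_of_real ((4 * pi) powr (real CARD('n) / 2))"
  define W where "W = ou_group (pi / 2 + of_int 0 * pi) f"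
  \<comment> \<open>Partial sums of the expansions of \<open>f\<close> and of \<open>W\<close>.\<close>
  define S where "S A x = (\<Sum>\<alpha>\<in>A. ?c \<alpha> * hermite \<alpha> x)" for A x
  define T where "T A x = (\<Sum>\<alpha>\<in>A. (- \<i>) ^ (\<Sum>i\<in>UNIV. \<alpha> $ i) * ?c \<alpha> * hermite \<alpha> x)" for A x
  have WL: "W \<in> L2 gauss" unfolding W_def ou_group_def by (rule ou_calculus_L2[OF f]) simp
  have Wm [measurable]: "W \<in> borel_measurable borel" using WL by (rule L2_gauss_measurable)
  have Sm [measurable]: "S A \<in> borel_measurable borel" for A unfolding S_def[abs_def] by measurable
  have Tm [measurable]: "T A \<in> borel_measurable borel" for A unfolding T_def[abs_def] by measurable
  have T: "L2_tendsto gauss T W (finite_subsets_at_top UNIV)"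
  proof -
    have "L2_tendsto gauss (\<lambda>A x. \<Sum>\<alpha>\<in>A. exp (\<i> * of_real (pi / 2 + of_int 0 * pi) * of_real (ou_eigenvalue \<alpha>)) * ?c \<alpha> * hermite \<alpha> x) W (finite_subsets_at_top UNIV)"
      unfolding W_def ou_group_def by (rule ou_calculus_lim[OF f]) simp
    then show ?thesis unfolding ou_eigenvalue_eq exp_phase_half T_def by simp
  qed
  have S: "L2_tendsto gauss S f (finite_subsets_at_top UNIV)"
  proof -
    have m: "cmod ((\<lambda>_. 1) s) \<le> 1" for s :: real by simp
    \<comment> \<open>The calculus with multiplier \<open>1\<close> is the Hermite expansion of \<open>f\<close> itself; completeness identifies its sum.\<close>
    have "AE x in gauss. ou_calculus (\<lambda>_. 1) f x = f x"
      by (rule AE_eq_if_same_hermite_integrals[OF L2_imp_exp_moments[OF ou_calculus_L2[OF f m]] L2_imp_exp_moments[OF f]]) (simp add: ou_calculus_coeff[OF f m])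
    moreover have "L2_tendsto gauss S (ou_calculus (\<lambda>_. 1) f) (finite_subsets_at_top UNIV)"
      using ou_calculus_lim[OF f m] unfolding S_def by simp
    moreover have "(\<integral>\<^sup>+x. ennreal ((cmod (S A x - ou_calculus (\<lambda>_. 1) f x))\<^sup>2) \<partial>gauss) = (\<integral>\<^sup>+x. ennreal ((cmod (S A x - f x))\<^sup>2) \<partial>gauss)" for A
      using calculation(1) by (intro nn_integral_cong_AE) (auto elim!: eventually_mono)
    ultimately show ?thesis unfolding L2_tendsto_def by simp
  qed
  have "\<exists>A. (\<forall>n. finite (A n)) \<and> L2_tendsto gauss (\<lambda>n. S (A n)) f sequentially \<and> L2_tendsto gauss (\<lambda>n. T (A n)) W sequentially"
    unfolding L2_tendsto_def
    by (rule finite_subsets_sequence[OF S[unfolded L2_tendsto_def] T[unfolded L2_tendsto_def]]) blast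
  then obtain A where A: "\<And>n. finite (A n)" and lS: "L2_tendsto gauss (\<lambda>n. S (A n)) f sequentially"
    and lT: "L2_tendsto gauss (\<lambda>n. T (A n)) W sequentially"
    by blast
  define u where "u n x = wt x * S (A n) x" for n x
  define g where "g \<xi> = ?C * (wt ((4 * pi) *\<^sub>R \<xi>) * W ((4 * pi) *\<^sub>R \<xi>))" for \<xi>
  have "g \<in> L2 lborel"
    unfolding g_def[abs_def] by (rule L2_lborel_dilate[OF _ L2_wt[OF WL]]) simp
  moreover have "u n \<in> L2 lborel" for n
    unfolding u_def[abs_def] S_def by (rule L2_wt[OF hermite_sum_L2[OF A]])
  moreover have "integrable lborel (u n)" for n
  proof -
    have "u n = (\<lambda>x. \<Sum>\<alpha>\<in>A n. ?c \<alpha> * (wt x * hermite \<alpha> x))"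
      unfolding u_def S_def sum_distrib_left by (simp only: mult_ac)
    then show ?thesis by (simp only:) (intro Bochner_Integration.integrable_sum integrable_mult_right integrable_wt_hermite)
  qed
  moreover have "L2_tendsto lborel u (\<lambda>y. wt y * f y) sequentially"
    unfolding u_def by (rule L2_tendsto_wt[OF Sm fm lS])
  moreover have "L2_tendsto lborel (\<lambda>n. fourier (u n)) g sequentially"
  proof -
    have "L2_tendsto lborel (\<lambda>n x. ?C * (wt ((4 * pi) *\<^sub>R x) * T (A n) ((4 * pi) *\<^sub>R x))) (\<lambda>x. ?C * (wt ((4 * pi) *\<^sub>R x) * W ((4 * pi) *\<^sub>R x))) sequentially"
      by (rule L2_tendsto_dilate[OF _ _ _ L2_tendsto_wt[OF Tm Wm lT]]) simp_all
    moreover have "fourier (u n) = (\<lambda>\<xi>. ?C * (wt ((4 * pi) *\<^sub>R \<xi>) * T (A n) ((4 * pi) *\<^sub>R \<xi>)))" for n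
      unfolding u_def[abs_def] S_def T_def by (rule ext) (rule fourier_hermite_sum[OF A])
    ultimately show ?thesis unfolding g_def[abs_def] by simp
  qed
  ultimately show ?thesis unfolding is_fourier_L2_def by blast
qed

lemma ou_group_half_fourier_L2:
  fixes f :: "real^'n \<Rightarrow> complex"
  assumes f: "f \<in> L2 gauss"
  shows "AE x in gauss. wt x * ou_group (pi / 2 + of_int k * pi) f x =
     of_real ((4 * pi) powr (- real CARD('n) / 2)) * fourier_L2 (\<lambda>y. wt y * f y) ((parity_sign k / (4 * pi)) *\<^sub>R x)"
proof (rule ou_group_half_is_fourier_L2[OF f])
  show "is_fourier_L2 (\<lambda>y. wt y * f y) (fourier_L2 (\<lambda>y. wt y * f y))"
    using someI_ex[OF is_fourier_L2_exists[OF f]] unfolding fourier_L2_def is_fourier_L2_def .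
qed

section \<open>Rapidly decreasing functions\<close>

lemma integrable_inverse_1_plus_square_real: "integrable lborel (\<lambda>t::real. inverse (1 + t\<^sup>2))"
  using integrable_inverse_1_plus_square by (simp add: set_integrable_def)

lemma integrable_vec_decay: "integrable lborel (\<lambda>x::real^'n. \<Prod>i\<in>UNIV. complex_of_real (inverse (1 + (x $ i)\<^sup>2)))"
  by (rule integrable_lborel_prod) (intro integrable_of_real integrable_inverse_1_plus_square_real)

lemma prod_one_plus_square_le:
  fixes x :: "real^'n"
  shows "(\<Prod>i\<in>UNIV. 1 + (x $ i)\<^sup>2) \<le> 2 ^ CARD('n) * (1 + norm x ^ (2 * CARD('n)))"
proof -
  have "(\<Prod>i\<in>UNIV. 1 + (x $ i)\<^sup>2) \<le> (\<Prod>i\<in>(UNIV::'n set). 1 + (norm x)\<^sup>2)"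
    using component_le_norm_cart[of x] by (intro prod_mono) (auto simp: abs_le_square_iff[symmetric])
  also have "\<dots> = (1 + (norm x)\<^sup>2) ^ CARD('n)" by simp
  also have "\<dots> \<le> 2 ^ CARD('n) * (1 + ((norm x)\<^sup>2) ^ CARD('n))"
  proof (cases "(norm x)\<^sup>2 \<le> 1")
    case True
    then have "(1 + (norm x)\<^sup>2) ^ CARD('n) \<le> 2 ^ CARD('n) * 1" by (simp add: power_mono)
    also have "\<dots> \<le> 2 ^ CARD('n) * (1 + ((norm x)\<^sup>2) ^ CARD('n))" by (intro mult_left_mono) auto
    finally show ?thesis .
  next
    case False
    then have "(1 + (norm x)\<^sup>2) ^ CARD('n) \<le> (2 * (norm x)\<^sup>2) ^ CARD('n)" by (intro power_mono) auto
    also have "\<dots> \<le> 2 ^ CARD('n) * (1 + ((norm x)\<^sup>2) ^ CARD('n))" by (simp add: power_mult_distrib)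
    finally show ?thesis .
  qed
  finally show ?thesis by (simp add: power_mult)
qed

text \<open>Decay of order \<open>2 d\<close> bounds the function by a constant times \<open>\<Prod>\<^sub>i 1 / (1 + x\<^sub>i\<^sup>2)\<close>, whose integral factors.\<close>

lemma schwartz_integrable_L2:
  fixes F :: "real^'n \<Rightarrow> complex"
  assumes F: "F \<in> schwartz" and [measurable]: "F \<in> borel_measurable borel"
  shows "integrable lborel F" "F \<in> L2 lborel"
proof -
  have b: "bounded (range (\<lambda>x. norm x ^ N *\<^sub>R F x))" for N
    using F unfolding schwartz_def by (auto dest!: spec[of _ "[]"] simp: partials_def)
  obtain B0 where B0: "\<And>x. cmod (F x) \<le> B0" using b[of 0] by (auto simp: bounded_iff)
  obtain B1 where B1: "\<And>x. norm x ^ (2 * CARD('n)) * cmod (F x) \<le> B1"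
    using b[of "2 * CARD('n)"] by (auto simp: bounded_iff)
  let ?p = "\<lambda>x::real^'n. \<Prod>i\<in>UNIV. complex_of_real (inverse (1 + (x $ i)\<^sup>2))"
  let ?C = "2 ^ CARD('n) * (B0 + B1)"
  show i: "integrable lborel F"
  proof (rule Bochner_Integration.integrable_bound)
    show "integrable lborel (\<lambda>x. of_real ?C * ?p x)" by (intro integrable_mult_right integrable_vec_decay)
    show "AE x in lborel. norm (F x) \<le> norm (of_real ?C * ?p x)"
    proof (rule AE_I2)
      fix x :: "real^'n"
      have pos: "(\<Prod>i\<in>UNIV. 1 + (x $ i)\<^sup>2) > 0" by (intro prod_pos) (auto intro: add_pos_nonneg)
      have "cmod (F x) * (\<Prod>i\<in>UNIV. 1 + (x $ i)\<^sup>2) \<le> cmod (F x) * (2 ^ CARD('n) * (1 + norm x ^ (2 * CARD('n))))"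
        by (intro mult_left_mono prod_one_plus_square_le) auto
      also have "\<dots> = 2 ^ CARD('n) * (cmod (F x) + norm x ^ (2 * CARD('n)) * cmod (F x))" by (simp add: algebra_simps)
      also have "\<dots> \<le> ?C" by (intro mult_left_mono add_mono B0 B1) auto
      finally have le: "cmod (F x) \<le> ?C * inverse (\<Prod>i\<in>UNIV. 1 + (x $ i)\<^sup>2)" using pos by (simp add: field_simps)
      have "?p x = of_real (inverse (\<Prod>i\<in>UNIV. 1 + (x $ i)\<^sup>2))"
        by (simp only: of_real_prod[symmetric] prod_inversef[symmetric] o_def)
      then have "of_real ?C * ?p x = of_real (?C * inverse (\<Prod>i\<in>UNIV. 1 + (x $ i)\<^sup>2))" by (simp only: of_real_mult)
      then show "norm (F x) \<le> norm (of_real ?C * ?p x)"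
        using le by (simp only: norm_of_real)
    qed
  qed simp
  have "integrable lborel (\<lambda>x. (cmod (F x))\<^sup>2)"
  proof (rule Bochner_Integration.integrable_bound)
    show "integrable lborel (\<lambda>x. B0 * cmod (F x))" using i by simp
    have "(cmod (F x))\<^sup>2 \<le> B0 * cmod (F x)" for x
      using mult_right_mono[OF B0 norm_ge_zero] by (simp add: power2_eq_square)
    then show "AE x in lborel. norm ((cmod (F x))\<^sup>2) \<le> norm (B0 * cmod (F x))"
      by (auto intro: order_trans[OF _ abs_ge_self])
  qed simp
  then show "F \<in> L2 lborel" by (simp add: L2_def)
qed

lemma K_space_L2:
  fixes \<phi> :: "real^'n \<Rightarrow> complex"
  assumes \<phi>: "\<phi> \<in> K_space"
  shows "\<phi> \<in> L2 gauss" "integrable lborel (\<lambda>y. wt y * \<phi> y)"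
proof -
  have "\<phi> differentiable (at x)" for x
    using \<phi> unfolding K_space_def smooth_def by (auto dest!: spec[of _ "[]"] simp: partials_def)
  then have "continuous_on UNIV \<phi>"
    by (simp add: continuous_on_eq_continuous_at differentiable_imp_continuous_within)
  then have [measurable]: "\<phi> \<in> borel_measurable borel" by (rule borel_measurable_continuous_onI)
  have "(\<lambda>y. wt y * \<phi> y) \<in> schwartz" using \<phi> by (simp add: K_space_def)
  note * = schwartz_integrable_L2[OF this]
  show "integrable lborel (\<lambda>y. wt y * \<phi> y)" by (rule *) measurable
  have "(\<lambda>y. wt y * \<phi> y) \<in> L2 lborel" by (rule *) measurable
  then show "\<phi> \<in> L2 gauss" by (rule iffD1[OF L2_wt_iff, rotated]) measurable
qed

section \<open>Iterated reflections\<close>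

lemma int_iterate_reflect: "int_iterate reflect k f x = f (parity_sign k *\<^sub>R x)"
proof -
  have rr: "reflect (reflect f) = f" for f :: "real^'a \<Rightarrow> complex" by (rule ext) (simp add: reflect_def)
  have "inv reflect = (reflect :: (real^'a \<Rightarrow> complex) \<Rightarrow> _)"
    by (rule inv_equality) (rule rr)+
  then have "int_iterate reflect k f = (reflect ^^ nat \<bar>k\<bar>) f" by (simp add: int_iterate_def)
  moreover have "(reflect ^^ n) f x = f ((-1) ^ n *\<^sub>R x)" for n and x :: "real^'a"
    by (induction n arbitrary: x) (simp_all add: reflect_def)
  moreover have "(-1) ^ nat \<bar>k\<bar> = parity_sign k"
    by (simp add: power_int_minus_left minus_one_power_iff even_nat_iff)
  ultimately show ?thesis by simp
qed

theorem corollary2p2: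
  shows
    "(\<forall>\<phi> \<in> (K_space :: (real ^ 'n \<Rightarrow> complex) set). \<forall>k::int.
        (AE x in gauss. ou_group (of_int k * pi) \<phi> x = \<phi> (((-1) powi k) *\<^sub>R x)) \<and>
        (\<forall>x. \<phi> (((-1) powi k) *\<^sub>R x) = int_iterate reflect k \<phi> x) \<and>
        (AE x in gauss.
           of_real (exp (- (norm x)\<^sup>2 / 4)) * ou_group (pi / 2 + of_int k * pi) \<phi> x =
           of_real ((4 * pi) powr (- real CARD('n) / 2)) *
             fourier (\<lambda>y. of_real (exp (- (norm y)\<^sup>2 / 4)) * \<phi> y)
               (((-1) powi k / (4 * pi)) *\<^sub>R x))) \<and>
     (\<forall>f \<in> L2 (gauss :: (real ^ 'n) measure).
        (AE x in gauss. ou_group pi f x = reflect f x) \<and>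
        (AE x in gauss. ou_group (2 * pi) f x = f x)) \<and>
     (\<forall>f \<in> L2 (gauss :: (real ^ 'n) measure). \<forall>k::int.
        (AE x in gauss. ou_group (of_int k * pi) f x = f (((-1) powi k) *\<^sub>R x)) \<and>
        (AE x in gauss. f (((-1) powi k) *\<^sub>R x) = int_iterate reflect k f x) \<and>
        (AE x in gauss.
           of_real (exp (- (norm x)\<^sup>2 / 4)) * ou_group (pi / 2 + of_int k * pi) f x =
           of_real ((4 * pi) powr (- real CARD('n) / 2)) *
             fourier_L2 (\<lambda>y. of_real (exp (- (norm y)\<^sup>2 / 4)) * f y)
               (((-1) powi k / (4 * pi)) *\<^sub>R x)))"
proof (intro conjI ballI allI)
  fix \<phi> :: "real^'n \<Rightarrow> complex" and k :: int
  assume \<phi>: "\<phi> \<in> K_space"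
  show "AE x in gauss. ou_group (of_int k * pi) \<phi> x = \<phi> (((-1) powi k) *\<^sub>R x)"
    by (rule ou_group_pi[OF K_space_L2(1)[OF \<phi>]])
  show "\<phi> (((-1) powi k) *\<^sub>R x) = int_iterate reflect k \<phi> x" for x
    by (rule int_iterate_reflect[symmetric])
  show "AE x in gauss.
           of_real (exp (- (norm x)\<^sup>2 / 4)) * ou_group (pi / 2 + of_int k * pi) \<phi> x =
           of_real ((4 * pi) powr (- real CARD('n) / 2)) *
             fourier (\<lambda>y. of_real (exp (- (norm y)\<^sup>2 / 4)) * \<phi> y)
               (((-1) powi k / (4 * pi)) *\<^sub>R x)"
    by (rule ou_group_half_fourier[OF K_space_L2[OF \<phi>]])
next
  fix f :: "real^'n \<Rightarrow> complex"
  assume f: "f \<in> L2 gauss"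
  show "AE x in gauss. ou_group pi f x = reflect f x"
    using ou_group_pi[OF f, of 1] by (simp add: reflect_def)
  show "AE x in gauss. ou_group (2 * pi) f x = f x"
    using ou_group_pi[OF f, of 2] by simp
next
  fix f :: "real^'n \<Rightarrow> complex" and k :: int
  assume f: "f \<in> L2 gauss"
  show "AE x in gauss. ou_group (of_int k * pi) f x = f (((-1) powi k) *\<^sub>R x)"
    by (rule ou_group_pi[OF f])
  show "AE x in gauss. f (((-1) powi k) *\<^sub>R x) = int_iterate reflect k f x"
    by (simp add: int_iterate_reflect)
  show "AE x in gauss.
           of_real (exp (- (norm x)\<^sup>2 / 4)) * ou_group (pi / 2 + of_int k * pi) f x =
           of_real ((4 * pi) powr (- real CARD('n) / 2)) *
             fourier_L2 (\<lambda>y. of_real (exp (- (norm y)\<^sup>2 / 4)) * f y)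
               (((-1) powi k / (4 * pi)) *\<^sub>R x)"
    by (rule ou_group_half_fourier_L2[OF f])
qed

end
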